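(* Fix an integer $m\ge 1$. There exist constants $\alpha,\beta>0$ such that for every even integer $k=12\ell+k'$ with $k'\in\{0,4,6,8,10,14\}$ and $\ell>\alpha m+\beta$, all the zeros of $g_{k,m}$ in the fundamental domain $\mathcal{F}$ lie on the arc $\mathcal{A}=\{e^{i\theta}:\frac{\pi}{2}\le\theta\le\frac{2\pi}{3}\}$. Moreover, these zeros become uniformly distributed on $\mathcal{A}$ as $k\to\infty$: for every $\frac{\pi}{2}\le a<b\le\frac{2\pi}{3}$, the proportion of the zeros of $g_{k,m}$ in $\mathcal{F}$ (counted with multiplicity) of the form $e^{i\theta}$ with $\theta\in[a,b]$ tends to $\frac{b-a}{2\pi/3-\pi/2}$ as $k\to\infty$.
   Context: $\mathbb{H}$ is the upper half plane and $q=e^{2\pi i\tau}$. For an even integer $k\ge0$, $M_k$ denotes the space of holomorphic modular forms of weight $k$ for $\mathrm{PSL}_2(\mathbb{Z})$. Every even $k\ge 0$ with $k\neq 2$ is written uniquely as $k=12\ell+k'$ with $\ell\ge0$ an integer and $k'\in\{0,4,6,8,10,14\}$. For $1\le m\le\ell$, $g_{k,m}$ denotes the unique form in $M_k$ whose $q$-expansion is $g_{k,m}(\tau)=q^m+O(q^{\ell+1})$ (the cusp forms of the Miller basis). The fundamental domain is $\mathcal{F}=\{z\in\mathbb{H}:|z|\ge1,\,-\frac12\le\operatorname{Re}z\le0\}\cup\{z\in\mathbb{H}:|z|>1,\,0<\operatorname{Re}z<\frac12\}$. "Zeros in $\mathcal{F}$" means zeros at points of $\mathcal{F}\subset\mathbb{H}$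 (not the vanishing at infinity). *)

theory Defs
  imports "HOL-Complex_Analysis.Complex_Analysis"
begin

definition upper_half_plane :: "complex set" where
  "upper_half_plane = {z. Im z > 0}"

text \<open>Holomorphic modular forms of weight k for PSL2(Z): holomorphic on H,
  invariant under the weight-k action of the generators T and S,
  and bounded as Im tau tends to infinity (holomorphic at the cusp).\<close>
definition modular_form :: "nat \<Rightarrow> (complex \<Rightarrow> complex) \<Rightarrow> bool" where
  "modular_form k f \<longleftrightarrow>
     f holomorphic_on upper_half_plane \<and>
     (\<forall>z\<in>upper_half_plane. f (z + 1) = f z \<and> f (- 1 / z) = z ^ k * f z) \<and>
     (\<exists>B. \<forall>z. Im z \<ge> 1 \<longrightarrow> norm (f z) \<le> B)"

definition has_q_expansion :: "(complex \<Rightarrow> complex) \<Rightarrow> (nat \<Rightarrow> complex) \<Rightarrow> bool" where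
  "has_q_expansion f a \<longleftrightarrow>
     (\<forall>z\<in>upper_half_plane. (\<lambda>n. a n * exp (2 * pi * \<i> * of_nat n * z)) sums f z)"

definition miller_form :: "nat \<Rightarrow> nat \<Rightarrow> nat \<Rightarrow> (complex \<Rightarrow> complex) \<Rightarrow> bool" where
  "miller_form k l m f \<longleftrightarrow> modular_form k f \<and>
     (\<exists>a. has_q_expansion f a \<and> a m = 1 \<and> (\<forall>n\<le>l. n \<noteq> m \<longrightarrow> a n = 0))"

definition fundamental_domain :: "complex set" where
  "fundamental_domain =
     {z. Im z > 0 \<and> norm z \<ge> 1 \<and> - 1/2 \<le> Re z \<and> Re z \<le> 0} \<union>
     {z. Im z > 0 \<and> norm z > 1 \<and> 0 < Re z \<and> Re z < 1/2}"

definition arcA :: "complex set" where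
  "arcA = {exp (\<i> * of_real \<theta>) | \<theta>. pi / 2 \<le> \<theta> \<and> \<theta> \<le> 2 * pi / 3}"

definition zero_count :: "(complex \<Rightarrow> complex) \<Rightarrow> complex set \<Rightarrow> int" where
  "zero_count f S = (\<Sum>z\<in>{z\<in>S. f z = 0}. zorder f z)"

end

theory Submission
  imports Defs
begin

text \<open>
  Let \<open>q = exp (2 \<pi> i z)\<close> and write \<open>f = g_{k,m}\<close>. Instead of the contour integral over a generating function, the
  proof compares \<open>f\<close> with the truncated Poincare series \<open>q^m + S(z)\<close>, where \<open>S(z)\<close> is the sum over the integers \<open>d\<close>
  of \<open>exp (-2 \<pi> i m / (z + d)) / (z + d)^k\<close>. It is periodic, and its defect under \<open>z \<mapsto> -1/z\<close> is exponentially small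
  near the fundamental domain. After removal of the first Fourier coefficients (bounded on \<open>Im z = 2\<close>), the difference
  \<open>T\<close> vanishes at the cusp to a higher order than \<open>\<Delta>^(k/12)\<close>; hence \<open>|T / \<eta>^(2k)|\<close> is maximal on \<open>Im z = 4/5\<close>, a point
  of that line is moved up by \<open>z \<mapsto> -1/z\<close>, and the maximum is bounded by a multiple of the defect. Thus
  \<open>f(z) = q^m + S(z)\<close> up to \<open>O(k exp (-k/50))\<close> for \<open>4/5 \<le> Im z \<le> 2\<close>, and only \<open>d = 0\<close> and \<open>d = 1\<close> matter in the left half
  of the fundamental domain.

  On the arc the terms \<open>q^m\<close> and \<open>d = 0\<close> add up to \<open>2 cos (k \<theta>/2 + 2 \<pi> m cos \<theta>)\<close> after normalisation, while the
  term \<open>d = 1\<close> has size less than \<open>1\<close> away from \<open>\<rho> = exp (2 \<pi> i / 3)\<close>. Together with a derivative bound this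
  gives exactly one zero, a simple and real one, per half period of the cosine, and excludes nearby zeros with
  non-real \<open>\<theta>\<close>. Higher up, \<open>q^m\<close> dominates. Within \<open>O(1/k)\<close> of \<open>\<rho>\<close> all three terms have the same size, and \<open>f\<close> is
  close to an explicit function of \<open>u = k (z - \<rho>)\<close> that vanishes at \<open>u = 0\<close> to the order forced on \<open>f\<close> by the weight
  and has no other zero nearby. Counting half periods gives the distribution.
\<close>

section \<open>Partial fractions of the cotangent\<close>

text \<open>Most constants serve one narrow margin. On \<open>Im z = 2\<close> the series
  \<open>S\<close> is bounded by \<open>35 / 2^k\<close>, so removing its Fourier coefficients of
  index \<open>n \<le> k / 12\<close> costs about \<open>exp ((\<pi>/3 - ln 2) k)\<close> after
  division by \<open>\<eta>^(2k)\<close>, while undoing the division at height \<open>4/5\<close>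
  gains about \<open>exp (- 2 \<pi> k / 15)\<close>. With the error in \<open>\<eta>\<close> and the
  case \<open>k' = 14\<close> the sum of the exponents is still below \<open>- k / 50\<close>. The
  height \<open>4/5\<close> lies under \<open>sqrt 3 / 2\<close>, which leaves a complex
  neighbourhood of the arc for Cauchy estimates. The corner is a genuine obstacle for the cosine
  argument. Value and derivative of the term \<open>d = 1\<close> are essentially bounded by
  \<open>c\<close> and, in units of \<open>k / 2\<close>, by \<open>sqrt 3 * c\<close>, and what is
  needed is \<open>c^2 + 3 c^2 < 4\<close>; this degenerates to an equality at \<open>rho\<close>.
  Hence the separate local analysis at scale \<open>1 / k\<close>, whose range overlaps that of the
  cosine argument. Reality on the arc rests on the uniqueness of the Miller form, which the same
  maximum argument yields with defect 0.\<close>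

lemma one_minus_not_Ints:
  fixes z :: "'a :: ring_1"
  assumes "z \<notin> \<int>"
  shows "1 - z \<notin> \<int>"
proof
  assume "1 - z \<in> \<int>"
  then have "1 - (1 - z) \<in> \<int>" by (intro Ints_diff) auto
  with assms show False by simp
qed

lemma sin_pi_times_nonzero:
  fixes z :: complex
  assumes "z \<notin> \<int>"
  shows "sin (pi * z) \<noteq> 0"
proof
  assume "sin (pi * z) = 0"
  then obtain n :: int where "complex_of_real pi * z = of_real (n * pi)" unfolding sin_eq_0 by blast
  then have "complex_of_real pi * z = of_real pi * of_int n" by (simp add: mult.commute)
  then have "z = of_int n" by simp
  with assms show False by simp
qed

text \<open>The reflection formula \<open>Gamma z * Gamma (1 - z) = pi / sin (pi * z)\<close> is
  differentiated on both sides, and the common nonzero factor \<open>pi / sin (pi * z)\<close> is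
  cancelled.\<close>

lemma cot_eq_Digamma_diff:
  fixes z :: complex
  assumes z: "z \<notin> \<int>"
  shows "pi * cot (pi * z) = Digamma (1 - z) - Digamma z"
proof -
    note z1 = one_minus_not_Ints[OF z]
    have nz: "z \<notin> \<int>\<^sub>\<le>\<^sub>0" "1 - z \<notin> \<int>\<^sub>\<le>\<^sub>0" using z z1 nonpos_Ints_subset_Ints by auto
    note sz = sin_pi_times_nonzero[OF z]
    have D1: "((\<lambda>z. Gamma z * Gamma (1 - z)) has_field_derivative
       (Gamma z * Gamma (1 - z) * (Digamma z - Digamma (1 - z)))) (at z)"
      using nz by (auto intro!: derivative_eq_intros simp: algebra_simps)
    have D2: "((\<lambda>z::complex. pi / sin (pi * z)) has_field_derivative (- pi * (pi * cos (pi * z)) / (sin (pi * z))^2)) (at z)"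
      using sz by (auto intro!: derivative_eq_intros simp: power2_eq_square)
    have "(\<lambda>z. Gamma z * Gamma (1 - z)) = (\<lambda>z::complex. pi / sin (pi * z))"
      using Gamma_reflection_complex by auto
    with D1 D2 have "Gamma z * Gamma (1 - z) * (Digamma z - Digamma (1 - z)) = - pi * (pi * cos (pi * z)) / (sin (pi * z))^2"
      by (simp add: DERIV_unique)
    then have "pi / sin (pi * z) * (Digamma z - Digamma (1 - z)) = - pi * (pi * cos (pi * z)) / (sin (pi * z))^2"
      using Gamma_reflection_complex by simp
    then have "(pi / sin (pi * z)) * (Digamma z - Digamma (1 - z)) = (pi / sin (pi * z)) * (- (pi * cot (pi * z)))"
      by (simp add: power2_eq_square cot_def)
    then have "Digamma z - Digamma (1 - z) = - (pi * cot (pi * z))"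
      using sz by (subst (asm) mult_left_cancel) auto
    then show ?thesis by (simp add: algebra_simps)
qed

text \<open>The series of \<open>Digamma\<close> at \<open>1 - w\<close> and at \<open>1 + w\<close>
  contain the same harmonic terms; these cancel in the difference and leave the conditionally
  convergent sum with \<open>n\<close> and \<open>-n\<close> paired.\<close>

lemma cot_partial_fractions:
  fixes w :: complex
  assumes "w \<notin> \<int>"
  shows "(\<lambda>n. 1 / (w + of_nat (Suc n)) + 1 / (w - of_nat (Suc n))) sums (pi * cot (pi * w) - 1 / w)"
proof -
  have w1: "w \<noteq> 0" "1 + w \<noteq> 0" "1 - w \<noteq> 0"
    using assms by (auto simp: add_eq_0_iff)
  have S: "(\<lambda>n. inverse (of_nat (Suc n)) - inverse (z + of_nat n)) sums (Digamma z + euler_mascheroni)"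
     if "z \<noteq> 0" for z :: complex
    using summable_sums[OF summable_Digamma[OF that]] unfolding Digamma_def by simp
  have "(\<lambda>n. (inverse (of_nat (Suc n)) - inverse ((1 - w) + of_nat n)) - (inverse (of_nat (Suc n)) - inverse ((1 + w) + of_nat n)))
     sums ((Digamma (1 - w) + euler_mascheroni) - (Digamma (1 + w) + euler_mascheroni))"
    by (intro sums_diff S w1)
  moreover have "Digamma (1 + w) = Digamma w + 1 / w"
    using Digamma_plus1[of w] w1 by (simp add: add.commute)
  moreover have "(inverse (of_nat (Suc n)) - inverse ((1 - w) + of_nat n)) - (inverse (of_nat (Suc n)) - inverse ((1 + w) + of_nat n))
      = 1 / (w + of_nat (Suc n)) + 1 / (w - of_nat (Suc n))" for n
  proof -
    have "(1 - w) + of_nat n = - (w - of_nat (Suc n))" "(1 + w) + of_nat n = w + of_nat (Suc n)" by simp_all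
    then show ?thesis by (simp only: inverse_minus_eq divide_inverse) simp
  qed
  ultimately show ?thesis using cot_eq_Digamma_diff[OF assms] by (simp add: diff_diff_eq)
qed

lemma has_sum_int_nonzero:
  fixes f :: "int \<Rightarrow> 'a :: banach"
  assumes "summable (\<lambda>n. norm (f (int (Suc n))))" "summable (\<lambda>n. norm (f (- int (Suc n))))"
  shows "(f has_sum ((\<Sum>n. f (int (Suc n))) + (\<Sum>n. f (- int (Suc n))))) (- {0})"
proof -
  have 1: "((\<lambda>n. f (int (Suc n))) has_sum (\<Sum>n. f (int (Suc n)))) UNIV"
    by (rule norm_summable_imp_has_sum[OF assms(1) summable_sums[OF summable_norm_cancel[OF assms(1)]]])
  have 2: "((\<lambda>n. f (- int (Suc n))) has_sum (\<Sum>n. f (- int (Suc n)))) UNIV"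
    by (rule norm_summable_imp_has_sum[OF assms(2) summable_sums[OF summable_norm_cancel[OF assms(2)]]])
  have i1: "inj (\<lambda>n. int (Suc n))" "inj (\<lambda>n. - int (Suc n))" by (auto simp: inj_on_def)
  have 3: "(f has_sum (\<Sum>n. f (int (Suc n)))) (range (\<lambda>n. int (Suc n)))"
    using has_sum_reindex[OF i1(1), of f] 1 by (simp add: o_def)
  have 4: "(f has_sum (\<Sum>n. f (- int (Suc n)))) (range (\<lambda>n. - int (Suc n)))"
    using has_sum_reindex[OF i1(2), of f] 2 by (simp add: o_def)
  have r1: "range (\<lambda>n. int (Suc n)) = {0<..}"
  proof (intro equalityI subsetI)
    fix x :: int assume "x \<in> {0<..}"
    then have "x = int (Suc (nat (x - 1)))" by auto
    then show "x \<in> range (\<lambda>n. int (Suc n))" by blast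
  qed auto
  have r2: "range (\<lambda>n. - int (Suc n)) = {..<0}"
  proof (intro equalityI subsetI)
    fix x :: int assume "x \<in> {..<0}"
    then have "x = - int (Suc (nat (- x - 1)))" by auto
    then show "x \<in> range (\<lambda>n. - int (Suc n))" by blast
  qed auto
  have e: "- {0::int} = {0<..} \<union> {..<0}" by (auto simp: set_eq_iff)
  show ?thesis unfolding e using 3 4 unfolding r1 r2 by (rule has_sum_Un_disjoint) (auto simp: disjoint_iff)
qed

lemma has_sum_int:
  fixes f :: "int \<Rightarrow> 'a :: banach"
  assumes "summable (\<lambda>n. norm (f (int (Suc n))))" "summable (\<lambda>n. norm (f (- int (Suc n))))"
  shows "(f has_sum (f 0 + (\<Sum>n. f (int (Suc n))) + (\<Sum>n. f (- int (Suc n))))) UNIV"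
proof -
  have "(f has_sum (f 0 + ((\<Sum>n. f (int (Suc n))) + (\<Sum>n. f (- int (Suc n)))))) (insert 0 (- {0}))"
    by (intro has_sum_insert has_sum_int_nonzero assms) auto
  moreover have "insert 0 (- {0}) = (UNIV :: int set)" by auto
  ultimately show ?thesis by (simp add: add.assoc)
qed

lemma cmod_add_of_int_ge:
  fixes w :: complex and d :: int
  assumes "\<bar>real_of_int d\<bar> \<ge> 2 * norm w"
  shows "norm (w + of_int d) \<ge> \<bar>real_of_int d\<bar> / 2"
proof -
  have "norm (of_int d :: complex) \<le> norm (w + of_int d) + norm w"
    using norm_triangle_ineq4[of "w + of_int d" w] by simp
  then show ?thesis using assms by simp
qed

lemma summable_inverse_square_shift: "summable (\<lambda>n. 1 / (real (Suc n))^2)"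
  using inverse_power_summable[of 2, where 'a = real] by (subst summable_Suc_iff) (simp add: field_simps)

lemma summable_int_inverse_square:
  fixes w :: complex and f :: "nat \<Rightarrow> int"
  assumes f: "\<And>n. \<bar>f n\<bar> = int (Suc n)"
  shows "summable (\<lambda>n. norm (1 / (w + of_int (f n))^2))"
proof (rule summable_comparison_test_ev)
  show "summable (\<lambda>n. 4 * (1 / (real (Suc n))^2))"
    using summable_inverse_square_shift by (rule summable_mult)
  show "\<forall>\<^sub>F n in sequentially. norm (norm (1 / (w + of_int (f n))^2)) \<le> 4 * (1 / (real (Suc n))^2)"
    using eventually_ge_at_top[of "nat \<lceil>2 * norm w\<rceil>"]
  proof eventually_elim
    case (elim n)
    have fn: "\<bar>real_of_int (f n)\<bar> = real (Suc n)"
      using f[of n] by (metis of_int_abs of_int_of_nat_eq)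
    have "norm (w + of_int (f n)) \<ge> real (Suc n) / 2"
      using cmod_add_of_int_ge[of w "f n"] elim unfolding fn by linarith
    then have "norm (w + of_int (f n))^2 \<ge> (real (Suc n) / 2)^2" by (intro power_mono) auto
    then have "1 / norm (w + of_int (f n))^2 \<le> 1 / (real (Suc n) / 2)^2"
      by (intro frac_le) (simp_all del: of_nat_Suc)
    then show ?case by (simp add: norm_divide norm_power power_divide del: of_nat_Suc)
  qed
qed

text \<open>This is the derivative of the identity between the cotangent and \<open>Digamma\<close>:
  \<open>Polygamma 1 w\<close> supplies the terms \<open>d \<ge> 0\<close> and
  \<open>Polygamma 1 (1 - w)\<close> the terms \<open>d < 0\<close>. The sum is now absolutely
  convergent and can be stated as an unordered one.\<close>

lemma csc_square_partial_fractions: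
  fixes w :: complex
  assumes "w \<notin> \<int>"
  shows "((\<lambda>d::int. 1 / (w + of_int d)^2) has_sum (pi^2 / (sin (pi * w))^2)) UNIV"
proof -
  note w1 = one_minus_not_Ints[OF assms]
  have nz: "w \<notin> \<int>\<^sub>\<le>\<^sub>0" "1 - w \<notin> \<int>\<^sub>\<le>\<^sub>0" using assms w1 nonpos_Ints_subset_Ints by auto
  note sz = sin_pi_times_nonzero[OF assms]
  have D1: "((\<lambda>z. Digamma (1 - z) - Digamma z) has_field_derivative (- Polygamma 1 (1 - w) - Polygamma 1 w)) (at w)"
    using nz by (auto intro!: derivative_eq_intros)
  have "((\<lambda>z. cos (pi * z) / sin (pi * z)) has_field_derivative
      ((- (pi * sin (pi * w)) * sin (pi * w) - cos (pi * w) * (pi * cos (pi * w))) / (sin (pi * w) * sin (pi * w)))) (at w)"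
    using sz by (auto intro!: derivative_eq_intros)
  moreover have "(- (pi * sin (pi * w)) * sin (pi * w) - cos (pi * w) * (pi * cos (pi * w))) = - pi * ((sin (pi * w))^2 + (cos (pi * w))^2)"
    unfolding power2_eq_square by (simp only: distrib_left) simp
  ultimately have "((\<lambda>z. cot (pi * z)) has_field_derivative (- pi / (sin (pi * w))^2)) (at w)"
    by (simp add: cot_def) (simp add: power2_eq_square)
  from DERIV_cmult[OF this, of "complex_of_real pi"]
  have "((\<lambda>z. pi * cot (pi * z)) has_field_derivative (- (pi^2 / (sin (pi * w))^2))) (at w)"
    by (simp add: power2_eq_square)
  moreover have "\<forall>\<^sub>F z in nhds w. pi * cot (pi * z) = Digamma (1 - z) - Digamma z"
    using eventually_nhds_in_open[of "- \<int>" w] assms closed_Ints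
    by (auto elim!: eventually_mono simp: cot_eq_Digamma_diff open_Compl)
  ultimately have "((\<lambda>z. Digamma (1 - z) - Digamma z) has_field_derivative (- (pi^2 / (sin (pi * w))^2))) (at w)"
    by (simp add: DERIV_cong_ev)
  with D1 have E: "Polygamma 1 (1 - w) + Polygamma 1 w = pi^2 / (sin (pi * w))^2"
    by (metis (no_types, lifting) DERIV_unique minus_add minus_minus uminus_add_conv_diff add.commute diff_conv_add_uminus)
  have P: "(\<lambda>n. inverse ((z + of_nat n)^2)) sums Polygamma 1 z" if "z \<noteq> 0" for z :: complex
    using summable_sums[OF Polygamma_converges'[OF that, of 2]] by (simp add: Polygamma_def eval_nat_numeral)
  have nw: "w \<noteq> 0" "1 - w \<noteq> 0" using nz by auto
  have "(\<lambda>n. inverse ((w + of_nat (Suc n))^2)) sums (Polygamma 1 w - inverse (w^2))"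
    using P[OF nw(1)] by (subst sums_Suc_iff) simp
  then have s1: "(\<Sum>n. 1 / (w + of_int (int (Suc n)))^2) = Polygamma 1 w - 1 / w^2"
    by (simp add: divide_inverse sums_iff)
  have "1 / (w + of_int (- int (Suc n)))^2 = inverse ((1 - w + of_nat n)^2)" for n
  proof -
    have "w + of_int (- int (Suc n)) = - (1 - w + of_nat n)" by simp
    then show ?thesis by (simp only: power2_minus divide_inverse mult_1)
  qed
  then have s2: "(\<Sum>n. 1 / (w + of_int (- int (Suc n)))^2) = Polygamma 1 (1 - w)"
    using P[OF nw(2)] by (simp only: sums_iff)
  have "((\<lambda>d::int. 1 / (w + of_int d)^2) has_sum (1 / (w + of_int 0)^2 + (\<Sum>n. 1 / (w + of_int (int (Suc n)))^2)
       + (\<Sum>n. 1 / (w + of_int (- int (Suc n)))^2))) UNIV"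
    by (intro has_sum_int summable_int_inverse_square) auto
  then show ?thesis unfolding s1 s2 using E by (simp add: add.commute)
qed

section \<open>The discriminant\<close>

definition nome :: "complex \<Rightarrow> complex" where
  "nome z = exp (2 * pi * \<i> * z)"

lemma norm_nome: "norm (nome z) = exp (- 2 * pi * Im z)"
  by (simp add: nome_def)

lemma nome_add: "nome (z + w) = nome z * nome w"
  by (simp add: nome_def distrib_left exp_add)

lemma nome_of_int [simp]: "nome (of_int n) = 1"
  using exp_integer_2pi[of "of_int n"] by (simp add: nome_def mult_ac)

lemma nome_periodic: "nome (z + 1) = nome z"
  using nome_add[of z 1] nome_of_int[of 1] by simp

lemma nome_of_nat_mult: "nome (of_nat n * z) = nome z ^ n"
  unfolding nome_def by (metis exp_of_nat_mult mult.left_commute)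

lemma norm_nome_less_1: "Im z > 0 \<Longrightarrow> norm (nome z) < 1"
  by (simp add: norm_nome)

lemma nome_nonzero [simp]: "nome z \<noteq> 0"
  by (simp add: nome_def)

lemma not_Ints_if_Im: "Im w \<noteq> 0 \<Longrightarrow> w \<notin> \<int>"
  by (auto elim!: Ints_cases)

lemma csc_square_nome:
  fixes w :: complex
  assumes "Im w \<noteq> 0"
  shows "pi^2 / (sin (pi * w))^2 = - 4 * pi^2 * nome w / (1 - nome w)^2"
proof -
  define x where "x = nome (w / 2)"
  have x0: "x \<noteq> 0" by (simp add: x_def)
  have n: "nome w = x * x" using nome_add[of "w / 2" "w / 2"] by (simp add: x_def)
  have e: "complex_of_real (2 * pi) * \<i> * (w / 2) = \<i> * (pi * w)" by simp
  have x_exp: "exp (\<i> * (pi * w)) = x" "exp (- (\<i> * (pi * w))) = 1 / x"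
    unfolding x_def nome_def e exp_minus by (rule refl, rule inverse_eq_divide)
  have s: "sin (pi * w) = (x - 1 / x) / (2 * \<i>)"
    unfolding sin_exp_eq by (simp only: x_exp)
  have "(sin (pi * w))^2 = - ((1 - nome w)^2 / (4 * nome w))"
    unfolding s n using x0 by (simp add: field_simps power2_eq_square)
  then show ?thesis by simp
qed

text \<open>The variable is \<open>nome (- w)\<close> because the formula is applied at
  \<open>w = N / z\<close> with \<open>z\<close> in the upper half plane. There
  \<open>Im w < 0\<close>, and \<open>nome (- w)\<close> tends to 0 as \<open>N\<close>
  grows.\<close>

lemma cot_nome:
  fixes w :: complex
  assumes "Im w \<noteq> 0"
  shows "cot (pi * w) = \<i> * (1 + nome (- w)) / (1 - nome (- w))"
proof -
  define x where "x = nome (- w / 2)"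
  have x0: "x \<noteq> 0" by (simp add: x_def)
  have n: "nome (- w) = x * x" using nome_add[of "- w / 2" "- w / 2"] by (simp add: x_def)
  have e: "complex_of_real (2 * pi) * \<i> * (- w / 2) = - (\<i> * (pi * w))" by simp
  have x_exp: "exp (\<i> * (pi * w)) = 1 / x" "exp (- (\<i> * (pi * w))) = x"
    unfolding x_def nome_def e by (simp add: exp_minus divide_inverse, rule refl)
  have s: "sin (pi * w) = (1 / x - x) / (2 * \<i>)"
    unfolding sin_exp_eq by (simp only: x_exp)
  have c: "cos (pi * w) = (1 / x + x) / 2"
    unfolding cos_exp_eq by (simp only: x_exp)
  have s0: "sin (pi * w) \<noteq> 0" by (rule sin_pi_times_nonzero[OF not_Ints_if_Im[OF assms]])
  then have "1 / x - x \<noteq> 0" unfolding s by auto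
  then have nz: "1 - x * x \<noteq> 0" using x0 by (auto simp: field_simps)
  have "cot (pi * w) = \<i> * ((1 / x + x) / (1 / x - x))"
  proof -
    have "(a / 2) / (b / (2 * \<i>)) = \<i> * (a / b)" for a b by (cases "b = 0") (simp_all add: field_simps)
    then show ?thesis unfolding cot_def c s .
  qed
  also have "(1 / x + x) / (1 / x - x) = (1 + x * x) / (1 - x * x)"
  proof -
    have "1 / x + x = (1 + x * x) / x" "1 / x - x = (1 - x * x) / x" using x0 by (simp_all add: field_simps)
    then show ?thesis using x0 by simp
  qed
  finally show ?thesis unfolding n by simp
qed

section \<open>Absolutely convergent and telescoping sums over the lattice spanned by 1 and
  z\<close>

lemma lattice_norm_ge:
  assumes "Im z > 0"
  obtains \<kappa> where "\<kappa> > 0" "\<And>c d :: int. norm (of_int c * z + of_int d) \<ge> \<kappa> * (\<bar>of_int c\<bar> + \<bar>of_int d\<bar>)"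
proof
  define \<kappa> where "\<kappa> = 1 / (1 / Im z + 1 + norm z / Im z)"
  have p: "1 / Im z + 1 + norm z / Im z > 0" using assms by (intro add_pos_nonneg add_pos_pos) auto
  then show "\<kappa> > 0" by (simp add: \<kappa>_def)
  fix c d :: int
  let ?w = "of_int c * z + of_int d"
  have "\<bar>Im ?w\<bar> \<le> norm ?w" by (rule abs_Im_le_cmod)
  then have c: "\<bar>of_int c\<bar> * Im z \<le> norm ?w" using assms by (simp add: abs_mult)
  then have c1: "\<bar>of_int c\<bar> \<le> norm ?w / Im z" using assms by (simp add: field_simps)
  have "norm (of_int d :: complex) \<le> norm ?w + norm (of_int c * z)"
    using norm_triangle_ineq4[of ?w "of_int c * z"] by simp
  then have "\<bar>of_int d\<bar> \<le> norm ?w + \<bar>of_int c\<bar> * norm z" by (simp add: norm_mult)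
  also have "\<bar>of_int c\<bar> * norm z \<le> norm ?w / Im z * norm z" using c1 by (intro mult_right_mono) auto
  finally have "\<bar>of_int c\<bar> + \<bar>of_int d\<bar> \<le> norm ?w * (1 / Im z + 1 + norm z / Im z)"
    using c1 by (simp add: algebra_simps)
  then show "norm ?w \<ge> \<kappa> * (\<bar>of_int c\<bar> + \<bar>of_int d\<bar>)"
    using p unfolding \<kappa>_def by (simp add: divide_simps mult.commute)
qed

lemma summable_on_int_powr: "(\<lambda>c::int. (1 + \<bar>of_int c\<bar>) powr (-3/2) :: real) summable_on UNIV"
proof -
  have "summable (\<lambda>n. real n powr (-3/2))" by (subst summable_real_powr_iff) auto
  then have "summable (\<lambda>n. real (n + 2) powr (-3/2))" by (subst summable_iff_shift) auto
  then have "summable (\<lambda>n. norm ((1 + \<bar>of_int (int (Suc n))\<bar>) powr (-3/2) :: real))"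
    by (simp add: add_ac)
  then show ?thesis
    by (intro has_sum_imp_summable[OF has_sum_int]) auto
qed

definition lattice_weight :: "int \<times> int \<Rightarrow> real" where
  "lattice_weight = (\<lambda>(c, d). 1 / (1 + \<bar>of_int c\<bar> + \<bar>of_int d\<bar>) ^ 3)"

text \<open>The inequality \<open>(1 + |c|) (1 + |d|) \<le> (1 + |c| + |d|)^2\<close>, raised to the
  power 3/2, bounds the cubic weight by a product of two summable one-variable weights.\<close>

lemma summable_on_lattice: "lattice_weight summable_on UNIV"
proof -
  let ?h = "\<lambda>c::int. (1 + \<bar>of_int c\<bar>) powr (-3/2) :: real"
  have s: "(\<lambda>(c, d). ?h c * ?h d) summable_on (UNIV :: (int \<times> int) set)"
    unfolding UNIV_Times_UNIV[symmetric]
  proof (rule summable_on_SigmaI)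
    fix c :: int
    show "((\<lambda>d. case (c, d) of (c, d) \<Rightarrow> ?h c * ?h d) has_sum ?h c * infsum ?h UNIV) UNIV"
      using has_sum_cmult_right[OF has_sum_infsum[OF summable_on_int_powr], of "?h c"] by simp
    next
    show "(\<lambda>c. ?h c * infsum ?h UNIV) summable_on UNIV"
      by (rule summable_on_cmult_left[OF summable_on_int_powr])
  qed auto
  show ?thesis
  proof (rule summable_on_comparison_test[OF s])
    fix p :: "int \<times> int"
    obtain c d where p: "p = (c, d)" by (cases p)
    define x y where "x = \<bar>real_of_int c\<bar>" and "y = \<bar>real_of_int d\<bar>"
    have xy: "x \<ge> 0" "y \<ge> 0" by (auto simp: x_def y_def)
    have "(1 + x) * (1 + y) \<le> (1 + x + y)^2" using xy by (simp add: power2_eq_square algebra_simps)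
    then have "((1 + x) * (1 + y)) powr (3/2) \<le> ((1 + x + y)^2) powr (3/2)"
      using xy by (intro powr_mono2) auto
    also have "((1 + x + y)^2) powr (3/2) = (1 + x + y) powr (2 * (3/2))"
      using xy by (simp add: powr_powr flip: powr_numeral)
    also have "\<dots> = (1 + x + y) ^ 3" using xy by (simp flip: powr_numeral)
    finally have le: "((1 + x) * (1 + y)) powr (3/2) \<le> (1 + x + y) ^ 3" .
    have "1 / (1 + x + y) ^ 3 \<le> 1 / ((1 + x) * (1 + y)) powr (3/2)"
    proof (rule frac_le)
      have "(1 + x) * (1 + y) \<noteq> 0" using xy by simp
      then show "0 < ((1 + x) * (1 + y)) powr (3/2)" by simp
    qed (use le in auto)
    also have "\<dots> = (1 + x) powr (-3/2) * (1 + y) powr (-3/2)"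
    proof -
      have "(- 3 / 2 :: real) = - (3 / 2)" by simp
      then show ?thesis using xy by (simp only: powr_mult powr_minus inverse_mult_distrib divide_inverse[of 1] mult_1)
    qed
    finally show "lattice_weight p \<le> (case p of (c, d) \<Rightarrow> ?h c * ?h d)"
      by (simp add: p x_def y_def lattice_weight_def)
  qed (auto simp: case_prod_unfold lattice_weight_def)
qed

text \<open>The window \<open>{1 - N..N}\<close> is not symmetric on purpose: differences
  \<open>u (d - 1) - u d\<close> summed over it telescope to the symmetric end points
  \<open>-N\<close> and \<open>N\<close>.\<close>

lemma has_sum_int_tendsto:
  fixes f :: "int \<Rightarrow> complex"
  assumes "(f has_sum s) UNIV"
  shows "(\<lambda>N. \<Sum>d = 1 - int N..int N. f d) \<longlonglongrightarrow> s"
proof -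
  have "filterlim (\<lambda>N. {1 - int N..int N}) (finite_subsets_at_top UNIV) sequentially"
    unfolding filterlim_finite_subsets_at_top
  proof safe
    fix X :: "int set" assume X: "finite X"
    show "\<forall>\<^sub>F N in sequentially. finite {1 - int N..int N} \<and> X \<subseteq> {1 - int N..int N} \<and> {1 - int N..int N} \<subseteq> UNIV"
      using eventually_ge_at_top[of "nat (Max (insert 0 (abs ` X)) + 1)"]
    proof eventually_elim
      case (elim N)
      have "\<bar>x\<bar> \<le> Max (insert 0 (abs ` X))" if "x \<in> X" for x using X that by (intro Max_ge) auto
      then have "\<bar>x\<bar> + 1 \<le> int N" if "x \<in> X" for x using elim that by (smt (verit, best) nat_le_iff)
      then show ?case by fastforce
    qed
  qed
  with assms show ?thesis unfolding has_sum_def by (rule filterlim_compose)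
qed

lemma telescope_int:
  fixes u :: "int \<Rightarrow> complex"
  shows "(\<Sum>d = 1 - int N..int N. u (d - 1) - u d) = u (- int N) - u (int N)"
proof (induction N)
  case 0 then show ?case by simp
next
  case (Suc N)
  have "{1 - int (Suc N)..int (Suc N)} = insert (- int N) (insert (int N + 1) {1 - int N..int N})" by auto
  then have "(\<Sum>d = 1 - int (Suc N)..int (Suc N). u (d - 1) - u d) =
     (u (- int N - 1) - u (- int N)) + ((u (int N + 1 - 1) - u (int N + 1)) + (u (- int N) - u (int N)))"
    using Suc by (simp del: of_nat_Suc)
  then show ?case by (simp add: add.commute[of 1])
qed

section \<open>The weight 2 Eisenstein series and its quasi-modular inversion\<close>

definition csc_sq :: "complex \<Rightarrow> complex" where
  "csc_sq w = of_real (pi^2) / (sin (of_real pi * w))^2"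

text \<open>Up to the constant term \<open>\<pi>^2 / 3\<close> this is Eisenstein's
  \<open>G_2\<close>: \<open>csc_sq (c z)\<close> is the sum of \<open>1 / (c z + d)^2\<close> over
  \<open>d\<close>. The double sum does not converge absolutely, so the order, first
  \<open>d\<close> and then \<open>c\<close>, belongs to the definition.\<close>

definition eisenstein_tail :: "complex \<Rightarrow> complex" where
  "eisenstein_tail z = (\<Sum>\<^sub>\<infinity>c\<in>-{0::int}. csc_sq (of_int c * z))"

lemma csc_sq_minus [simp]: "csc_sq (- w) = csc_sq w"
  by (simp add: csc_sq_def)

lemma has_sum_inverse_squares_int: "((\<lambda>c::int. 1 / (of_int c)^2) has_sum (of_real (pi^2 / 3) :: complex)) (- {0})"
proof -
  have "(\<lambda>n. of_real (1 / (real (Suc n))^2) :: complex) sums of_real (pi^2/6)"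
    using inverse_squares_sums by (subst sums_of_real_iff) simp
  then have e: "(\<Sum>n. 1 / (of_int (int (Suc n)))^2 :: complex) = of_real (pi^2/6)"
    by (simp add: sums_iff del: of_nat_Suc)
  have sm: "summable (\<lambda>n. norm (1 / (of_int (int (Suc n)))^2 :: complex))"
    using summable_inverse_square_shift by (simp add: norm_divide norm_power del: of_nat_Suc)
  have m: "(of_int (- int n))^2 = ((of_int (int n))^2 :: complex)" for n by simp
  have "((\<lambda>c::int. 1 / (of_int c)^2) has_sum ((\<Sum>n. 1 / (of_int (int (Suc n)))^2) + (\<Sum>n. 1 / (of_int (- int (Suc n)))^2 :: complex))) (- {0})"
    by (rule has_sum_int_nonzero[OF sm]) (use sm in \<open>simp only: m\<close>)
  then show ?thesis unfolding m e by (simp flip: of_real_add)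
qed

lemma sums_of_even_has_sum_int:
  fixes g :: "int \<Rightarrow> complex"
  assumes g: "(g has_sum s) (- {0})" and even: "\<And>c. g (- c) = g c"
  shows "(\<lambda>n. g (int (Suc n))) sums (s / 2)"
proof -
  have "g summable_on {0<..}" by (rule summable_on_subset[OF has_sum_imp_summable[OF g]]) auto
  then obtain p where p: "(g has_sum p) {0<..}" using has_sum_infsum by blast
  have "bij_betw (\<lambda>n. int (Suc n)) UNIV {0<..}"
    by (rule bij_betwI[where g = "\<lambda>x. nat (x - 1)"]) auto
  from has_sum_reindex_bij_betw[OF this, of g p] p
  have "((\<lambda>n. g (int (Suc n))) has_sum p) UNIV" by simp
  then have sp: "(\<lambda>n. g (int (Suc n))) sums p" by (rule has_sum_imp_sums)
  have "bij_betw uminus {0<..} {..<(0::int)}" by (rule bij_betwI[where g = uminus]) auto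
  from has_sum_reindex_bij_betw[OF this, of g p] p have m: "(g has_sum p) {..<0}" by (simp add: even)
  have e: "- {0::int} = {0<..} \<union> {..<0}" by (auto simp: set_eq_iff)
  have "(g has_sum (p + p)) (- {0})"
    unfolding e by (rule has_sum_Un_disjoint[OF p m]) (auto simp: disjoint_iff)
  then have "s = p + p" using g has_sum_unique by blast
  then show ?thesis using sp by simp
qed

locale upper =
  fixes z :: complex
  assumes z: "Im z > 0"
begin

definition "W = (\<lambda>(c :: int, d :: int). of_int c * z + of_int d)"
definition "aa = (\<lambda>p. 1 / (W p)^2)"
text \<open>A correction that telescopes in \<open>d\<close>. Since
  \<open>W (c, d - 1) = W (c, d) - 1\<close>, it equals \<open>1 / (W (W - 1))\<close> with
  \<open>W = W (c, d)\<close>, so that \<open>aa - bb\<close> has cubic order and is absolutely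
  summable over the lattice.\<close>

definition "bb = (\<lambda>(c, d). 1 / W (c, d - 1) - 1 / W (c, d))"

lemma W_nonzero: "c \<noteq> 0 \<or> d \<noteq> 0 \<Longrightarrow> W (c, d) \<noteq> 0"
proof
  assume cd: "c \<noteq> 0 \<or> d \<noteq> 0" and "W (c, d) = 0"
  then have "Im (of_int c * z + of_int d) = 0" "Re (of_int c * z + of_int d) = 0" by (auto simp: W_def)
  then show False using z cd by auto
qed

lemma summable_difference: "(\<lambda>p. aa p - bb p) summable_on ((- {0}) \<times> UNIV)"
proof -
  obtain \<kappa> where \<kappa>: "\<kappa> > 0" "\<And>c d :: int. norm (of_int c * z + of_int d) \<ge> \<kappa> * (\<bar>of_int c\<bar> + \<bar>of_int d\<bar>)"
    using lattice_norm_ge[OF z] by blast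
  have "(\<lambda>p. (16 / \<kappa>^3) * lattice_weight p) summable_on UNIV"
    by (rule summable_on_cmult_right[OF summable_on_lattice])
  then have S: "(\<lambda>p. (16 / \<kappa>^3) * lattice_weight p) summable_on ((- {0}) \<times> UNIV)"
    by (rule summable_on_subset) auto
  show ?thesis
  proof (rule abs_summable_summable, rule summable_on_comparison_test[OF S])
    fix p :: "int \<times> int" assume "p \<in> (- {0}) \<times> UNIV"
    then obtain c d where p: "p = (c, d)" and c: "c \<noteq> 0" by auto
    define s where "s = 1 + \<bar>real_of_int c\<bar> + \<bar>real_of_int d\<bar>"
    have c1: "\<bar>real_of_int c\<bar> \<ge> 1" using c by linarith
    have s: "s > 0" by (simp add: s_def add_pos_nonneg)
    have "s / 2 \<le> \<bar>of_int c\<bar> + \<bar>of_int d\<bar>" using c1 by (simp add: s_def)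
    then have "\<kappa> * (s / 2) \<le> \<kappa> * (\<bar>of_int c\<bar> + \<bar>of_int d\<bar>)" using \<kappa>(1) by (intro mult_left_mono) auto
    then have n1: "norm (W (c, d)) \<ge> \<kappa> * (s / 2)"
      using \<kappa>(2)[of c d] unfolding W_def by simp
    have "s / 4 \<le> \<bar>of_int c\<bar> + \<bar>of_int (d - 1)\<bar>" using c1 unfolding s_def of_int_diff by (simp only: of_int_1) argo
    then have "\<kappa> * (s / 4) \<le> \<kappa> * (\<bar>of_int c\<bar> + \<bar>of_int (d - 1)\<bar>)" using \<kappa>(1) by (intro mult_left_mono) auto
    then have n2: "norm (W (c, d - 1)) \<ge> \<kappa> * (s / 4)"
      using \<kappa>(2)[of c "d - 1"] unfolding W_def by (simp del: of_int_diff)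
    have w0: "W (c, d) \<noteq> 0" "W (c, d - 1) \<noteq> 0" using c W_nonzero by auto
    have W1: "W (c, d - 1) = W (c, d) - 1" by (simp add: W_def)
    have "aa p - bb p = - (1 / ((W (c, d))^2 * W (c, d - 1)))"
      using w0 unfolding p aa_def bb_def W1 prod.case by (simp add: divide_simps) (simp add: algebra_simps power2_eq_square)
    then have "norm (aa p - bb p) = 1 / (norm (W (c, d))^2 * norm (W (c, d - 1)))"
      by (simp add: norm_divide norm_mult norm_power)
    also have "\<dots> \<le> 1 / ((\<kappa> * (s / 2))^2 * (\<kappa> * (s / 4)))"
      using n1 n2 s \<kappa>(1) by (intro frac_le mult_mono power_mono) auto
    also have "\<dots> = (16 / \<kappa>^3) * (1 / s ^ 3)" using s \<kappa>(1) by (simp add: field_simps power2_eq_square power3_eq_cube)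
    finally show "norm (aa p - bb p) \<le> (16 / \<kappa>^3) * lattice_weight p"
      by (simp add: p s_def lattice_weight_def)
  qed auto
qed

lemma Im_int_mult: "c \<noteq> 0 \<Longrightarrow> Im (of_int c * z) \<noteq> 0"
  using z by auto

text \<open>Along a row the telescoped partial sums of \<open>bb\<close> tend to 0, hence a row of
  \<open>aa - bb\<close> has the same sum as a row of \<open>aa\<close>.\<close>

lemma row_sum:
  assumes c: "c \<noteq> 0"
  shows "((\<lambda>d. aa (c, d) - bb (c, d)) has_sum csc_sq (of_int c * z)) UNIV"
proof -
  have a: "((\<lambda>d. aa (c, d)) has_sum csc_sq (of_int c * z)) UNIV"
    using csc_square_partial_fractions[OF not_Ints_if_Im[OF Im_int_mult[OF c]]]
    by (simp add: aa_def W_def csc_sq_def)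
  have "(\<lambda>d. aa (c, d) - bb (c, d)) summable_on UNIV"
    using summable_on_SigmaD1[of "\<lambda>c d. aa (c, d) - bb (c, d)" "- {0}" "\<lambda>_. UNIV" c] summable_difference c
    by (simp add: case_prod_unfold)
  then obtain v where v: "((\<lambda>d. aa (c, d) - bb (c, d)) has_sum v) UNIV" using has_sum_infsum by blast
  have b: "((\<lambda>d. bb (c, d)) has_sum (csc_sq (of_int c * z) - v)) UNIV"
    using has_sum_add[OF a has_sum_uminusI[OF v]] by simp
  have l: "(\<lambda>N. \<Sum>d = 1 - int N..int N. bb (c, d)) \<longlonglongrightarrow> csc_sq (of_int c * z) - v"
    by (rule has_sum_int_tendsto[OF b])
  have "(\<lambda>N. 1 / W (c, - int N) - 1 / W (c, int N)) \<longlonglongrightarrow> 0 - 0"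
  proof (intro tendsto_diff)
    have f1: "filterlim (\<lambda>N. of_int c * z + of_nat N) at_infinity sequentially"
      by (intro tendsto_add_filterlim_at_infinity[OF tendsto_const] tendsto_of_nat)
    have f2: "filterlim (\<lambda>N. of_int (- c) * z + of_nat N) at_infinity sequentially"
      by (intro tendsto_add_filterlim_at_infinity[OF tendsto_const] tendsto_of_nat)
    show "(\<lambda>N. 1 / W (c, int N)) \<longlonglongrightarrow> 0"
      using filterlim_compose[OF tendsto_inverse_0 f1] by (simp add: W_def divide_inverse)
    have "(\<lambda>N. - (1 / W (- c, int N))) \<longlonglongrightarrow> - 0"
      using tendsto_minus[OF filterlim_compose[OF tendsto_inverse_0 f2]] by (simp add: W_def divide_inverse)
    moreover have "- (1 / W (- c, int N)) = 1 / W (c, - int N)" for N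
    proof -
      have "W (c, - int N) = - W (- c, int N)" by (simp add: W_def)
      then show ?thesis by simp
    qed
    ultimately show "(\<lambda>N. 1 / W (c, - int N)) \<longlonglongrightarrow> 0" by simp
  qed
  moreover have "(\<Sum>d = 1 - int N..int N. bb (c, d)) = 1 / W (c, - int N) - 1 / W (c, int N)" for N
    using telescope_int[of "\<lambda>d. 1 / W (c, d)" N] by (simp add: bb_def)
  ultimately have "csc_sq (of_int c * z) - v = 0"
    using LIMSEQ_unique[OF l] by simp
  then show ?thesis using v by simp
qed

lemma has_sum_eisenstein_tail: "((\<lambda>c. csc_sq (of_int c * z)) has_sum eisenstein_tail z) (- {0})"
  and has_sum_difference: "((\<lambda>p. aa p - bb p) has_sum eisenstein_tail z) ((- {0}) \<times> UNIV)"
proof -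
  have h: "((\<lambda>p. aa p - bb p) has_sum infsum (\<lambda>p. aa p - bb p) ((- {0}) \<times> UNIV)) ((- {0}) \<times> UNIV)"
    using summable_difference by simp
  then have g: "((\<lambda>c. csc_sq (of_int c * z)) has_sum infsum (\<lambda>p. aa p - bb p) ((- {0}) \<times> UNIV)) (- {0})"
    by (rule has_sum_SigmaD) (use row_sum in auto)
  then have e: "eisenstein_tail z = infsum (\<lambda>p. aa p - bb p) ((- {0}) \<times> UNIV)"
    by (simp add: eisenstein_tail_def infsumI)
  show "((\<lambda>c. csc_sq (of_int c * z)) has_sum eisenstein_tail z) (- {0})" using g e by simp
  show "((\<lambda>p. aa p - bb p) has_sum eisenstein_tail z) ((- {0}) \<times> UNIV)" using h e by simp
qed

text \<open>The sum of \<open>aa\<close> over \<open>c \<noteq> 0\<close> for fixed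
  \<open>d\<close>, obtained from \<open>c z + d = z (c + d / z)\<close> and the cosecant formula at
  \<open>d / z\<close>. The summand \<open>1 / d^2\<close> takes out \<open>c = 0\<close>; for
  \<open>d = 0\<close> only the inverse squares of \<open>c\<close> are left.\<close>

definition "colA = (\<lambda>d::int. if d = 0 then of_real (pi^2/3) * (1 / z^2) else csc_sq (of_int d / z) * (1 / z^2) - 1 / (of_int d)^2)"
definition "colC = (\<lambda>d::int. \<Sum>\<^sub>\<infinity>c\<in>-{0}. aa (c, d) - bb (c, d))"

lemma z_nonzero: "z \<noteq> 0"
  using z by auto

lemma col_sum_aa: "((\<lambda>c. aa (c, d)) has_sum colA d) (- {0})"
proof (cases "d = 0")
  case True
  have "((\<lambda>c::int. 1 / (of_int c)^2 * (1 / z^2)) has_sum (of_real (pi^2/3) * (1 / z^2))) (- {0})"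
    by (rule has_sum_cmult_left[OF has_sum_inverse_squares_int])
  then show ?thesis using True by (simp add: aa_def W_def colA_def power_mult_distrib)
next
  case False
  have "Im (of_int d / z) \<noteq> 0" using z False by (simp add: Im_divide)
  then have "((\<lambda>c::int. 1 / (of_int d / z + of_int c)^2) has_sum csc_sq (of_int d / z)) UNIV"
    unfolding csc_sq_def by (intro csc_square_partial_fractions not_Ints_if_Im)
  then have "((\<lambda>c::int. 1 / (of_int d / z + of_int c)^2) has_sum csc_sq (of_int d / z) - 1 / (of_int d / z)^2) (UNIV - {0})"
    by (rule has_sum_Diff) (auto intro: has_sum_finiteI)
  from has_sum_cmult_left[OF this, of "1 / z^2"]
  have "((\<lambda>c::int. 1 / (of_int d / z + of_int c)^2 * (1 / z^2)) has_sum (csc_sq (of_int d / z) - 1 / (of_int d / z)^2) * (1 / z^2)) (- {0})"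
    by (simp add: Compl_eq_Diff_UNIV)
  moreover have "1 / (of_int d / z + of_int c)^2 * (1 / z^2) = aa (c, d)" for c
  proof -
    have "(of_int d / z + of_int c) * z = of_int c * z + of_int d" using z_nonzero by (simp add: field_simps)
    then have "(of_int d / z + of_int c)^2 * z^2 = (of_int c * z + of_int d)^2" by (metis power_mult_distrib)
    then show ?thesis by (simp add: aa_def W_def)
  qed
  moreover have "(csc_sq (of_int d / z) - 1 / (of_int d / z)^2) * (1 / z^2) = colA d"
    using False z_nonzero by (simp add: colA_def diff_divide_distrib power_divide)
  ultimately show ?thesis by simp
qed

lemma swapped_difference: "((\<lambda>p. aa (snd p, fst p) - bb (snd p, fst p)) has_sum eisenstein_tail z) (UNIV \<times> (- {0}))"
  using has_sum_difference has_sum_swap[of "\<lambda>p. aa p - bb p" "- {0}" UNIV "eisenstein_tail z"]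
  by (simp add: case_prod_unfold)

lemma col_sum_difference: "((\<lambda>c. aa (c, d) - bb (c, d)) has_sum colC d) (- {0})"
proof -
  have "(\<lambda>(d, c). aa (c, d) - bb (c, d)) summable_on (UNIV \<times> (- {0}))"
    using has_sum_imp_summable[OF swapped_difference] by (simp add: case_prod_unfold)
  then have "(\<lambda>c. aa (c, d) - bb (c, d)) summable_on (- {0})" by (rule summable_on_SigmaD1) auto
  then show ?thesis by (simp add: colC_def)
qed

lemma has_sum_colC: "(colC has_sum eisenstein_tail z) UNIV"
  using swapped_difference by (rule has_sum_SigmaD) (use col_sum_difference in simp)

lemma col_sum_bb: "((\<lambda>c. bb (c, d)) has_sum (colA d - colC d)) (- {0})"
  using has_sum_add[OF col_sum_aa has_sum_uminusI[OF col_sum_difference], of d d] by simp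

text \<open>For a sum by columns the telescoping happens across the columns, inside the sum over
  \<open>c\<close>. It leaves boundary terms at \<open>d = -N\<close> and \<open>d = N\<close> whose
  total over \<open>c\<close> does not vanish in the limit.\<close>

lemma col_sum_bb_partial:
  "((\<lambda>c. 1 / W (c, - int N) - 1 / W (c, int N)) has_sum (\<Sum>d = 1 - int N..int N. colA d - colC d)) (- {0})"
proof -
  have "((\<lambda>c. \<Sum>d\<in>F. bb (c, d)) has_sum (\<Sum>d\<in>F. colA d - colC d)) (- {0})" if "finite F" for F
    using that by induction (auto intro: has_sum_add col_sum_bb)
  from this[of "{1 - int N..int N}"] show ?thesis
    using telescope_int[of "\<lambda>d. 1 / W (_, d)" N] by (simp add: bb_def)
qed

text \<open>The boundary terms for \<open>c\<close> and \<open>-c\<close> agree, and with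
  \<open>w = N / z\<close> they are \<open>- 1 / z\<close> times the terms of the partial fraction
  series of the cotangent.\<close>

lemma partial_sum_cot:
  assumes "N > 0"
  shows "(\<Sum>d = 1 - int N..int N. colA d - colC d) = (2 / z) * (z / of_nat N - pi * cot (pi * (of_nat N / z)))"
proof -
  define w where "w = of_nat N / z"
  define g where "g = (\<lambda>c. 1 / W (c, - int N) - 1 / W (c, int N))"
  have Imw: "Im w \<noteq> 0" using z assms by (simp add: Im_divide w_def)
  have w0: "w \<noteq> 0" using Imw by auto
  have wn: "w + of_nat (Suc n) \<noteq> 0" "w - of_nat (Suc n) \<noteq> 0" for n
    using Imw by (auto simp: complex_eq_iff)
  have gw: "g (int (Suc n)) = (1 / (w + of_nat (Suc n)) + 1 / (w - of_nat (Suc n))) * (- 1 / z)" for n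
  proof -
    have W: "W (int (Suc n), - int N) = - z * (w - of_nat (Suc n))" "W (int (Suc n), int N) = z * (w + of_nat (Suc n))"
      using z_nonzero by (simp_all add: W_def w_def field_simps)
    have "1 / (- z * u) - 1 / (z * v) = (1 / v + 1 / u) * (- 1 / z)" for u v
      by (simp add: algebra_simps flip: minus_divide_left minus_divide_right)
    then show ?thesis unfolding g_def W .
  qed
  have gm: "g (- c) = g c" for c
  proof -
    have "W (- c, - int N) = - W (c, int N)" "W (- c, int N) = - W (c, - int N)" by (simp_all add: W_def)
    then show ?thesis by (simp add: g_def)
  qed
  have g: "(g has_sum (\<Sum>d = 1 - int N..int N. colA d - colC d)) (- {0})"
    unfolding g_def by (rule col_sum_bb_partial)
  have "(\<lambda>n. g (int (Suc n))) sums ((\<Sum>d = 1 - int N..int N. colA d - colC d) / 2)"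
    by (rule sums_of_even_has_sum_int[OF g gm])
  moreover have "(\<lambda>n. g (int (Suc n))) sums ((pi * cot (pi * w) - 1 / w) * (- 1 / z))"
    unfolding gw by (intro sums_mult2 cot_partial_fractions not_Ints_if_Im Imw)
  ultimately have pe: "(\<Sum>d = 1 - int N..int N. colA d - colC d) / 2 = (pi * cot (pi * w) - 1 / w) * (- 1 / z)" by (rule sums_unique2)
  have "(\<Sum>d = 1 - int N..int N. colA d - colC d) = 2 * ((\<Sum>d = 1 - int N..int N. colA d - colC d) / 2)" by simp
  also have "\<dots> = (2 / z) * (1 / w - pi * cot (pi * w))" unfolding pe using z_nonzero by (simp add: field_simps)
  finally show ?thesis by (simp add: w_def)
qed

text \<open>As \<open>N\<close> grows, \<open>N / z\<close> moves down the lower half plane, where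
  the cotangent tends to \<open>\<i>\<close>. This nonzero limit is the anomaly of the weight 2
  series.\<close>

lemma partial_sum_limit: "(\<lambda>N. \<Sum>d = 1 - int N..int N. colA d - colC d) \<longlonglongrightarrow> - 2 * pi * \<i> / z"
proof -
  define x where "x = nome (- 1 / z)"
  have Imz: "Im (- 1 / z) > 0" using z by (auto simp: Im_divide intro!: divide_pos_pos add_nonneg_pos)
  then have x1: "norm x < 1" unfolding x_def by (rule norm_nome_less_1)
  have xN: "(\<lambda>N. x ^ N) \<longlonglongrightarrow> 0" using x1 by (rule LIMSEQ_power_zero)
  have zN: "(\<lambda>N. z / of_nat N) \<longlonglongrightarrow> 0"
    using tendsto_mult[OF tendsto_const[of z] lim_inverse_n] by (simp add: divide_inverse)
  have "(\<lambda>N. (2 / z) * (z / of_nat N - pi * (\<i> * (1 + x ^ N) / (1 - x ^ N)))) \<longlonglongrightarrow> (2 / z) * (0 - pi * (\<i> * (1 + 0) / (1 - 0)))"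
    by (intro tendsto_intros xN zN) auto
  moreover have "\<forall>\<^sub>F N in sequentially. (2 / z) * (z / of_nat N - pi * (\<i> * (1 + x ^ N) / (1 - x ^ N)))
      = (\<Sum>d = 1 - int N..int N. colA d - colC d)"
    using eventually_gt_at_top[of 0]
  proof eventually_elim
    case (elim N)
    have "Im (of_nat N / z) \<noteq> 0" using z elim by (simp add: Im_divide)
    from cot_nome[OF this] have "cot (pi * (of_nat N / z)) = \<i> * (1 + x ^ N) / (1 - x ^ N)"
      unfolding x_def nome_of_nat_mult[symmetric] by simp
    then show ?case unfolding partial_sum_cot[OF elim] by simp
  qed
  ultimately have "(\<lambda>N. \<Sum>d = 1 - int N..int N. colA d - colC d) \<longlonglongrightarrow> (2 / z) * (0 - pi * (\<i> * (1 + 0) / (1 - 0)))"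
    by (rule Lim_transform_eventually)
  then show ?thesis by (simp add: mult.commute mult.left_commute)
qed

lemma Im_inverse_pos: "Im (- 1 / z) > 0"
  using z by (auto simp: Im_divide intro!: divide_pos_pos add_nonneg_pos)

end

text \<open>The absolutely convergent sum of \<open>aa - bb\<close> is evaluated twice. By rows it
  is the tail at \<open>z\<close>; by columns the part from \<open>aa\<close> gives the tail at
  \<open>- 1 / z\<close>, and the part from \<open>bb\<close> gives the limit
  \<open>- 2 \<pi> \<i> / z\<close>.\<close>

lemma eisenstein_tail_inversion:
  fixes z :: complex
  assumes z: "Im z > 0"
  shows   "eisenstein_tail (- 1 / z) / z^2 = eisenstein_tail z + pi^2 / 3 - pi^2 / (3 * z^2) - 2 * pi * \<i> / z"
proof -
  interpret upper z by unfold_locales (rule z)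
  define E where "E = eisenstein_tail (- 1 / z)"
  have "((\<lambda>c. csc_sq (of_int c * (- 1 / z))) has_sum eisenstein_tail (- 1 / z)) (- {0})"
    by (rule upper.has_sum_eisenstein_tail) (unfold_locales, rule Im_inverse_pos)
  moreover have "csc_sq (of_int c * (- 1 / z)) = csc_sq (of_int c / z)" for c
    using csc_sq_minus[of "of_int c / z"] by simp
  ultimately have "((\<lambda>d. csc_sq (of_int d / z)) has_sum E) (- {0})"
    unfolding E_def by simp
  from has_sum_add[OF has_sum_cmult_left[OF this, of "1 / z^2"] has_sum_uminusI[OF has_sum_inverse_squares_int]]
  have "((\<lambda>d. csc_sq (of_int d / z) * (1 / z^2) - 1 / (of_int d)^2) has_sum (E * (1 / z^2) - of_real (pi^2/3))) (- {0})"
    by simp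
  then have "(colA has_sum (E * (1 / z^2) - of_real (pi^2/3))) (- {0})"
    by (subst has_sum_cong[where g = "\<lambda>d. csc_sq (of_int d / z) * (1 / z^2) - 1 / (of_int d)^2"]) (auto simp: colA_def)
  then have "(colA has_sum (colA 0 + (E * (1 / z^2) - of_real (pi^2/3)))) (insert 0 (- {0}))"
    by (intro has_sum_insert) auto
  moreover have "insert 0 (- {0}) = (UNIV :: int set)" by auto
  ultimately have "(colA has_sum (colA 0 + (E * (1 / z^2) - of_real (pi^2/3)))) UNIV" by simp
  from has_sum_add[OF this has_sum_uminusI[OF has_sum_colC]]
  have "((\<lambda>d. colA d - colC d) has_sum (colA 0 + (E * (1 / z^2) - of_real (pi^2/3)) - eisenstein_tail z)) UNIV"
    by simp
  from LIMSEQ_unique[OF has_sum_int_tendsto[OF this] partial_sum_limit]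
  show ?thesis unfolding E_def[symmetric] by (simp add: colA_def algebra_simps)
qed

text \<open>Minus the logarithm of Euler's product \<open>(1 - q) (1 - q^2) (1 - q^3) ...\<close>,
  as one sees by expanding \<open>1 / (1 - q^n)\<close> geometrically and summing over
  \<open>n\<close> first. In this form no branch of the logarithm has to be chosen.\<close>

definition lambert :: "complex \<Rightarrow> complex" where
  "lambert q = (\<Sum>n. q ^ Suc n / (of_nat (Suc n) * (1 - q ^ Suc n)))"

lemma norm_one_minus_power_ge:
  fixes q :: complex
  assumes "norm q \<le> r" "r < 1"
  shows "norm (1 - q ^ Suc n) \<ge> 1 - r"
proof -
  have "norm (q ^ Suc n) \<le> norm q"
    unfolding norm_power using power_decreasing[of 1 "Suc n" "norm q"] assms by simp
  then show ?thesis using norm_triangle_ineq2[of 1 "q ^ Suc n"] assms by simp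
qed

lemma norm_lambert_term_le:
  fixes q :: complex
  assumes "norm q \<le> r" "r < 1"
  shows "norm (q ^ Suc n / (of_nat (Suc n) * (1 - q ^ Suc n))) \<le> r / (1 - r) * r ^ n"
proof -
  have r: "r \<ge> 0" using assms(1) norm_ge_zero order_trans by blast
  have "norm (q ^ Suc n) \<le> r ^ Suc n" unfolding norm_power by (rule power_mono) (use assms in auto)
  moreover have "1 - r \<le> norm (of_nat (Suc n) * (1 - q ^ Suc n))"
  proof -
    have "1 * (1 - r) \<le> real (Suc n) * norm (1 - q ^ Suc n)"
      by (rule mult_mono) (use norm_one_minus_power_ge[OF assms] assms in auto)
    then show ?thesis by (simp add: norm_mult del: of_nat_Suc)
  qed
  ultimately have "norm (q ^ Suc n) / norm (of_nat (Suc n) * (1 - q ^ Suc n)) \<le> r ^ Suc n / (1 - r)"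
    using assms r by (intro frac_le) auto
  then show ?thesis by (simp add: norm_divide)
qed

lemma lambert_sums_deriv:
  assumes "norm q < 1"
  shows "\<exists>g'. (\<lambda>n. q ^ n / (1 - q ^ Suc n)^2) sums g' \<and> (lambert has_field_derivative g') (at q)"
    and "(\<lambda>n. q ^ Suc n / (of_nat (Suc n) * (1 - q ^ Suc n))) sums lambert q"
proof -
  let ?f = "\<lambda>n q. q ^ Suc n / (of_nat (Suc n) * (1 - q ^ Suc n)) :: complex"
  let ?f' = "\<lambda>n q. q ^ n / (1 - q ^ Suc n)^2 :: complex"
  have "\<exists>g g'. \<forall>x\<in>ball 0 1. ((\<lambda>n. ?f n x) sums g x) \<and> ((\<lambda>n. ?f' n x) sums g' x) \<and> (g has_field_derivative g' x) (at x)"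
  proof (rule series_and_derivative_comparison_complex)
    show "open (ball 0 1 :: complex set)" by simp
  next
    fix n and x :: complex assume x: "x \<in> ball 0 1"
    define N where "N = complex_of_nat (Suc n)"
    have N0: "N \<noteq> 0" unfolding N_def by (simp del: of_nat_Suc)
    have nz: "1 - x ^ Suc n \<noteq> 0"
      using norm_one_minus_power_ge[of x "norm x" n] x by auto
    have d: "((\<lambda>x. x ^ Suc n) has_field_derivative N * x ^ n) (at x)"
      unfolding N_def by (rule DERIV_cong[OF DERIV_power[OF DERIV_ident]]) simp
    have "((\<lambda>x. x ^ Suc n / (N * (1 - x ^ Suc n))) has_field_derivative
       ((N * x ^ n) * (N * (1 - x ^ Suc n)) - x ^ Suc n * (N * (0 - N * x ^ n))) / ((N * (1 - x ^ Suc n)) * (N * (1 - x ^ Suc n)))) (at x)"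
      by (intro DERIV_divide DERIV_cmult DERIV_diff d DERIV_const) (use nz N0 in auto)
    moreover have "((N * x ^ n) * (N * (1 - x ^ Suc n)) - x ^ Suc n * (N * (0 - N * x ^ n))) / ((N * (1 - x ^ Suc n)) * (N * (1 - x ^ Suc n))) = ?f' n x"
    proof -
      have "(N * x ^ n) * (N * (1 - x ^ Suc n)) - x ^ Suc n * (N * (0 - N * x ^ n)) = (N * N) * x ^ n"
        by (simp add: algebra_simps)
      moreover have "(N * (1 - x ^ Suc n)) * (N * (1 - x ^ Suc n)) = (N * N) * (1 - x ^ Suc n)^2"
        by (simp add: power2_eq_square mult_ac)
      ultimately show ?thesis using N0 by (simp only: mult_divide_mult_cancel_left_if) simp
    qed
    ultimately show "((\<lambda>x. ?f n x) has_field_derivative ?f' n x) (at x)" unfolding N_def by simp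
  next
    fix x :: complex assume x: "x \<in> ball 0 1"
    define r where "r = (1 + norm x) / 2"
    have r: "norm x < r" "r < 1" "r \<ge> 0" using x by (auto simp: r_def)
    let ?h = "\<lambda>n. complex_of_real (r / (1 - r) * r ^ n)"
    have A1: "0 < r - norm x" using r by simp
    have A2: "summable ?h"
      unfolding summable_complex_of_real using r by (intro summable_mult summable_geometric) auto
    have A3: "range ?h \<subseteq> \<real>\<^sub>\<ge>\<^sub>0"
      using r by (auto intro!: mult_nonneg_nonneg divide_nonneg_nonneg simp flip: of_real_mult of_real_divide of_real_power of_real_diff)
    have A4: "norm (?f n y) \<le> norm (?h n)" if "y \<in> ball x (r - norm x) \<inter> ball 0 1" for n y
    proof -
      have "norm y \<le> norm x + dist x y" by (metis dist_norm norm_triangle_sub norm_minus_commute)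
      then have "norm y \<le> r" using that by auto
      from norm_lambert_term_le[OF this r(2), of n] show ?thesis unfolding norm_of_real by linarith
    qed
    show "\<exists>d (h :: nat \<Rightarrow> complex). 0 < d \<and> summable h \<and> range h \<subseteq> \<real>\<^sub>\<ge>\<^sub>0 \<and>
        (\<forall>\<^sub>F n in sequentially. \<forall>y\<in>ball x d \<inter> ball 0 1. norm (?f n y) \<le> norm (h n))"
      by (rule exI[of _ "r - norm x"], rule exI[of _ ?h], intro conjI A1 A2 A3 always_eventually allI ballI) (rule A4)
  qed
  then obtain g g' where g: "\<And>x. x \<in> ball 0 1 \<Longrightarrow> ((\<lambda>n. ?f n x) sums g x) \<and> ((\<lambda>n. ?f' n x) sums g' x) \<and> (g has_field_derivative g' x) (at x)"
    by blast
  have q: "q \<in> ball 0 1" using assms by simp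
  have gl: "g x = lambert x" if "x \<in> ball 0 1" for x
    using g[OF that] by (simp add: lambert_def sums_iff)
  show "(\<lambda>n. q ^ Suc n / (of_nat (Suc n) * (1 - q ^ Suc n))) sums lambert q"
    using g[OF q] gl[OF q] by simp
  have "(lambert has_field_derivative g' q) (at q)"
    by (rule has_field_derivative_transform_within_open[of g _ _ "ball 0 1"]) (use g q gl in auto)
  then show "\<exists>g'. (\<lambda>n. ?f' n q) sums g' \<and> (lambert has_field_derivative g') (at q)"
    using g[OF q] by blast
qed

lemma norm_lambert_le:
  assumes "norm q \<le> r" "r < 1"
  shows "norm (lambert q) \<le> r / (1 - r)^2"
proof -
  have r: "r \<ge> 0" using assms(1) norm_ge_zero order_trans by blast
  have "norm (lambert q) \<le> (\<Sum>n. r / (1 - r) * r ^ n)"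
    unfolding lambert_def by (rule norm_suminf_le) (use norm_lambert_term_le[OF assms] r assms in \<open>auto intro!: summable_mult summable_geometric simp del: of_nat_Suc power_Suc\<close>)
  also have "\<dots> = r / (1 - r)^2"
    using assms r by (subst suminf_mult) (auto simp: suminf_geometric power2_eq_square)
  finally show ?thesis .
qed

lemma lambert_holomorphic: "lambert holomorphic_on ball 0 1"
  by (rule holomorphic_onI, rule field_differentiable_at_within)
     (use lambert_sums_deriv(1) in \<open>auto simp: field_differentiable_def\<close>)

lemma lambert_0 [simp]: "lambert 0 = 0"
  by (simp add: lambert_def)

definition log_disc :: "complex \<Rightarrow> complex" where
  "log_disc z = 2 * pi * \<i> * z - 24 * lambert (nome z)"

text \<open>The product \<open>q (1 - q)^24 (1 - q^2)^24 \<dots>\<close> in exponential form, so that it visibly has no zeros. Its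
  logarithmic derivative is the weight 2 Eisenstein series, whose conditionally convergent double sum yields the
  inversion formula.\<close>

definition modular_disc :: "complex \<Rightarrow> complex" where
  "modular_disc z = exp (log_disc z)"

lemma has_field_derivative_nome [derivative_intros]: "(nome has_field_derivative (2 * pi * \<i> * nome z)) (at z)"
  unfolding nome_def by (auto intro!: derivative_eq_intros)

text \<open>Termwise differentiation of \<open>lambert\<close> produces
  \<open>q^n / (1 - q^(n+1))^2\<close>, which \<open>csc_square_nome\<close> identifies with the
  rows of \<open>eisenstein_tail\<close>. As the rows are even in \<open>c\<close>, the sum over
  \<open>c \<ge> 1\<close> is half of the tail.\<close>

lemma log_disc_deriv:
  assumes z: "Im z > 0"
  shows "(log_disc has_field_derivative (2 * pi * \<i> + 6 * \<i> / pi * eisenstein_tail z)) (at z)"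
proof -
  define q where "q = nome z"
  have q1: "norm q < 1" unfolding q_def by (rule norm_nome_less_1[OF z])
  obtain g' where g': "(\<lambda>n. q ^ n / (1 - q ^ Suc n)^2) sums g'" "(lambert has_field_derivative g') (at q)"
    using lambert_sums_deriv(1)[OF q1] by blast
  have D: "(log_disc has_field_derivative (2 * pi * \<i> - 24 * (g' * (2 * pi * \<i> * q)))) (at z)"
    unfolding log_disc_def using g'(2) unfolding q_def
    by (auto intro!: derivative_eq_intros DERIV_chain2[where g = nome])
  interpret upper z by unfold_locales (rule z)
  have "csc_sq (of_int (- c) * z) = csc_sq (of_int c * z)" for c
    using csc_sq_minus[of "of_int c * z"] by simp
  from sums_of_even_has_sum_int[OF has_sum_eisenstein_tail this]
  have S: "(\<lambda>n. csc_sq (of_int (int (Suc n)) * z)) sums (eisenstein_tail z / 2)" .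
  have "csc_sq (of_int (int (Suc n)) * z) = (- 4 * pi^2 * q) * (q ^ n / (1 - q ^ Suc n)^2)" for n
  proof -
    have "Im (of_nat (Suc n) * z) \<noteq> 0" using z by (simp del: of_nat_Suc)
    from csc_square_nome[OF this] show ?thesis
      unfolding nome_of_nat_mult q_def csc_sq_def by (simp add: mult_ac)
  qed
  with S have "(\<lambda>n. (- 4 * pi^2 * q) * (q ^ n / (1 - q ^ Suc n)^2)) sums (eisenstein_tail z / 2)" by simp
  from sums_unique2[OF sums_mult[OF g'(1)] this]
  have "eisenstein_tail z = - 8 * pi^2 * q * g'" by (simp add: mult_ac)
  then have "2 * pi * \<i> + 6 * \<i> / pi * eisenstein_tail z = 2 * pi * \<i> - 24 * (g' * (2 * pi * \<i> * q))"
    by (simp add: power2_eq_square)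
  then show ?thesis using D by simp
qed

text \<open>The anomaly of the weight 2 series is exactly the derivative of \<open>12 Ln z\<close>,
  so \<open>F\<close> is constant. Its value at the fixed point \<open>\<i>\<close> is
  \<open>- 12 Ln \<i> = - 6 \<pi> \<i>\<close>, whose exponential is 1.\<close>

lemma modular_disc_inversion:
  fixes z :: complex
  assumes z: "Im z > 0"
  shows "modular_disc (- 1 / z) = z ^ 12 * modular_disc z"
proof -
  define F where "F = (\<lambda>z. log_disc (- 1 / z) - log_disc z - 12 * Ln z)"
  define H where "H = {z::complex. Im z > 0}"
  have "\<exists>c. \<forall>z\<in>H. F z = c"
  proof (rule has_field_derivative_zero_constant)
    show "convex H" unfolding H_def by (rule convex_halfspace_Im_gt)
    fix w assume "w \<in> H"
    then have w: "Im w > 0" by (simp add: H_def)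
    then have w0: "w \<noteq> 0" by auto
    have Iw: "Im (- 1 / w) > 0"
      using upper.Im_inverse_pos[of w] w by (simp add: upper_def)
    have wn: "w \<notin> \<real>\<^sub>\<le>\<^sub>0" using w by (auto simp: complex_nonpos_Reals_iff)
    have i: "((\<lambda>w. - 1 / w) has_field_derivative (1 / w^2)) (at w)"
      using w0 by (auto intro!: derivative_eq_intros simp: power2_eq_square field_simps)
    have "(F has_field_derivative ((2 * pi * \<i> + 6 * \<i> / pi * eisenstein_tail (- 1 / w)) * (1 / w^2)
        - (2 * pi * \<i> + 6 * \<i> / pi * eisenstein_tail w) - 12 * (1 / w))) (at w)"
      unfolding F_def
      by (intro DERIV_diff DERIV_cmult DERIV_chain2[OF log_disc_deriv[OF Iw] i] log_disc_deriv[OF w])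
         (use wn in \<open>auto intro!: derivative_eq_intros simp: divide_inverse\<close>)
    moreover have "(2 * pi * \<i> + 6 * \<i> / pi * eisenstein_tail (- 1 / w)) * (1 / w^2)
        - (2 * pi * \<i> + 6 * \<i> / pi * eisenstein_tail w) - 12 * (1 / w) = 0"
    proof -
      have "(2 * pi * \<i> + 6 * \<i> / pi * eisenstein_tail (- 1 / w)) * (1 / w^2)
        = 2 * pi * \<i> / w^2 + 6 * \<i> / pi * (eisenstein_tail (- 1 / w) / w^2)" by (simp add: algebra_simps)
      note this[unfolded eisenstein_tail_inversion[OF w]]
      then show ?thesis using w0 by (simp only:) (simp add: field_simps power2_eq_square)
    qed
    ultimately show "(F has_field_derivative 0) (at w within H)"
      by (simp add: has_field_derivative_at_within)
  qed
  then obtain c where c: "\<And>z. z \<in> H \<Longrightarrow> F z = c" by blast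
  have "F z = F \<i>" using c z by (simp add: H_def)
  also have "F \<i> = - (6 * pi * \<i>)"
  proof -
    have "- 1 / \<i> = \<i>" by simp
    then show ?thesis unfolding F_def by (simp only: Ln_ii) simp
  qed
  finally have "log_disc (- 1 / z) = log_disc z + 12 * Ln z + - (6 * pi * \<i>)" by (simp add: F_def algebra_simps)
  then have "modular_disc (- 1 / z) = modular_disc z * exp (12 * Ln z) * exp (- (6 * pi * \<i>))"
    unfolding modular_disc_def by (simp only: exp_add)
  also have "exp (12 * Ln z) = z ^ 12"
  proof -
    have "z \<noteq> 0" using z by auto
    then show ?thesis using exp_of_nat_mult[of 12 "Ln z"] by (simp add: exp_Ln)
  qed
  also have "exp (- (6 * pi * \<i>)) = 1"
    using exp_integer_2pi[of "-3"] by (simp add: mult_ac)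
  finally show ?thesis by (simp add: mult.commute)
qed

text \<open>This is \<open>2 ln |\<eta>(z)|\<close>, so that \<open>norm (f z) * exp (- k * log_eta z)\<close> is \<open>|f / \<eta>^(2k)|\<close>, which is invariant
  for a form of weight \<open>k\<close>.\<close>

definition log_eta :: "complex \<Rightarrow> real" where
  "log_eta z = Re (log_disc z) / 12"

lemma norm_modular_disc: "norm (modular_disc z) = exp (12 * log_eta z)"
  by (simp add: modular_disc_def log_eta_def)

lemma log_eta_inversion:
  assumes z: "Im z > 0"
  shows "log_eta (- 1 / z) = ln (norm z) + log_eta z"
proof -
  have "z \<noteq> 0" using z by auto
  then have "exp (12 * log_eta (- 1 / z)) = exp (12 * (ln (norm z) + log_eta z))"
    using arg_cong[OF modular_disc_inversion[OF z], of norm] exp_of_nat_mult[of 12 "ln (norm z)"]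
    by (simp add: norm_modular_disc norm_mult norm_power distrib_left exp_add)
  then show ?thesis by simp
qed

lemma log_eta_eq: "log_eta z = - pi / 6 * Im z - 2 * Re (lambert (nome z))"
  by (simp add: log_eta_def log_disc_def)

lemma log_eta_bounds:
  assumes "exp (- 2 * pi * Im z) \<le> r" "r < 1"
  shows "\<bar>log_eta z + pi / 6 * Im z\<bar> \<le> 2 * r / (1 - r)^2"
proof -
  have "\<bar>Re (lambert (nome z))\<bar> \<le> r / (1 - r)^2"
    using norm_lambert_le[of "nome z" r] abs_Re_le_cmod[of "lambert (nome z)"] assms by (simp add: norm_nome)
  then show ?thesis unfolding log_eta_eq by simp
qed

lemma modular_disc_periodic: "modular_disc (z + 1) = modular_disc z"
proof -
  have "log_disc (z + 1) = log_disc z + 2 * pi * \<i>"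
    unfolding log_disc_def nome_periodic by (simp add: algebra_simps)
  then show ?thesis by (simp add: modular_disc_def exp_add)
qed

lemma modular_disc_eq: "modular_disc z = nome z * exp (- 24 * lambert (nome z))"
  by (simp add: modular_disc_def log_disc_def nome_def exp_diff exp_minus divide_inverse)

section \<open>Periodic functions in the disc variable\<close>

lemma nome_eq_iff: "nome z = nome w \<longleftrightarrow> (\<exists>n::int. z = w + of_int n)"
proof
  assume "nome z = nome w"
  then obtain n :: int where n: "2 * of_real pi * \<i> * z = 2 * of_real pi * \<i> * w + (of_int (2 * n) * pi) * \<i>"
    unfolding nome_def exp_eq by auto
  then have "(2 * of_real pi * \<i>) * z = (2 * of_real pi * \<i>) * (w + of_int n)" by (simp add: algebra_simps)
  then show "\<exists>n::int. z = w + of_int n" by auto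
next
  assume "\<exists>n::int. z = w + of_int n"
  then show "nome z = nome w" by (auto simp: nome_add)
qed

lemma periodic_of_int:
  fixes g :: "complex \<Rightarrow> complex"
  assumes per: "\<And>z. Im z > 0 \<Longrightarrow> g (z + 1) = g z" and z: "Im z > 0"
  shows "g (z + of_int n) = g z"
proof -
  have P: "g (z + of_nat n) = g z" if "Im z > 0" for z n
  proof (induction n)
    case (Suc n)
    have e: "z + of_nat (Suc n) = (z + of_nat n) + 1" by simp
    show ?case unfolding e using per[of "z + of_nat n"] that Suc by simp
  qed simp
  show ?thesis
  proof (cases "n \<ge> 0")
    case True
    then show ?thesis using P[OF z, of "nat n"] by simp
  next
    case False
    then show ?thesis using P[of "z + of_int n" "nat (- n)"] z by simp
  qed
qed

lemma nome_Ln: "q \<noteq> 0 \<Longrightarrow> nome (Ln q / (2 * pi * \<i>)) = q"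
  by (simp add: nome_def)

lemma Im_Ln_over: "q \<noteq> 0 \<Longrightarrow> Im (Ln q / (2 * pi * \<i>)) = - ln (norm q) / (2 * pi)"
  by (simp add: Im_divide field_simps power2_eq_square)

lemma nome_surj:
  assumes "norm q = exp (- 2 * pi * y)"
  obtains z where "nome z = q" "Im z = y" "\<bar>Re z\<bar> \<le> 1/2"
proof
  have q0: "q \<noteq> 0" using assms by auto
  show "nome (Ln q / (2 * pi * \<i>)) = q" by (rule nome_Ln[OF q0])
  show "Im (Ln q / (2 * pi * \<i>)) = y" unfolding Im_Ln_over[OF q0] assms by simp
  have e: "Re (Ln q / (2 * pi * \<i>)) = Im (Ln q) / (2 * pi)"
    by (simp add: Re_divide field_simps power2_eq_square)
  have "\<bar>Im (Ln q)\<bar> \<le> pi" using Im_Ln_le_pi[OF q0] mpi_less_Im_Ln[OF q0] by linarith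
  then show "\<bar>Re (Ln q / (2 * pi * \<i>))\<bar> \<le> 1/2" unfolding e by (simp add: abs_divide field_simps)
qed

text \<open>Two branches of the logarithm define, by periodicity, the same function on the disc slit
  along the negative and along the positive reals. The two slit discs cover the punctured disc, and
  boundedness removes the singularity at 0.\<close>

lemma periodic_eq_disc_function:
  assumes hol: "g holomorphic_on upper_half_plane"
    and per: "\<And>z. Im z > 0 \<Longrightarrow> g (z + 1) = g z"
    and bdd: "\<And>z. Im z \<ge> 1 \<Longrightarrow> norm (g z) \<le> B"
  obtains h where "h holomorphic_on ball 0 1" "\<And>z. Im z > 0 \<Longrightarrow> g z = h (nome z)"
proof -
  have same: "g z = g w" if "nome z = nome w" "Im w > 0" for z w
    using periodic_of_int[of g w] per that by (auto simp: nome_eq_iff)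
  define h0 where "h0 = (\<lambda>q. g (Ln q / (2 * pi * \<i>)))"
  have im: "Im (Ln q / (2 * pi * \<i>)) > 0" if "q \<in> ball 0 1" "q \<noteq> 0" for q
  proof -
    have "ln (norm q) < 0" using that by simp
    then show ?thesis unfolding Im_Ln_over[OF that(2)] by (simp add: divide_neg_pos)
  qed
  \<comment> \<open>The cut of \<open>Ln (- q)\<close> lies on the positive reals. The shift by
    \<open>1 / 2\<close> undoes the sign, since \<open>nome (1 / 2) = - 1\<close>.\<close>
  define h1 where "h1 = (\<lambda>q. g (Ln (- q) / (2 * pi * \<i>) + 1 / 2))"
  have n2: "nome (1 / 2) = - 1"
  proof -
    have "of_real (2 * pi) * \<i> * (1 / 2) = \<i> * complex_of_real pi" by simp
    then show ?thesis unfolding nome_def by (simp only: exp_pi_i')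
  qed
  have h1: "h1 q = h0 q" if "q \<in> ball 0 1" "q \<noteq> 0" for q
  proof -
    have "nome (Ln (- q) / (2 * pi * \<i>) + 1 / 2) = q"
      unfolding nome_add n2 using nome_Ln[of "- q"] that by simp
    then show ?thesis unfolding h1_def h0_def using nome_Ln[of q] that im[of q] by (intro same) auto
  qed
  have H0: "h0 holomorphic_on (ball 0 1 - \<real>\<^sub>\<le>\<^sub>0)"
  proof -
    have "(g \<circ> (\<lambda>q. Ln q / (2 * pi * \<i>))) holomorphic_on (ball 0 1 - \<real>\<^sub>\<le>\<^sub>0)"
    proof (rule holomorphic_on_compose_gen[OF _ hol])
      show "(\<lambda>q. Ln q / (2 * pi * \<i>)) holomorphic_on (ball 0 1 - \<real>\<^sub>\<le>\<^sub>0)"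
        by (intro holomorphic_intros) auto
      show "(\<lambda>q. Ln q / (2 * pi * \<i>)) ` (ball 0 1 - \<real>\<^sub>\<le>\<^sub>0) \<subseteq> upper_half_plane"
      proof safe
        fix q :: complex assume q: "q \<in> ball 0 1" "q \<notin> \<real>\<^sub>\<le>\<^sub>0"
        then have "Im (Ln q / (2 * pi * \<i>)) > 0" by (intro im) auto
        then show "Ln q / (2 * pi * \<i>) \<in> upper_half_plane" by (simp add: upper_half_plane_def del: Im_divide)
      qed
    qed
    then show ?thesis by (simp add: h0_def o_def)
  qed
  have H1: "h1 holomorphic_on (ball 0 1 - \<real>\<^sub>\<ge>\<^sub>0)"
  proof -
    have "(g \<circ> (\<lambda>q. Ln (- q) / (2 * pi * \<i>) + 1 / 2)) holomorphic_on (ball 0 1 - \<real>\<^sub>\<ge>\<^sub>0)"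
    proof (rule holomorphic_on_compose_gen[OF _ hol])
      show "(\<lambda>q. Ln (- q) / (2 * pi * \<i>) + 1 / 2) holomorphic_on (ball 0 1 - \<real>\<^sub>\<ge>\<^sub>0)"
        by (intro holomorphic_intros) (auto simp: complex_nonpos_Reals_iff complex_nonneg_Reals_iff)
      show "(\<lambda>q. Ln (- q) / (2 * pi * \<i>) + 1 / 2) ` (ball 0 1 - \<real>\<^sub>\<ge>\<^sub>0) \<subseteq> upper_half_plane"
      proof safe
        fix q :: complex assume q: "q \<in> ball 0 1" "q \<notin> \<real>\<^sub>\<ge>\<^sub>0"
        then have "Im (Ln (- q) / (2 * pi * \<i>)) > 0" by (intro im) auto
        then show "Ln (- q) / (2 * pi * \<i>) + 1 / 2 \<in> upper_half_plane" by (simp add: upper_half_plane_def del: Im_divide)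
      qed
    qed
    then show ?thesis by (simp add: h1_def o_def)
  qed
  have H1': "h0 holomorphic_on (ball 0 1 - \<real>\<^sub>\<ge>\<^sub>0)"
    by (rule holomorphic_transform[OF H1]) (metis Diff_iff h1 nonneg_Reals_zero_I)
  have "h0 holomorphic_on ((ball 0 1 - \<real>\<^sub>\<le>\<^sub>0) \<union> (ball 0 1 - \<real>\<^sub>\<ge>\<^sub>0))"
    by (rule holomorphic_on_Un[OF H0 H1']) (auto intro!: open_Diff closed_nonpos_Reals_complex closed_nonneg_Reals_complex)
  moreover have "(ball 0 1 - \<real>\<^sub>\<le>\<^sub>0) \<union> (ball 0 1 - \<real>\<^sub>\<ge>\<^sub>0) = ball 0 1 - {0::complex}"
    by (auto simp: complex_nonpos_Reals_iff complex_nonneg_Reals_iff complex_eq_iff)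
  ultimately have hol0: "h0 holomorphic_on (ball 0 1 - {0})" by simp
  have "\<forall>\<^sub>F q in at 0. norm (h0 q) \<le> B"
    unfolding eventually_at
  proof (intro exI[of _ "exp (- 2 * pi)"] conjI ballI impI)
    fix q :: complex assume q: "q \<noteq> 0 \<and> dist q 0 < exp (- 2 * pi)"
    then have "ln (norm q) \<le> - 2 * pi" using ln_le_cancel_iff[of "norm q" "exp (- 2 * pi)"] by simp
    then have "Im (Ln q / (2 * pi * \<i>)) \<ge> 1" using q unfolding Im_Ln_over[OF conjunct1[OF q]] by (simp add: field_simps)
    then show "norm (h0 q) \<le> B" unfolding h0_def by (rule bdd)
  qed auto
  then have "\<exists>h. h holomorphic_on ball 0 1 \<and> (\<forall>q\<in>ball 0 1 - {0}. h q = h0 q)"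
    using holomorphic_on_extend_bounded[OF hol0] by auto
  then obtain h where h: "h holomorphic_on ball 0 1" "\<And>q. q \<in> ball 0 1 - {0} \<Longrightarrow> h q = h0 q" by blast
  have "g z = h (nome z)" if z: "Im z > 0" for z
  proof -
    have "nome z \<in> ball 0 1 - {0}" using norm_nome_less_1[OF z] by simp
    moreover have "g (Ln (nome z) / (2 * pi * \<i>)) = g z"
      by (rule same[OF nome_Ln z]) simp
    ultimately show ?thesis using h(2) by (simp add: h0_def)
  qed
  with h(1) show ?thesis using that by blast
qed

lemma power_series_factor:
  assumes "\<And>q. q \<in> ball 0 1 \<Longrightarrow> (\<lambda>n. a n * q ^ n) sums h q"
  obtains g where "g holomorphic_on ball 0 1" "g 0 = a N"
    "\<And>q. q \<in> ball 0 1 \<Longrightarrow> h q = (\<Sum>n<N. a n * q ^ n) + q ^ N * (g q :: complex)"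
proof -
  define g where "g = (\<lambda>q. \<Sum>n. a (n + N) * q ^ n)"
  have sm: "summable (\<lambda>n. a (n + N) * q ^ n)" if q: "q \<in> ball 0 1" for q
  proof (cases "q = 0")
    case False
    have "summable (\<lambda>n. a (n + N) * q ^ (n + N))"
      using sums_summable[OF assms[OF q]] by (subst summable_iff_shift)
    then have "summable (\<lambda>n. q ^ N * (a (n + N) * q ^ n))" by (simp add: power_add mult_ac)
    then show ?thesis using False by (simp add: summable_cmult_iff)
  next
    case True
    show ?thesis by (rule summable_finite[of "{0}"]) (auto simp: True)
  qed
  have g: "(\<lambda>n. a (n + N) * (q - 0) ^ n) sums g q" if "q \<in> ball 0 1" for q
    using summable_sums[OF sm[OF that]] by (simp add: g_def)
  have "g holomorphic_on ball 0 1" by (rule power_series_holomorphic[OF g])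
  moreover have "g 0 = a N" using powser_zero[of "\<lambda>n. a (n + N)"] by (simp add: g_def)
  moreover have "h q = (\<Sum>n<N. a n * q ^ n) + q ^ N * g q" if q: "q \<in> ball 0 1" for q
  proof -
    have "(\<lambda>n. a (n + N) * q ^ (n + N)) sums (q ^ N * g q)"
      using sums_mult[OF g[OF q], of "q ^ N"] by (simp add: power_add mult_ac)
    then have "(\<lambda>n. a n * q ^ n) sums (q ^ N * g q + (\<Sum>n<N. a n * q ^ n))" by (subst (asm) sums_iff_shift)
    then show ?thesis using sums_unique2[OF assms[OF q]] by (simp add: add.commute)
  qed
  ultimately show ?thesis using that by blast
qed

lemma holomorphic_disc_factor:
  assumes h: "h holomorphic_on ball 0 1"
  obtains g where "g holomorphic_on ball 0 1"
    "\<And>q. q \<in> ball 0 1 \<Longrightarrow> h q = (\<Sum>n<N. (deriv ^^ n) h 0 / fact n * q ^ n) + q ^ N * (g q :: complex)"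
proof -
  have s: "(\<lambda>n. (deriv ^^ n) h 0 / fact n * q ^ n) sums h q" if "q \<in> ball 0 1" for q
    using holomorphic_power_series[OF h that] by simp
  show ?thesis by (rule power_series_factor[of "\<lambda>n. (deriv ^^ n) h 0 / fact n" h N, OF s]) (auto intro: that)
qed

text \<open>Cauchy's inequality on the circle \<open>|q| = exp (- 2 \<pi> y)\<close>, which is the
  image of one period of the line \<open>Im z = y\<close>.\<close>

lemma taylor_coefficient_bound:
  assumes h: "h holomorphic_on ball 0 1" and y: "y > 0"
    and B: "\<And>z. Im z = y \<Longrightarrow> \<bar>Re z\<bar> \<le> 1/2 \<Longrightarrow> norm (h (nome z)) \<le> B"
  shows "norm ((deriv ^^ n) h 0 / fact n) \<le> B * exp (2 * pi * real n * y)"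
proof -
  define r where "r = exp (- 2 * pi * y)"
  have r: "0 < r" "r < 1" using y by (auto simp: r_def)
  have "norm ((deriv ^^ n) h 0) \<le> fact n * B / r ^ n"
  proof (rule Cauchy_inequality)
    show "h holomorphic_on ball 0 r" using h r by (auto elim: holomorphic_on_subset)
    show "continuous_on (cball 0 r) h"
      by (rule continuous_on_subset[OF holomorphic_on_imp_continuous_on[OF h]]) (use r in auto)
    fix q :: complex assume "norm (0 - q) = r"
    then have "norm q = exp (- 2 * pi * y)" by (simp add: r_def)
    then obtain z where "nome z = q" "Im z = y" "\<bar>Re z\<bar> \<le> 1/2" by (rule nome_surj)
    then show "norm (h q) \<le> B" using B by auto
  qed (use r in auto)
  moreover have "1 / r ^ n = exp (2 * pi * real n * y)"
  proof -
    have "r ^ n = exp (- (2 * pi * real n * y))"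
      unfolding r_def exp_of_nat_mult[symmetric] by (simp add: mult_ac)
    then show ?thesis by (simp add: exp_minus inverse_eq_divide)
  qed
  ultimately have "norm ((deriv ^^ n) h 0) \<le> fact n * (B * exp (2 * pi * real n * y))" by (metis divide_inverse inverse_eq_divide mult.assoc)
  then have "norm ((deriv ^^ n) h 0) / fact n \<le> (fact n * (B * exp (2 * pi * real n * y))) / fact n" by (intro divide_right_mono) auto
  then show ?thesis by (simp add: norm_divide)
qed

text \<open>Maximum principle on the disc that corresponds to the half plane above height
  \<open>y\<close>. The maximum is represented by a point with \<open>|Re z| \<le> 1/2\<close>,
  because the inversion raises such points when \<open>y = 4/5\<close>.\<close>

lemma disc_maximum:
  assumes G: "G holomorphic_on ball 0 1" and y: "y > 0"
  obtains z1 where "Im z1 = y" "\<bar>Re z1\<bar> \<le> 1/2" "\<And>q. norm q \<le> exp (- 2 * pi * y) \<Longrightarrow> norm (G q) \<le> norm (G (nome z1))"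
proof -
  define r where "r = exp (- 2 * pi * y)"
  have r: "0 < r" "r < 1" using y by (auto simp: r_def)
  have cont: "continuous_on (cball 0 r) G"
    by (rule continuous_on_subset[OF holomorphic_on_imp_continuous_on[OF G]]) (use r in auto)
  have "\<exists>q1\<in>sphere 0 r. \<forall>q\<in>sphere 0 r. norm (G q) \<le> norm (G q1)"
    by (rule continuous_attains_sup) (use r cont in \<open>auto intro!: continuous_intros elim: continuous_on_subset\<close>)
  then obtain q1 where q1: "norm q1 = r" and mx: "\<And>q. norm q = r \<Longrightarrow> norm (G q) \<le> norm (G q1)" by auto
  obtain z1 where z1: "nome z1 = q1" "Im z1 = y" "\<bar>Re z1\<bar> \<le> 1/2" using nome_surj[of q1 y] q1 unfolding r_def by blast
  have "norm (G q) \<le> norm (G (nome z1))" if "norm q \<le> exp (- 2 * pi * y)" for q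
  proof (rule maximum_modulus_frontier[of G "cball 0 r"])
    show "G holomorphic_on interior (cball 0 r)" using G r by (auto elim!: holomorphic_on_subset)
    show "continuous_on (closure (cball 0 r)) G" using cont by simp
    fix w :: complex assume "w \<in> frontier (cball 0 r)"
    then have "norm w = r" using r by (simp add: frontier_cball)
    then show "norm (G w) \<le> norm (G (nome z1))" using mx z1 by simp
  qed (use that in \<open>auto simp: r_def\<close>)
  with z1 that show ?thesis by blast
qed

lemma Im_minus_inverse: "Im (- 1 / z) = Im z / (norm z)^2"
  by (simp add: Im_divide cmod_power2)

section \<open>Approximation by a truncated Poincare series\<close>

text \<open>Division by \<open>\<eta>^(2k)\<close> contributes \<open>q^(- k / 12)\<close> and the
  zero-free factor \<open>exp (2 k lambert)\<close>. As \<open>k / 12\<close> need not be an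
  integer, only norms are compared, and the fractional power stays a real exponential in
  \<open>Im z\<close>.\<close>

lemma norm_log_eta_weight:
  fixes T g :: "complex \<Rightarrow> complex"
  assumes "T z = nome z ^ N * g (nome z)"
  shows "norm (T z) * exp (- real k * log_eta z) =
    norm (g (nome z) * exp (2 * of_nat k * lambert (nome z))) * exp (- 2 * pi * (real N - real k / 12) * Im z)"
proof -
  have "norm (nome z ^ N) = exp (- 2 * pi * real N * Im z)"
    unfolding norm_power norm_nome exp_of_nat_mult[symmetric] by (simp add: mult_ac)
  moreover have "exp (- real k * log_eta z) = exp (real k * pi / 6 * Im z) * exp (2 * real k * Re (lambert (nome z)))"
    unfolding log_eta_eq exp_add[symmetric] by (simp add: algebra_simps)
  moreover have "exp (- 2 * pi * real N * Im z) * exp (real k * pi / 6 * Im z) = exp (- 2 * pi * (real N - real k / 12) * Im z)"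
    unfolding exp_add[symmetric] by (rule arg_cong[of _ _ exp]) (simp add: field_simps)
  ultimately show ?thesis unfolding assms by (simp add: norm_mult mult_ac)
qed

text \<open>The weighted function attains its maximum over \<open>Im z \<ge> 4/5\<close> on the boundary line, whose points are moved
  by the inversion to height at least \<open>80/89\<close>; there the vanishing at the cusp gains the factor \<open>10/11\<close>.\<close>

lemma modular_contraction:
  fixes T g :: "complex \<Rightarrow> complex" and k N :: nat
  assumes g: "g holomorphic_on ball 0 1"
    and T: "\<And>z. Im z > 0 \<Longrightarrow> T z = nome z ^ N * g (nome z)"
    and k: "k + 2 \<le> 12 * N"
    and step: "\<And>z. Im z = 4/5 \<Longrightarrow> \<bar>Re z\<bar> \<le> 1/2 \<Longrightarrow>
      norm (T z) * exp (- real k * log_eta z) \<le> A + norm (T (- 1 / z)) * exp (- real k * log_eta (- 1 / z))"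
    and z: "Im z \<ge> 4/5"
  shows "norm (T z) * exp (- real k * log_eta z) \<le> 11 * A"
proof -
  define G where "G = (\<lambda>q. g q * exp (2 * of_nat k * lambert q))"
  define \<delta> where "\<delta> = real N - real k / 12"
  have "real k + 2 \<le> 12 * real N" using k by linarith
  \<comment> \<open>The spare order of vanishing beyond \<open>k / 12\<close>, at least
    \<open>2 / 12\<close>.\<close>
  then have \<delta>: "\<delta> \<ge> 1/6" unfolding \<delta>_def by simp
  have G: "G holomorphic_on ball 0 1"
    unfolding G_def by (intro holomorphic_intros g lambert_holomorphic)
  have W: "norm (T z) * exp (- real k * log_eta z) = norm (G (nome z)) * exp (- 2 * pi * \<delta> * Im z)" if "Im z > 0" for z
    unfolding G_def \<delta>_def by (rule norm_log_eta_weight[where T = T and g = g]) (rule T[OF that])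
  obtain z1 where z1: "Im z1 = 4/5" "\<bar>Re z1\<bar> \<le> 1/2"
    and mx: "\<And>q. norm q \<le> exp (- 2 * pi * (4/5)) \<Longrightarrow> norm (G q) \<le> norm (G (nome z1))"
    using disc_maximum[OF G, of "4/5"] by auto
  have mono: "norm (G (nome w)) \<le> norm (G (nome z1))" if "Im w \<ge> 4/5" for w
    by (rule mx) (use that in \<open>simp add: norm_nome\<close>)
  define S where "S = norm (G (nome z1)) * exp (- 2 * pi * \<delta> * (4/5))"
  have S0: "S \<ge> 0" by (simp add: S_def)
  define w where "w = - 1 / z1"
  have "(norm z1)^2 = (Re z1)^2 + (4/5)^2" by (simp add: cmod_power2 z1)
  also have "(Re z1)^2 \<le> (1/2)^2" using z1(2) by (metis abs_ge_zero power2_abs power_mono)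
  finally have n: "(norm z1)^2 \<le> 89/100" by (simp add: power2_eq_square)
  have "z1 \<noteq> 0" using z1 by auto
  then have n0: "(norm z1)^2 > 0" by simp
  have Imw: "Im w \<ge> 80/89"
    unfolding w_def Im_minus_inverse z1 using n n0 by (simp add: field_simps)
  have "S \<le> A + norm (T w) * exp (- real k * log_eta w)"
    using step[OF z1] W[of z1] z1 unfolding w_def S_def by simp
  also have "norm (T w) * exp (- real k * log_eta w) = norm (G (nome w)) * exp (- 2 * pi * \<delta> * Im w)"
    by (rule W) (use Imw in linarith)
  also have "\<dots> \<le> norm (G (nome z1)) * exp (- 2 * pi * \<delta> * Im w)"
    by (rule mult_right_mono[OF mono]) (use Imw in auto)
  also have "exp (- 2 * pi * \<delta> * Im w) = exp (- 2 * pi * \<delta> * (4/5)) * exp (- (2 * pi * \<delta> * (Im w - 4/5)))"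
    unfolding exp_add[symmetric] by (simp add: algebra_simps)
  also have "exp (- (2 * pi * \<delta> * (Im w - 4/5))) \<le> 10 / 11"
  proof -
    have "2 * 3 * (1/6) * (1/10) \<le> 2 * pi * \<delta> * (Im w - 4/5)"
    proof -
      \<comment> \<open>The height gained, \<open>80/89 - 4/5 = 44/445\<close>, is slightly less
        than \<open>1/10\<close>; the bound \<open>3.1\<close> for \<open>pi\<close> makes up for
        it.\<close>
      have "2 * 3.1 * (1/6) * (80/89 - 4/5) \<le> 2 * pi * \<delta> * (Im w - 4/5)"
        using \<delta> Imw pi_approx by (intro mult_mono) auto
      then show ?thesis by simp
    qed
    then have "11 / 10 \<le> exp (2 * pi * \<delta> * (Im w - 4/5))"
      using exp_ge_add_one_self[of "2 * pi * \<delta> * (Im w - 4/5)"] by linarith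
    then have "1 / exp (2 * pi * \<delta> * (Im w - 4/5)) \<le> 1 / (11 / 10)" by (intro frac_le) auto
    then show ?thesis by (simp add: exp_minus inverse_eq_divide)
  qed
  finally have "S \<le> A + norm (G (nome z1)) * (exp (- 2 * pi * \<delta> * (4/5)) * (10 / 11))"
    by (simp add: mult_left_mono)
  \<comment> \<open>\<open>S\<close> occurs on both sides, and absorbing it gives the factor
    \<open>11 = 1 / (1 - 10 / 11)\<close>.\<close>
  then have "S \<le> A + S * (10 / 11)" by (simp add: S_def)
  then have SA: "S \<le> 11 * A" by simp
  have "norm (T z) * exp (- real k * log_eta z) = norm (G (nome z)) * exp (- 2 * pi * \<delta> * Im z)"
    by (rule W) (use z in linarith)
  also have "\<dots> \<le> norm (G (nome z1)) * exp (- 2 * pi * \<delta> * (4/5))"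
  proof (rule mult_mono[OF mono[OF z]])
    have "pi * \<delta> * (4/5) \<le> pi * \<delta> * Im z" using \<delta> z by (intro mult_left_mono) auto
    then show "exp (- 2 * pi * \<delta> * Im z) \<le> exp (- 2 * pi * \<delta> * (4/5))" by simp
  qed auto
  finally show ?thesis using SA by (simp add: S_def)
qed

text \<open>The image of \<open>q^m\<close> under the weight \<open>k\<close> slash action of
  \<open>z \<mapsto> - 1 / (z + d)\<close>. Summed over \<open>d\<close>, these are the terms of the
  Poincare series whose lower left entry is \<open>1\<close> up to sign; \<open>q^m\<close> itself
  is the term with entry 0.\<close>

definition slash_term :: "nat \<Rightarrow> nat \<Rightarrow> int \<Rightarrow> complex \<Rightarrow> complex" where
  "slash_term k m d z = nome (- of_nat m / (z + of_int d)) / (z + of_int d) ^ k"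

definition slash_series :: "nat \<Rightarrow> nat \<Rightarrow> complex \<Rightarrow> complex" where
  "slash_series k m z = (\<Sum>\<^sub>\<infinity>d. slash_term k m d z)"

lemma norm_nome_inverse_le_1:
  assumes "Im w > 0"
  shows "norm (nome (- of_nat m / w)) \<le> 1"
proof -
  have I: "Im (of_nat m * u) = real m * Im u" for u by simp
  have "- of_nat m / w = of_nat m * (- 1 / w)" by simp
  then have "Im (- of_nat m / w) = real m * (Im w / (norm w)^2)"
    by (simp only: I Im_minus_inverse)
  then have "Im (- of_nat m / w) \<ge> 0" using assms by simp
  then have "2 * pi * Im (- of_nat m / w) \<ge> 0" by (intro mult_nonneg_nonneg) auto
  then show ?thesis unfolding norm_nome by (simp only: exp_le_one_iff mult_minus_left neg_le_0_iff_le)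
qed

lemma norm_slash_term_le:
  assumes "Im z > 0"
  shows "norm (slash_term k m d z) \<le> 1 / norm (z + of_int d) ^ k"
proof -
  have "norm (nome (- of_nat m / (z + of_int d))) \<le> 1"
    by (rule norm_nome_inverse_le_1) (use assms in simp)
  then show ?thesis unfolding slash_term_def norm_divide norm_power by (intro divide_right_mono) auto
qed

text \<open>Of the \<open>k\<close> powers of \<open>|d| / 2 \<ge> 1\<close> two are kept for
  summability over \<open>d\<close> and the others are dropped; the smallness is carried by
  \<open>c^(-k)\<close>.\<close>

lemma norm_slash_term_le':
  assumes z: "Im z > 0" and b: "norm (z + of_int d) \<ge> c * \<bar>of_int d\<bar> / 2" and c: "c > 0" and d: "\<bar>d\<bar> \<ge> 2" and k: "k \<ge> 2"
  shows "norm (slash_term k m d z) \<le> (4 / c ^ k) * (1 / (of_int d)^2)"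
proof -
  define D where "D = \<bar>real_of_int d\<bar> / 2"
  have D: "D \<ge> 1" using d unfolding D_def by linarith
  have "norm (slash_term k m d z) \<le> 1 / norm (z + of_int d) ^ k" by (rule norm_slash_term_le[OF z])
  also have "\<dots> \<le> 1 / (c * D) ^ k"
    using b c D by (intro frac_le power_mono zero_less_power) (simp_all add: D_def)
  also have "\<dots> \<le> 1 / (c ^ k * D ^ 2)"
  proof (rule divide_left_mono)
    show "c ^ k * D ^ 2 \<le> (c * D) ^ k"
      unfolding power_mult_distrib using c D k by (intro mult_left_mono power_increasing) auto
  qed (use c D in auto)
  also have "\<dots> = (4 / c ^ k) * (1 / (of_int d)^2)" by (simp add: D_def power_divide power2_eq_square)
  finally show ?thesis .
qed

lemma summable_on_if_inverse_square:
  fixes f :: "int \<Rightarrow> complex"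
  assumes f: "\<And>d. \<bar>d\<bar> \<ge> n0 \<Longrightarrow> norm (f d) \<le> B * (1 / (of_int d)^2)"
  shows "f summable_on UNIV"
proof (rule has_sum_imp_summable[OF has_sum_int])
  have *: "summable (\<lambda>n. norm (f (g n)))" if g: "\<And>n. \<bar>g n\<bar> = int (Suc n)" for g
  proof (rule summable_comparison_test_ev)
    show "summable (\<lambda>n. B * (1 / (real (Suc n))^2))" by (rule summable_mult[OF summable_inverse_square_shift])
    show "\<forall>\<^sub>F n in sequentially. norm (norm (f (g n))) \<le> B * (1 / (real (Suc n))^2)"
      using eventually_ge_at_top[of "nat n0"]
    proof eventually_elim
      case (elim n)
      have "real_of_int (g n)^2 = (real (Suc n))^2" using g[of n] by (metis of_int_abs of_int_of_nat_eq power2_abs)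
      then show ?case using f[of "g n"] g[of n] elim by simp
    qed
  qed
  show "summable (\<lambda>n. norm (f (int (Suc n))))" "summable (\<lambda>n. norm (f (- int (Suc n))))"
    by (rule *; simp)+
qed

text \<open>The constant 4 bounds \<open>\<pi>^2 / 3\<close>, the sum of \<open>1 / d^2\<close> over
  all \<open>d \<noteq> 0\<close>.\<close>

lemma norm_infsum_tail_le:
  fixes f :: "int \<Rightarrow> complex"
  assumes f: "\<And>d. \<bar>d\<bar> \<ge> 2 \<Longrightarrow> norm (f d) \<le> B * (1 / (of_int d)^2)"
  shows "norm (infsum f UNIV - (f 0 + f 1 + f (- 1))) \<le> 4 * B"
proof -
  define X where "X = - {0, 1, - 1 :: int}"
  have X: "d \<in> X \<Longrightarrow> \<bar>d\<bar> \<ge> 2" for d by (auto simp: X_def)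
  have s: "f summable_on UNIV" by (rule summable_on_if_inverse_square[of 2 f B]) (use f in auto)
  have "infsum f UNIV = infsum f ({0, 1, -1} \<union> X)" by (simp add: X_def)
  also have "\<dots> = infsum f {0, 1, - 1} + infsum f X"
    by (rule infsum_Un_disjoint) (auto simp: X_def intro: summable_on_subset[OF s])
  finally have e: "infsum f UNIV - (f 0 + f 1 + f (- 1)) = infsum f X" by (simp add: add.assoc)
  have B0: "B \<ge> 0"
  proof -
    have "0 \<le> B * (1 / (real_of_int 2)^2)" by (rule order_trans[OF norm_ge_zero f]) simp
    then show ?thesis by simp
  qed
  let ?g = "\<lambda>d::int. 1 / (real_of_int d)^2"
  have h: "(?g has_sum (pi^2 / 3)) (- {0})"
  proof -
    have "((\<lambda>d::int. complex_of_real (1 / (real_of_int d)^2)) has_sum complex_of_real (pi^2/3)) (- {0})"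
      using has_sum_inverse_squares_int by simp
    then show ?thesis by (simp only: has_sum_of_real_iff)
  qed
  have gX: "?g summable_on X" by (rule summable_on_subset[OF has_sum_imp_summable[OF h]]) (auto simp: X_def)
  have "infsum ?g X \<le> infsum ?g (- {0})"
    by (rule infsum_mono2[OF gX has_sum_imp_summable[OF h]]) (auto simp: X_def)
  also have "\<dots> = pi^2/3" using h by (rule infsumI)
  also have "\<dots> \<le> 4"
  proof -
    have "pi ^ 2 \<le> 3.2 ^ 2" using pi_approx by (intro power_mono) auto
    then show ?thesis by (simp add: power2_eq_square)
  qed
  finally have g4: "infsum ?g X \<le> 4" .
  have "norm (infsum f X) \<le> infsum (\<lambda>d. B * ?g d) X"
    by (rule norm_infsum_le[OF has_sum_infsum has_sum_infsum])
       (rule summable_on_subset[OF s subset_UNIV], rule summable_on_cmult_right[OF gX], use X f in blast)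
  also have "\<dots> = B * infsum ?g X" by (rule infsum_cmult_right) (use gX in auto)
  also have "\<dots> \<le> B * 4" by (rule mult_left_mono[OF g4 B0])
  finally show ?thesis unfolding e by simp
qed

lemma slash_term_bound_locally:
  assumes z: "Im z > 0" and d: "\<bar>of_int d\<bar> \<ge> 2 * (norm z + 1)" and k: "k \<ge> 2"
  shows "norm (slash_term k m d z) \<le> 4 * (1 / (of_int d)^2)"
proof -
  have "\<bar>real_of_int d\<bar> \<ge> 2" by (rule order_trans[OF _ d]) simp
  then have "\<bar>d\<bar> \<ge> 2" by linarith
  moreover have "norm (z + of_int d) \<ge> 1 * \<bar>of_int d\<bar> / 2" using cmod_add_of_int_ge[of z d] d by simp
  ultimately show ?thesis using norm_slash_term_le'[of z 1 d k m] z k by simp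
qed

lemma slash_term_summable:
  assumes z: "Im z > 0" and k: "k \<ge> 2"
  shows "(\<lambda>d. slash_term k m d z) summable_on UNIV"
proof (rule summable_on_if_inverse_square)
  fix d :: int assume "\<bar>d\<bar> \<ge> \<lceil>2 * (norm z + 1)\<rceil>"
  then have "\<bar>of_int d\<bar> \<ge> 2 * (norm z + 1)" by (simp only: ceiling_le_iff of_int_abs)
  then show "norm (slash_term k m d z) \<le> 4 * (1 / (of_int d)^2)" by (rule slash_term_bound_locally[OF z _ k])
qed

lemma slash_series_periodic:
  assumes z: "Im z > 0" and k: "k \<ge> 2"
  shows "slash_series k m (z + 1) = slash_series k m z"
proof -
  have "slash_term k m d (z + 1) = slash_term k m (d + 1) z" for d
    by (simp add: slash_term_def add_ac)
  moreover have "infsum (\<lambda>d. slash_term k m (d + 1) z) UNIV = infsum (\<lambda>d. slash_term k m d z) UNIV"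
    by (rule infsum_reindex_bij_witness[of _ "\<lambda>d. d - 1" "\<lambda>d. d + 1"]) auto
  ultimately show ?thesis by (simp add: slash_series_def)
qed

lemma slash_term_has_derivative:
  assumes z: "Im z > 0"
  shows "(slash_term k m d has_field_derivative deriv (slash_term k m d) z) (at z)"
proof -
  have "slash_term k m d holomorphic_on upper_half_plane"
    unfolding slash_term_def[abs_def] nome_def
  proof (intro holomorphic_intros)
    fix w assume "w \<in> upper_half_plane"
    then show "w + of_int d \<noteq> 0" by (auto simp: upper_half_plane_def complex_eq_iff)
    then show "(w + of_int d) ^ k \<noteq> 0" by simp
  qed
  then show ?thesis
    by (rule holomorphic_derivI) (use z in \<open>auto simp: upper_half_plane_def open_halfspace_Im_gt\<close>)
qed

lemma slash_series_holomorphic: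
  assumes k: "k \<ge> 2"
  shows "slash_series k m holomorphic_on upper_half_plane"
proof -
  have op: "open upper_half_plane" unfolding upper_half_plane_def by (rule open_halfspace_Im_gt)
  \<comment> \<open>Pairing \<open>n + 1\<close> with \<open>- (n + 1)\<close> turns the unordered
    sum into an ordinary series, for which termwise differentiation is available. The term
    \<open>d = 0\<close> is added at the end.\<close>
  let ?f = "\<lambda>n z. slash_term k m (int (Suc n)) z + slash_term k m (- int (Suc n)) z"
  let ?f' = "\<lambda>n z. deriv (slash_term k m (int (Suc n))) z + deriv (slash_term k m (- int (Suc n))) z"
  have "\<exists>g g'. \<forall>x\<in>upper_half_plane. ((\<lambda>n. ?f n x) sums g x) \<and> ((\<lambda>n. ?f' n x) sums g' x) \<and> (g has_field_derivative g' x) (at x)"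
  proof (rule series_and_derivative_comparison_complex[OF op])
    fix n x assume "x \<in> upper_half_plane"
    then show "(?f n has_field_derivative ?f' n x) (at x)"
      by (intro DERIV_add slash_term_has_derivative) (auto simp: upper_half_plane_def)
  next
    fix x assume "x \<in> upper_half_plane"
    let ?h = "\<lambda>n. complex_of_real (8 * (1 / (real (Suc n))^2))"
    have A2: "summable ?h"
      unfolding summable_complex_of_real by (rule summable_mult[OF summable_inverse_square_shift])
    have A3: "range ?h \<subseteq> \<real>\<^sub>\<ge>\<^sub>0" by (auto simp del: of_nat_Suc of_real_mult of_real_divide of_real_power)
    have A4: "\<forall>\<^sub>F n in sequentially. \<forall>y\<in>ball x 1 \<inter> upper_half_plane. norm (?f n y) \<le> norm (?h n)"
      using eventually_ge_at_top[of "nat \<lceil>2 * (norm x + 2)\<rceil>"]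
    proof eventually_elim
      case (elim n)
      show ?case
      proof
        fix y assume y: "y \<in> ball x 1 \<inter> upper_half_plane"
        then have "norm y \<le> norm x + 1" by (metis IntD1 dist_commute dist_norm less_eq_real_def mem_ball norm_triangle_sub order_trans add_left_mono)
        then have n: "real (Suc n) \<ge> 2 * (norm y + 1)" using elim unfolding nat_ceiling_le_eq by simp
        have Iy: "Im y > 0" using y by (simp add: upper_half_plane_def)
        have b: "norm (slash_term k m (int (Suc n)) y) \<le> 4 * (1 / (of_int (int (Suc n)))^2)"
          "norm (slash_term k m (- int (Suc n)) y) \<le> 4 * (1 / (of_int (- int (Suc n)))^2)"
          using n by (intro slash_term_bound_locally[OF Iy _ k]; simp)+
        have e: "(real_of_int (- int (Suc n)))^2 = (real (Suc n))^2" "(real_of_int (int (Suc n)))^2 = (real (Suc n))^2"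
          by (simp_all only: of_int_minus power2_minus of_int_of_nat_eq)
        have "norm (?f n y) \<le> 4 * (1 / (real (Suc n))^2) + 4 * (1 / (real (Suc n))^2)"
          by (rule order_trans[OF norm_triangle_ineq add_mono[OF b[unfolded e]]])
        then show "norm (?f n y) \<le> norm (?h n)" unfolding norm_of_real by linarith
      qed
    qed
    show "\<exists>d (h :: nat \<Rightarrow> complex). 0 < d \<and> summable h \<and> range h \<subseteq> \<real>\<^sub>\<ge>\<^sub>0 \<and>
        (\<forall>\<^sub>F n in sequentially. \<forall>y\<in>ball x d \<inter> upper_half_plane. norm (?f n y) \<le> norm (h n))"
      by (rule exI[of _ 1], rule exI[of _ ?h], intro conjI zero_less_one A2 A3 A4)
  qed
  then obtain g g' where g: "\<And>x. x \<in> upper_half_plane \<Longrightarrow> ((\<lambda>n. ?f n x) sums g x) \<and> (g has_field_derivative g' x) (at x)"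
    by blast
  have "slash_series k m z = slash_term k m 0 z + g z" if z: "z \<in> upper_half_plane" for z
  proof -
    have Iz: "Im z > 0" using z by (simp add: upper_half_plane_def)
    have sm: "(\<lambda>d. norm (slash_term k m d z)) summable_on UNIV"
      using slash_term_summable[OF Iz k] by (simp flip: summable_on_iff_abs_summable_on_complex)
    have s: "summable (\<lambda>n. norm (slash_term k m (u n) z))" if "inj u" for u :: "nat \<Rightarrow> int"
    proof -
      have "(\<lambda>d. norm (slash_term k m d z)) summable_on range u" by (rule summable_on_subset[OF sm]) auto
      then have "(\<lambda>n. norm (slash_term k m (u n) z)) summable_on UNIV"
        using summable_on_reindex[OF that, of "\<lambda>d. norm (slash_term k m d z)"] by (simp add: o_def)
      then show ?thesis by (rule summable_on_imp_summable)
    qed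
    have i: "inj (\<lambda>n. int (Suc n))" "inj (\<lambda>n. - int (Suc n))" by (auto simp: inj_on_def)
    have "slash_series k m z = slash_term k m 0 z + (\<Sum>n. slash_term k m (int (Suc n)) z) + (\<Sum>n. slash_term k m (- int (Suc n)) z)"
      unfolding slash_series_def by (rule infsumI[OF has_sum_int]) (rule s[OF i(1)], rule s[OF i(2)])
    also have "\<dots> = slash_term k m 0 z + (\<Sum>n. ?f n z)"
      using suminf_add[OF summable_norm_cancel[OF s[OF i(1)]] summable_norm_cancel[OF s[OF i(2)]]] by (simp add: add.assoc)
    also have "(\<Sum>n. ?f n z) = g z" using g[OF z] by (simp add: sums_iff)
    finally show ?thesis .
  qed
  moreover have "(\<lambda>z. slash_term k m 0 z + g z) holomorphic_on upper_half_plane"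
  proof (rule holomorphic_onI, rule field_differentiable_at_within, rule field_differentiable_add)
    fix x assume x: "x \<in> upper_half_plane"
    show "slash_term k m 0 field_differentiable at x"
      using slash_term_has_derivative[of x] x by (auto simp: upper_half_plane_def field_differentiable_def)
    show "g field_differentiable at x" using g[OF x] by (auto simp: field_differentiable_def)
  qed
  ultimately show ?thesis by (subst holomorphic_cong[OF refl]) auto
qed

lemma slash_series_near:
  assumes z: "Im z > 0" and k: "k \<ge> 2" and c: "c > 0"
    and far: "\<And>d. \<bar>d\<bar> \<ge> 2 \<Longrightarrow> norm (z + of_int d) \<ge> c * \<bar>of_int d\<bar> / 2"
  shows "norm (slash_series k m z - (slash_term k m 0 z + slash_term k m 1 z + slash_term k m (- 1) z)) \<le> 16 / c ^ k"
proof -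
  have "norm (infsum (\<lambda>d. slash_term k m d z) UNIV - (slash_term k m 0 z + slash_term k m 1 z + slash_term k m (- 1) z)) \<le> 4 * (4 / c ^ k)"
    by (rule norm_infsum_tail_le) (rule norm_slash_term_le'[OF z far c _ k])
  then show ?thesis by (simp add: slash_series_def)
qed

lemma norm_add_of_int_ge_Re:
  assumes "\<bar>Re z\<bar> \<le> x"
  shows "norm (z + of_int d) \<ge> \<bar>of_int d\<bar> - x"
  using abs_Re_le_cmod[of "z + of_int d"] assms by simp

text \<open>At height 2 every \<open>|z + d|\<close> is at least 2. The three central terms
  contribute \<open>3 / 2^k\<close> and the tail \<open>32 / 2^k\<close>. The base 2 has to compete
  with the growth \<open>exp (4 \<pi> n)\<close> of Fourier coefficients read off on this
  line.\<close>

lemma slash_series_bound_at_2: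
  assumes z: "Im z = 2" "\<bar>Re z\<bar> \<le> 1/2" and k: "k \<ge> 2"
  shows "norm (slash_series k m z) \<le> 35 / 2 ^ k"
proof -
  have n2: "norm (z + of_int d) \<ge> 2" for d using abs_Im_le_cmod[of "z + of_int d"] z by simp
  have t: "norm (slash_term k m d z) \<le> 1 / 2 ^ k" for d
  proof -
    have "norm (slash_term k m d z) \<le> 1 / norm (z + of_int d) ^ k" by (rule norm_slash_term_le) (use z in simp)
    also have "\<dots> \<le> 1 / 2 ^ k" using n2 by (intro frac_le power_mono) auto
    finally show ?thesis .
  qed
  have "norm (infsum (\<lambda>d. slash_term k m d z) UNIV - (slash_term k m 0 z + slash_term k m 1 z + slash_term k m (- 1) z)) \<le> 4 * (8 / 2 ^ k)"
  proof (rule norm_infsum_tail_le)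
    fix d :: int assume d: "\<bar>d\<bar> \<ge> 2"
    then have d': "\<bar>real_of_int d\<bar> \<ge> 2" by linarith
    define N where "N = norm (z + of_int d)"
    have N: "N \<ge> 2" "N \<ge> 3/4 * \<bar>of_int d\<bar>"
      using n2[of d] norm_add_of_int_ge_Re[OF z(2), of d] d' unfolding N_def by linarith+
    have "2 ^ k * N^2 \<le> 4 * N ^ k"
    proof -
      have "2 ^ (k - 2) * N^2 \<le> N ^ (k - 2) * N^2" using N by (intro mult_right_mono power_mono) auto
      moreover have "N ^ (k - 2) * N^2 = N ^ k" "(2::real) ^ k = 2 ^ (k - 2) * 2^2"
        using k by (simp_all only: power_add[symmetric] le_add_diff_inverse2)
      ultimately show ?thesis by simp
    qed
    then have "1 / N ^ k \<le> (4 / 2 ^ k) * (1 / N^2)" using N by (simp add: field_simps)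
    also have "\<dots> \<le> (4 / 2 ^ k) * (2 * (1 / (of_int d)^2))"
    proof (rule mult_left_mono)
      have "(3/4 * \<bar>of_int d\<bar>)^2 \<le> N^2" using N by (intro power_mono) auto
      then have "1 / N^2 \<le> 1 / (3/4 * \<bar>of_int d\<bar>)^2" using d' by (intro frac_le) auto
      also have "\<dots> = (16/9) * (1 / (of_int d)^2)" by (simp add: power_mult_distrib power_divide)
      also have "\<dots> \<le> 2 * (1 / (of_int d)^2)" by (intro mult_right_mono) auto
      finally show "1 / N^2 \<le> 2 * (1 / (of_int d)^2)" .
    qed auto
    finally show "norm (slash_term k m d z) \<le> (8 / 2 ^ k) * (1 / (of_int d)^2)"
      using norm_slash_term_le[of z k m d] z unfolding N_def by simp
  qed
  then have "norm (slash_series k m z - (slash_term k m 0 z + slash_term k m 1 z + slash_term k m (- 1) z)) \<le> 32 / 2 ^ k"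
    by (simp add: slash_series_def)
  moreover have "norm (slash_term k m 0 z + slash_term k m 1 z + slash_term k m (- 1) z) \<le> 1 / 2 ^ k + 1 / 2 ^ k + 1 / 2 ^ k"
    by (intro norm_triangle_mono t)
  ultimately have "norm (slash_series k m z) \<le> 32 / 2 ^ k + (1 / 2 ^ k + 1 / 2 ^ k + 1 / 2 ^ k)"
    using norm_triangle_ineq[of "slash_series k m z - (slash_term k m 0 z + slash_term k m 1 z + slash_term k m (- 1) z)"
      "slash_term k m 0 z + slash_term k m 1 z + slash_term k m (- 1) z"] by simp
  then show ?thesis by simp
qed

text \<open>The arguments of \<open>nome\<close> match up to integers, for instance
  \<open>- m / ((z - 1) / z) = - m / (z - 1) - m\<close>, and \<open>nome\<close> ignores integers.
  The sign in \<open>(- (z + 1))^k\<close> disappears because \<open>k\<close> is even.\<close>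

lemma slash_term_slash:
  assumes z: "Im z > 0" and k: "even k"
  shows "slash_term k m 0 (- 1 / z) / z ^ k = nome (of_nat m * z)"
    and "slash_term k m 1 (- 1 / z) / z ^ k = slash_term k m (- 1) z"
    and "slash_term k m (- 1) (- 1 / z) / z ^ k = slash_term k m 1 z"
    and "nome (of_nat m * (- 1 / z)) / z ^ k = slash_term k m 0 z"
proof -
  have z0: "z \<noteq> 0" "z + 1 \<noteq> 0" "z - 1 \<noteq> 0" using z by (auto simp: complex_eq_iff)
  have nm: "nome (z + of_nat m) = nome z" "nome (z - of_nat m) = nome z" for z
    using nome_add[of z "of_int (int m)"] nome_add[of z "of_int (- int m)"] nome_of_int[of "int m"] nome_of_int[of "- int m"] by simp_all
  have p: "(a / z) ^ k * z ^ k = a ^ k" for a using z0 by (simp add: power_divide)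
  have ev: "(- a) ^ k = a ^ k" for a :: complex using k by simp
  show "slash_term k m 0 (- 1 / z) / z ^ k = nome (of_nat m * z)"
    using p[of "- 1"] z0 k by (simp add: slash_term_def)
  have e1: "- 1 / z + 1 = (z - 1) / z" using z0 by (simp add: field_simps)
  have "- of_nat m / ((z - 1) / z) = - of_nat m / (z - 1) - of_nat m" using z0 by (simp add: field_simps)
  then show "slash_term k m 1 (- 1 / z) / z ^ k = slash_term k m (- 1) z"
    using p[of "z - 1"] unfolding slash_term_def of_int_1 e1 by (simp add: nm)
  have e2: "- 1 / z + - 1 = - (z + 1) / z" using z0 by (simp add: field_simps)
  have "- of_nat m / (- (z + 1) / z) = of_nat m * z / (z + 1)" by (simp add: minus_divide_left[symmetric] del: minus_add_distrib)
  also have "\<dots> = - of_nat m / (z + 1) + of_nat m" using z0 by (simp add: field_simps)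
  finally have e3: "- of_nat m / (- (z + 1) / z) = - of_nat m / (z + 1) + of_nat m" .
  have "slash_term k m (- 1) (- 1 / z) = nome (- of_nat m / (z + 1)) / (- (z + 1) / z) ^ k"
    unfolding slash_term_def of_int_minus of_int_1 e2 e3 nm ..
  then show "slash_term k m (- 1) (- 1 / z) / z ^ k = slash_term k m 1 z"
    using p[of "- (z + 1)"] ev[of "z + 1"] by (simp add: slash_term_def del: minus_add_distrib)
  show "nome (of_nat m * (- 1 / z)) / z ^ k = slash_term k m 0 z"
    by (simp add: slash_term_def)
qed

text \<open>The inversion permutes \<open>q^m\<close> and the terms with \<open>|d| \<le> 1\<close>, so only \<open>|d| \<ge> 2\<close> contributes to the defect.\<close>

lemma slash_series_defect:
  assumes z: "Im z = 4/5" "\<bar>Re z\<bar> \<le> 1/2" and k: "even k" "k \<ge> 2"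
  shows "norm ((nome (of_nat m * (- 1 / z)) + slash_series k m (- 1 / z)) / z ^ k
     - (nome (of_nat m * z) + slash_series k m z)) \<le> 32 / (3/2) ^ k"
proof -
  have Iz: "Im z > 0" using z by simp
  have z0: "z \<noteq> 0" using Iz by auto
  define w where "w = - 1 / z"
  have Iw: "Im w > 0" unfolding w_def Im_minus_inverse using Iz z0 by simp
  have a: "norm (slash_series k m z - (slash_term k m 0 z + slash_term k m 1 z + slash_term k m (- 1) z)) \<le> 16 / (3/2) ^ k"
  proof (rule slash_series_near[OF Iz k(2)])
    fix d :: int assume "\<bar>d\<bar> \<ge> 2"
    then have "\<bar>real_of_int d\<bar> \<ge> 2" by linarith
    then show "norm (z + of_int d) \<ge> 3/2 * \<bar>of_int d\<bar> / 2"
      using norm_add_of_int_ge_Re[OF z(2), of d] by linarith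
  qed simp
  have "norm (infsum (\<lambda>d. slash_term k m d w / z ^ k) UNIV
     - (slash_term k m 0 w / z ^ k + slash_term k m 1 w / z ^ k + slash_term k m (- 1) w / z ^ k)) \<le> 4 * (4 / (3/2) ^ k)"
  proof (rule norm_infsum_tail_le)
    fix d :: int assume d: "\<bar>d\<bar> \<ge> 2"
    define D where "D = \<bar>real_of_int d\<bar> / 2"
    have D: "D \<ge> 1" using d unfolding D_def by linarith
    have "(w + of_int d) * z = of_int d * z - 1" using z0 by (simp add: w_def field_simps)
    \<comment> \<open>The imaginary part alone gives \<open>|d| * 4/5 = 8/5 * D\<close>.\<close>
    moreover have "norm (of_int d * z - 1) \<ge> 3/2 * D"
      using abs_Im_le_cmod[of "of_int d * z - 1"] z(1) D by (simp add: abs_mult D_def)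
    ultimately have n: "norm (w + of_int d) * norm z \<ge> 3/2 * D" by (metis norm_mult)
    have "norm (slash_term k m d w / z ^ k) \<le> 1 / norm (w + of_int d) ^ k / norm z ^ k"
      unfolding norm_divide norm_power by (rule divide_right_mono[OF norm_slash_term_le[OF Iw]]) simp
    also have "\<dots> = 1 / (norm (w + of_int d) * norm z) ^ k" by (simp add: power_mult_distrib)
    also have "\<dots> \<le> 1 / (3/2 * D) ^ k" using n D by (intro frac_le power_mono) auto
    also have "\<dots> \<le> 1 / ((3/2) ^ k * D^2)"
    proof (rule divide_left_mono)
      show "(3/2) ^ k * D^2 \<le> (3/2 * D) ^ k"
        unfolding power_mult_distrib using D k by (intro mult_left_mono power_increasing) auto
    qed (use D in auto)
    also have "\<dots> = (4 / (3/2) ^ k) * (1 / (of_int d)^2)" by (simp add: D_def power_divide power2_eq_square)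
    finally show "norm (slash_term k m d w / z ^ k) \<le> (4 / (3/2) ^ k) * (1 / (of_int d)^2)" .
  qed
  moreover have "infsum (\<lambda>d. slash_term k m d w / z ^ k) UNIV = slash_series k m w / z ^ k"
    unfolding slash_series_def divide_inverse by (rule infsum_cmult_left) (use slash_term_summable[OF Iw k(2)] in auto)
  ultimately have b: "norm (slash_series k m w / z ^ k - (nome (of_nat m * z) + slash_term k m (- 1) z + slash_term k m 1 z)) \<le> 16 / (3/2) ^ k"
    unfolding w_def slash_term_slash[OF Iz k(1)] by simp
  have "(nome (of_nat m * w) + slash_series k m w) / z ^ k - (nome (of_nat m * z) + slash_series k m z)
     = (slash_series k m w / z ^ k - (nome (of_nat m * z) + slash_term k m (- 1) z + slash_term k m 1 z))
       - (slash_series k m z - (slash_term k m 0 z + slash_term k m 1 z + slash_term k m (- 1) z))"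
    unfolding add_divide_distrib using slash_term_slash(4)[OF Iz k(1), of m] by (simp add: w_def)
  also have "norm \<dots> \<le> 16 / (3/2) ^ k + 16 / (3/2) ^ k"
    by (rule order_trans[OF norm_triangle_ineq4]) (rule add_mono[OF b a])
  finally show ?thesis by (simp add: w_def)
qed

section \<open>Numerical bounds for the eta function and for exponentials\<close>

lemma pi_bounds: "31415/10000 \<le> pi" "pi \<le> 31416/10000"
  using pi_approx by simp_all

text \<open>A device for numerical bounds: \<open>exp (n x)\<close> is a product of \<open>n\<close>
  equal factors with small \<open>x\<close>, for which the quadratic Taylor polynomial is accurate
  enough.\<close>

lemma exp_neg_power_bound:
  fixes x :: real
  assumes "x \<ge> 0" "B \<le> (1 + x + x^2 / 2) ^ n" "B > 0"
  shows "exp (- (real n * x)) \<le> 1 / B"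
proof -
  have "B \<le> exp x ^ n"
    by (rule order_trans[OF assms(2)]) (use assms(1) in \<open>intro power_mono exp_lower_Taylor_quadratic, auto\<close>)
  also have "\<dots> = exp (real n * x)" by (simp add: exp_of_nat_mult)
  finally have "1 / exp (real n * x) \<le> 1 / B" using assms(3) by (intro frac_le) auto
  then show ?thesis by (simp add: exp_minus inverse_eq_divide)
qed

text \<open>Here \<open>|q| \<le> exp (- 8 \<pi> / 5)\<close>, about \<open>1/152\<close>; sixteen
  steps of \<open>\<pi> / 10\<close> certify \<open>1/142\<close>. The resulting error
  \<open>0.0143\<close> is paid once per unit of \<open>k\<close> in the exponents that
  follow.\<close>

lemma log_eta_near:
  assumes "Im z \<ge> 4/5"
  shows "\<bar>log_eta z + pi / 6 * Im z\<bar> \<le> 143/10000"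
proof -
  have "exp (- 2 * pi * Im z) \<le> exp (- (real 16 * (pi / 10)))" using assms pi_gt_zero by (simp add: field_simps)
  also have "\<dots> \<le> 1 / 142"
  proof (rule exp_neg_power_bound)
    have "(142::real) \<le> (1 + 3141/10000 + (3141/10000)^2 / 2) ^ 16" by (simp add: power2_eq_square field_simps)
    also have "\<dots> \<le> (1 + pi / 10 + (pi / 10)^2 / 2) ^ 16"
      using pi_bounds by (intro power_mono add_mono divide_right_mono) auto
    finally show "142 \<le> (1 + pi / 10 + (pi / 10)^2 / 2) ^ 16" .
  qed auto
  finally have "\<bar>log_eta z + pi / 6 * Im z\<bar> \<le> 2 * (1/142) / (1 - 1/142)^2" by (rule log_eta_bounds) simp
  also have "\<dots> \<le> 143/10000" by (simp add: power2_eq_square)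
  finally show ?thesis .
qed

text \<open>The height \<open>1/2\<close> is that of the segment over which the weight 2 period is
  integrated. The bound \<open>0.367\<close> has to stay below \<open>0.382 - 0.0143\<close>, the
  rate left for the coefficient estimated there.\<close>

lemma log_eta_at_half:
  assumes "Im z = 1/2"
  shows "- log_eta z \<le> 367/1000"
proof -
  have "exp (- 2 * pi * Im z) = exp (- (real 8 * (pi / 8)))" using assms by simp
  also have "\<dots> \<le> 1 / 21"
  proof (rule exp_neg_power_bound)
    have "(21::real) \<le> (1 + 392/1000 + (392/1000)^2 / 2) ^ 8" by (simp add: power2_eq_square field_simps)
    also have "\<dots> \<le> (1 + pi / 8 + (pi / 8)^2 / 2) ^ 8"
      using pi_bounds by (intro power_mono add_mono divide_right_mono) auto
    finally show "21 \<le> (1 + pi / 8 + (pi / 8)^2 / 2) ^ 8" .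
  qed auto
  finally have "\<bar>log_eta z + pi / 6 * Im z\<bar> \<le> 2 * (1/21) / (1 - 1/21)^2" by (rule log_eta_bounds) simp
  also have "\<dots> = 105/1000" by (simp add: power2_eq_square)
  finally have "- (log_eta z + pi / 6 * (1/2)) \<le> 105/1000" unfolding assms by linarith
  then show ?thesis using pi_bounds by linarith
qed

lemma ln_2_ge: "ln 2 \<ge> (69/100 :: real)"
  using ln_approx_bounds[of 2 2, simplified, simplified eval_nat_numeral, simplified] by simp

lemma two_power_le: "1 / (2::real) ^ k \<le> exp (- (69/100) * real k)"
proof -
  have "(2::real) ^ k = exp (real k * ln 2)" by (simp add: exp_of_nat_mult)
  then have "1 / (2::real) ^ k = exp (- (real k * ln 2))" by (simp add: exp_minus inverse_eq_divide)
  also have "\<dots> \<le> exp (- (69/100) * real k)" using mult_left_mono[OF ln_2_ge, of "real k"] by (simp add: mult.commute)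
  finally show ?thesis .
qed

lemma inverse_power_le_exp:
  fixes b x :: real
  assumes "0 \<le> x" "x < 1" "1 / (1 - x) \<le> b"
  shows "1 / b ^ k \<le> exp (- x * real k)"
proof -
  have b: "b > 0" using assms by (metis diff_gt_0_iff_gt divide_pos_pos less_le_trans zero_less_one)
  have "1 / b \<le> 1 - x" using assms b by (simp add: field_simps)
  also have "\<dots> \<le> exp (- x)" using exp_ge_add_one_self[of "- x"] by simp
  finally have "(1 / b) ^ k \<le> exp (- x) ^ k" using b by (intro power_mono) auto
  also have "\<dots> = exp (- x * real k)" by (simp add: mult.commute flip: exp_of_nat_mult)
  finally show ?thesis by (simp add: power_divide)
qed

text \<open>For \<open>k' = 14\<close> the weight is \<open>12 L + 2\<close> with \<open>L = l + 1\<close>, and the coefficient \<open>g 0\<close> of \<open>q^L\<close> is not prescribed.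
  It is controlled because the primitive of \<open>f / \<Delta>^L\<close>, of weight 2, is invariant under both generators, so that the
  constant term of \<open>f / \<Delta>^L\<close> vanishes.\<close>

lemma weight_2_constant_term:
  fixes f g :: "complex \<Rightarrow> complex"
  assumes f: "modular_form (12 * L + 2) f"
    and g: "g holomorphic_on ball 0 1"
    and fg: "\<And>z. Im z > 0 \<Longrightarrow> f z = nome z ^ m + nome z ^ L * g (nome z)"
  shows "norm (g 0) \<le> exp (367/1000 * (12 * real L))"
proof -
  have H: "convex upper_half_plane" "open upper_half_plane"
    unfolding upper_half_plane_def by (rule convex_halfspace_Im_gt, rule open_halfspace_Im_gt)
  define D where "D = (\<lambda>z. modular_disc z ^ L)"
  have D0: "D z \<noteq> 0" for z by (simp add: D_def modular_disc_def)
  have disc_hol: "modular_disc holomorphic_on upper_half_plane"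
  proof (rule holomorphic_onI, rule field_differentiable_at_within)
    fix z assume "z \<in> upper_half_plane"
    then have "(modular_disc has_field_derivative (exp (log_disc z) * (2 * pi * \<i> + 6 * \<i> / pi * eisenstein_tail z))) (at z)"
      unfolding modular_disc_def by (intro DERIV_chain2[OF DERIV_exp] log_disc_deriv) (simp add: upper_half_plane_def)
    then show "modular_disc field_differentiable at z" by (auto simp: field_differentiable_def)
  qed
  have fm: "f holomorphic_on upper_half_plane" "\<And>z. Im z > 0 \<Longrightarrow> f (z + 1) = f z" "\<And>z. Im z > 0 \<Longrightarrow> f (- 1 / z) = z ^ (12 * L + 2) * f z"
    using f by (auto simp: modular_form_def upper_half_plane_def)
  define u where "u = (\<lambda>z. f z / D z)"
  have u_hol: "u holomorphic_on upper_half_plane"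
    unfolding u_def D_def by (intro holomorphic_intros fm(1) disc_hol) (simp add: modular_disc_def)
  \<comment> \<open>As \<open>u\<close> has weight 2, the differential \<open>u dz\<close> is
    invariant under both generators, so a primitive changes by a constant under each of
    them.\<close>
  obtain U where U: "\<And>z. z \<in> upper_half_plane \<Longrightarrow> (U has_field_derivative u z) (at z within upper_half_plane)"
    using holomorphic_convex_primitive'[OF H(1,2) u_hol] H by blast
  then have U': "(U has_field_derivative u z) (at z)" if "Im z > 0" for z
    using at_within_open[OF _ H(2)] that by (force simp: upper_half_plane_def)
  have inv: "Im (- 1 / z) > 0" if "Im z > 0" for z
    unfolding Im_minus_inverse using that by (intro divide_pos_pos) auto
  have u1: "u (z + 1) = u z" if "Im z > 0" for z
    using fm(2)[OF that] by (simp add: u_def D_def modular_disc_periodic)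
  have uS: "u (- 1 / z) * (1 / z^2) = u z" if "Im z > 0" for z
  proof -
    have z0: "z \<noteq> 0" using that by auto
    have "D (- 1 / z) = z ^ (12 * L) * D z"
      unfolding D_def modular_disc_inversion[OF that] by (simp add: power_mult_distrib power_mult)
    then show ?thesis unfolding u_def fm(3)[OF that] using z0 D0[of z] by (simp add: power_add power2_eq_square)
  qed
  have "\<exists>c. \<forall>z\<in>upper_half_plane. U (z + 1) - U z = c"
  proof (rule has_field_derivative_zero_constant[OF H(1)])
    fix z assume "z \<in> upper_half_plane"
    then have z: "Im z > 0" by (simp add: upper_half_plane_def)
    have "((\<lambda>z. U (z + 1)) has_field_derivative u (z + 1) * 1) (at z)"
      by (rule DERIV_chain2[OF U']) (use z in \<open>auto intro!: derivative_eq_intros\<close>)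
    then have "((\<lambda>z. U (z + 1) - U z) has_field_derivative u (z + 1) * 1 - u z) (at z)"
      by (intro DERIV_diff U'[OF z])
    then show "((\<lambda>z. U (z + 1) - U z) has_field_derivative 0) (at z within upper_half_plane)"
      using u1[OF z] by (simp add: has_field_derivative_at_within)
  qed
  then obtain c where c: "\<And>z. Im z > 0 \<Longrightarrow> U (z + 1) - U z = c" by (auto simp: upper_half_plane_def)
  have "\<exists>c. \<forall>z\<in>upper_half_plane. U (- 1 / z) - U z = c"
  proof (rule has_field_derivative_zero_constant[OF H(1)])
    fix z assume "z \<in> upper_half_plane"
    then have z: "Im z > 0" by (simp add: upper_half_plane_def)
    have z0: "z \<noteq> 0" using z by auto
    have i: "((\<lambda>w. - 1 / w) has_field_derivative (1 / z^2)) (at z)"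
      using z0 by (auto intro!: derivative_eq_intros simp: power2_eq_square field_simps)
    have "((\<lambda>z. U (- 1 / z)) has_field_derivative u (- 1 / z) * (1 / z^2)) (at z)"
      by (rule DERIV_chain2[where f = U and g = "\<lambda>z. - 1 / z"], rule U'[OF inv[OF z]], rule i)
    then have "((\<lambda>z. U (- 1 / z) - U z) has_field_derivative u (- 1 / z) * (1 / z^2) - u z) (at z)"
      by (intro DERIV_diff U'[OF z])
    then show "((\<lambda>z. U (- 1 / z) - U z) has_field_derivative 0) (at z within upper_half_plane)"
      using uS[OF z] by (simp add: has_field_derivative_at_within)
  qed
  then obtain d where d: "\<And>z. Im z > 0 \<Longrightarrow> U (- 1 / z) - U z = d" by (auto simp: upper_half_plane_def)
  \<comment> \<open>The inversion fixes \<open>\<i>\<close>, hence its constant is 0. At the corner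
    the inversion acts like the translation, which forces the constant \<open>c\<close> of the
    translation to be 0 as well.\<close>
  have "d = 0" using d[of \<i>] by simp
  moreover define \<rho> where "\<rho> = Complex (- 1/2) (sqrt 3 / 2)"
  have "\<rho> * (\<rho> + 1) = - 1" by (simp add: \<rho>_def complex_eq_iff field_simps)
  moreover have "\<rho> \<noteq> 0" by (simp add: \<rho>_def complex_eq_iff)
  ultimately have "- 1 / \<rho> = \<rho> + 1" by (simp add: field_simps)
  moreover have "Im \<rho> > 0" by (simp add: \<rho>_def)
  ultimately have c0: "c = 0" using c[of \<rho>] d[of \<rho>] \<open>d = 0\<close> by simp
  define g1 where "g1 = (\<lambda>q. g q * exp (24 * of_nat L * lambert q))"
  have g1: "g1 holomorphic_on ball 0 1" unfolding g1_def by (intro holomorphic_intros g lambert_holomorphic)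
  obtain g2 where g2: "g2 holomorphic_on ball 0 1" "\<And>q. q \<in> ball 0 1 \<Longrightarrow> g1 q = g1 0 + q * g2 q"
    using holomorphic_disc_factor[OF g1, of 1] by auto
  have g10: "g1 0 = g 0" by (simp add: g1_def)
  obtain V where V: "\<And>q. q \<in> ball 0 1 \<Longrightarrow> (V has_field_derivative g2 q) (at q within ball 0 1)"
    using holomorphic_convex_primitive'[OF convex_ball open_ball g2(1)] by blast
  then have V': "(V has_field_derivative g2 q) (at q)" if "q \<in> ball 0 1" for q
    using at_within_open[OF that open_ball] that by force
  \<comment> \<open>Removing the primitives of the part holomorphic in \<open>q\<close> leaves the
    derivative \<open>q^m / \<Delta>^L\<close>. Among the three summands only \<open>g 0 * z\<close>
    fails to be periodic, so the increment of \<open>X\<close> over a period is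
    \<open>- g 0\<close>.\<close>
  define X where "X = (\<lambda>z. U z - V (nome z) / (2 * pi * \<i>) - g 0 * z)"
  have uX: "u z = nome z ^ m / D z + g 0 + nome z * g2 (nome z)" if z: "Im z > 0" for z
  proof -
    have Dz: "D z = nome z ^ L * exp (- (24 * of_nat L * lambert (nome z)))"
      unfolding D_def modular_disc_eq power_mult_distrib exp_of_nat_mult[symmetric] by (simp add: mult_ac)
    have "nome z ^ L * g (nome z) / D z = g1 (nome z)"
      unfolding Dz g1_def by (simp add: exp_minus divide_inverse)
    then show ?thesis
      using g2(2)[of "nome z"] norm_nome_less_1[OF z] unfolding u_def fg[OF z] add_divide_distrib g10 by simp
  qed
  have X: "(X has_field_derivative nome z ^ m / D z) (at z)" if z: "Im z > 0" for z
  proof -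
    have "((\<lambda>z. V (nome z)) has_field_derivative g2 (nome z) * (2 * pi * \<i> * nome z)) (at z)"
      by (rule DERIV_chain2[OF V' has_field_derivative_nome]) (use norm_nome_less_1[OF z] in simp)
    from DERIV_cdivide[OF this, of "2 * pi * \<i>"]
    have "((\<lambda>z. V (nome z) / (2 * pi * \<i>)) has_field_derivative nome z * g2 (nome z)) (at z)"
      by (rule DERIV_cong) (subst nonzero_divide_eq_eq, simp_all add: mult_ac)
    from DERIV_diff[OF DERIV_diff[OF U'[OF z] this] DERIV_cmult[OF DERIV_ident, of "g 0"]]
    show ?thesis unfolding X_def uX[OF z] by (rule DERIV_cong) simp
  qed
  define a where "a = \<i> / 2"
  have seg: "Im z = 1/2" if "z \<in> closed_segment a (a + 1)" for z
    using that by (auto simp: closed_segment_def a_def diff_divide_distrib)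
  have "norm (X (a + 1) - X a) \<le> exp (367/1000 * (12 * real L)) * norm (a + 1 - a)"
  proof (rule field_differentiable_bound[of "closed_segment a (a + 1)" X "\<lambda>z. nome z ^ m / D z"])
    fix z assume z: "z \<in> closed_segment a (a + 1)"
    then have I: "Im z = 1/2" by (rule seg)
    then show "(X has_field_derivative nome z ^ m / D z) (at z within closed_segment a (a + 1))"
      by (intro has_field_derivative_at_within[OF X]) linarith
    have "norm (nome z ^ m / D z) = norm (nome z) ^ m / exp (12 * log_eta z) ^ L"
      by (simp add: D_def norm_divide norm_power norm_modular_disc)
    also have "exp (12 * log_eta z) ^ L = exp (12 * real L * log_eta z)"
      unfolding exp_of_nat_mult[symmetric] by (simp add: mult_ac)
    also have "norm (nome z) ^ m / exp (12 * real L * log_eta z) = norm (nome z) ^ m * exp (- (12 * real L * log_eta z))"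
      by (simp add: exp_minus divide_inverse)
    also have "\<dots> \<le> 1 * exp (367/1000 * (12 * real L))"
    proof (rule mult_mono)
      show "norm (nome z) ^ m \<le> 1" by (rule power_le_one) (use norm_nome_less_1[of z] I in auto)
      show "exp (- (12 * real L * log_eta z)) \<le> exp (367/1000 * (12 * real L))"
        using mult_left_mono[OF log_eta_at_half[OF I], of "12 * real L"] by (simp add: algebra_simps)
    qed auto
    finally show "norm (nome z ^ m / D z) \<le> exp (367/1000 * (12 * real L))" by simp
  qed auto
  moreover have "X (a + 1) - X a = - g 0"
    using c[of a] c0 unfolding X_def nome_periodic by (simp add: a_def algebra_simps)
  ultimately show ?thesis by simp
qed

text \<open>The size of the removed terms after division by \<open>\<eta>^(2k)\<close>. The rate
  \<open>0.382\<close> dominates both \<open>\<pi>/3 - 0.69 + 0.0143\<close>, from the Fourier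
  coefficients, and \<open>0.367 + 0.0143\<close>, from the free coefficient, and it stays below
  \<open>0.4045\<close>, the decay rate of \<open>\<eta>^(2k)\<close> at height
  \<open>4/5\<close>.\<close>

definition approx_error :: "nat \<Rightarrow> real" where
  "approx_error k = (real k + 1) * exp (382/1000 * real k)"

text \<open>The coefficient bound from height 2 contributes the exponent
  \<open>2 \<pi> n (2 - Im z)\<close> with \<open>n \<le> k / 12\<close>, the eta power contributes
  \<open>\<pi> k / 6 * Im z\<close>. Together they are at most \<open>\<pi> k / 3\<close>, whatever
  the height.\<close>

lemma coefficient_term_bound:
  assumes y: "4/5 \<le> Im z" "Im z \<le> 2" and n: "12 * n \<le> k"
    and c: "norm c \<le> 35 / 2 ^ k * exp (2 * pi * real n * 2)"
  shows "norm (c * nome z ^ n) * exp (- real k * log_eta z) \<le> 35 * exp (382/1000 * real k)"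
proof -
  have e: "- log_eta z \<le> pi / 6 * Im z + 143/10000" using log_eta_near[OF y(1)] by linarith
  have "norm (c * nome z ^ n) = norm c * exp (- (2 * pi * real n * Im z))"
    unfolding norm_mult norm_power norm_nome exp_of_nat_mult[symmetric] by (simp add: mult_ac)
  then have "norm (c * nome z ^ n) * exp (- real k * log_eta z)
      \<le> (35 / 2 ^ k * exp (2 * pi * real n * 2)) * exp (- (2 * pi * real n * Im z)) * exp (- real k * log_eta z)"
    by (simp only:) (intro mult_right_mono c; simp)
  also have "\<dots> = 35 * (1 / 2 ^ k) * exp (2 * pi * real n * (2 - Im z) + real k * (- log_eta z))"
    by (simp add: exp_add[symmetric] exp_diff[symmetric] algebra_simps mult_exp_exp)
  also have "\<dots> \<le> 35 * exp (- (69/100) * real k) * exp (pi / 6 * real k * (2 - Im z) + real k * (pi / 6 * Im z + 143/10000))"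
  proof (intro mult_mono two_power_le)
    have "12 * real n \<le> real k" using n by linarith
    then have "pi / 6 * (12 * real n) * (2 - Im z) \<le> pi / 6 * real k * (2 - Im z)"
      using y by (intro mult_right_mono mult_left_mono) auto
    moreover have "2 * pi * real n * (2 - Im z) = pi / 6 * (12 * real n) * (2 - Im z)" by simp
    moreover have "real k * (- log_eta z) \<le> real k * (pi / 6 * Im z + 143/10000)"
      by (rule mult_left_mono[OF e]) simp
    ultimately show "exp (2 * pi * real n * (2 - Im z) + real k * (- log_eta z)) \<le> exp (pi / 6 * real k * (2 - Im z) + real k * (pi / 6 * Im z + 143/10000))"
      unfolding exp_le_cancel_iff by linarith
  qed auto
  also have "\<dots> = 35 * exp (real k * (pi / 3 - 69/100 + 143/10000))"
    unfolding mult.assoc mult_exp_exp by (simp add: algebra_simps)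
  also have "\<dots> \<le> 35 * exp (real k * (382/1000))"
    using pi_bounds by (intro mult_left_mono iffD2[OF exp_le_cancel_iff]) auto
  finally show ?thesis by (simp add: mult.commute)
qed

lemma extra_term_bound:
  assumes y: "4/5 \<le> Im z" "Im z \<le> 2" and k: "12 * L \<le> k" "k \<le> 12 * L + 2" and k2: "k \<ge> 2"
    and a: "norm a \<le> exp (367/1000 * (12 * real L))"
  shows "norm (a * nome z ^ L) * exp (- real k * log_eta z) \<le> 12 * exp (382/1000 * real k)"
proof -
  have e: "- log_eta z \<le> pi / 6 * Im z + 143/10000" using log_eta_near[OF y(1)] by linarith
  have "norm (a * nome z ^ L) = norm a * exp (- (2 * pi * real L * Im z))"
    unfolding norm_mult norm_power norm_nome exp_of_nat_mult[symmetric] by (simp add: mult_ac)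
  then have "norm (a * nome z ^ L) * exp (- real k * log_eta z)
      \<le> exp (367/1000 * (12 * real L)) * exp (- (2 * pi * real L * Im z)) * exp (- real k * log_eta z)"
    by (simp only:) (intro mult_right_mono a; simp)
  also have "\<dots> = exp (367/1000 * (12 * real L) - 2 * pi * real L * Im z + real k * (- log_eta z))"
    unfolding mult_exp_exp by (simp add: algebra_simps)
  \<comment> \<open>The summand \<open>21/10\<close> bounds \<open>\<pi> / 6 * 2 * 2\<close>, the
    loss due to \<open>k - 12 L \<le> 2\<close> at heights up to 2.\<close>
  also have "\<dots> \<le> exp (382/1000 * real k + 21/10)"
  proof -
    have kL: "12 * real L \<le> real k" "real k - 12 * real L \<le> 2" using k by linarith+
    have 1: "real k * (- log_eta z) \<le> real k * (pi / 6 * Im z + 143/10000)"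
      by (rule mult_left_mono[OF e]) simp
    have "pi / 6 * (real k - 12 * real L) * Im z \<le> (31416/10000) / 6 * 2 * 2"
      using y kL pi_bounds by (intro mult_mono divide_right_mono) auto
    then have 2: "real k * (pi / 6 * Im z) - 2 * pi * real L * Im z \<le> 21/10"
      by (simp add: algebra_simps)
    have "real k * (pi / 6 * Im z + 143/10000) = real k * (pi / 6 * Im z) + 143/10000 * real k" by (simp add: algebra_simps)
    then show ?thesis unfolding exp_le_cancel_iff using 1 2 kL by linarith
  qed
  also have "\<dots> = exp (382/1000 * real k) * exp (7/10) ^ 3"
    by (simp add: exp_add flip: exp_of_nat_mult)
  also have "\<dots> \<le> exp (382/1000 * real k) * (1 + 7/10 + (7/10)^2) ^ 3"
    by (intro mult_left_mono power_mono exp_bound) auto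
  also have "\<dots> \<le> exp (382/1000 * real k) * 12" by (intro mult_left_mono) (auto simp: power2_eq_square power3_eq_cube)
  finally show ?thesis by simp
qed

text \<open>A crude bound that makes the singularity at the cusp removable: 16 from the tail and 3
  from the central terms, after a translation to \<open>|Re z| \<le> 1/2\<close>.\<close>

lemma slash_series_bounded:
  assumes z: "Im z \<ge> 1" and k: "k \<ge> 2"
  shows "norm (slash_series k m z) \<le> 19"
proof -
  define w where "w = z + of_int (- round (Re z))"
  have w: "Im w \<ge> 1" "\<bar>Re w\<bar> \<le> 1/2"
    using z of_int_round_abs_le[of "Re z"] by (simp_all add: w_def abs_minus_commute)
  have e: "slash_series k m z = slash_series k m w"
    unfolding w_def using z by (intro periodic_of_int[of "slash_series k m", symmetric] slash_series_periodic[OF _ k]) auto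
  have Iw: "Im w > 0" using w by simp
  have "norm (slash_series k m w - (slash_term k m 0 w + slash_term k m 1 w + slash_term k m (- 1) w)) \<le> 16 / (3/2) ^ k"
  proof (rule slash_series_near[OF Iw k])
    fix d :: int assume "\<bar>d\<bar> \<ge> 2"
    then have "\<bar>real_of_int d\<bar> \<ge> 2" by linarith
    then show "norm (w + of_int d) \<ge> 3/2 * \<bar>of_int d\<bar> / 2"
      using norm_add_of_int_ge_Re[OF w(2), of d] by linarith
  qed simp
  also have "\<dots> \<le> 16 / 1" by (intro frac_le) (auto simp: one_le_power)
  finally have 1: "norm (slash_series k m w - (slash_term k m 0 w + slash_term k m 1 w + slash_term k m (- 1) w)) \<le> 16" by simp
  have t: "norm (slash_term k m d w) \<le> 1" for d
  proof -
    have "norm (w + of_int d) \<ge> 1" using abs_Im_le_cmod[of "w + of_int d"] w by simp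
    then have "1 / norm (w + of_int d) ^ k \<le> 1 / 1" by (intro frac_le) (auto simp: one_le_power)
    then show ?thesis using norm_slash_term_le[OF Iw, of k m d] by simp
  qed
  have "norm (slash_term k m 0 w + slash_term k m 1 w + slash_term k m (- 1) w) \<le> 1 + 1 + 1"
    by (intro norm_triangle_mono t)
  with 1 show ?thesis unfolding e
    using norm_triangle_ineq[of "slash_series k m w - (slash_term k m 0 w + slash_term k m 1 w + slash_term k m (- 1) w)"
      "slash_term k m 0 w + slash_term k m 1 w + slash_term k m (- 1) w"] by simp
qed

text \<open>\<open>L\<close> is the last index to be corrected, so that vanishing to order
  \<open>L + 1\<close> leaves the room asked for by \<open>modular_contraction\<close>. In general
  \<open>L = l\<close> and \<open>a = 0\<close>; in weight \<open>12 L + 2\<close> one has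
  \<open>L = l + 1\<close>, and \<open>a\<close> is the free coefficient of
  \<open>q^L\<close>.\<close>

lemma main_approximation:
  fixes f g :: "complex \<Rightarrow> complex" and a :: complex
  assumes f: "modular_form k f" and k: "even k" "k \<ge> 2" "12 * L \<le> k" "k + 2 \<le> 12 * (L + 1)"
    and g: "g holomorphic_on ball 0 1"
    and fg: "\<And>z. Im z > 0 \<Longrightarrow> f z = nome z ^ m + a * nome z ^ L + nome z ^ (L + 1) * g (nome z)"
    and a: "a = 0 \<or> k \<le> 12 * L + 2 \<and> norm a \<le> exp (367/1000 * (12 * real L))"
    and z: "4/5 \<le> Im z" "Im z \<le> 2"
  shows "norm (f z - nome z ^ m - slash_series k m z) \<le> 1600 * (real k + 1) * exp (- (real k / 50))"
proof -
  have fm: "f holomorphic_on upper_half_plane" "\<And>z. Im z > 0 \<Longrightarrow> f (z + 1) = f z" "\<And>z. Im z > 0 \<Longrightarrow> f (- 1 / z) = z ^ k * f z"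
    using f by (auto simp: modular_form_def upper_half_plane_def)
  obtain h where h: "h holomorphic_on ball 0 1" and sh: "\<And>z. Im z > 0 \<Longrightarrow> slash_series k m z = h (nome z)"
    using periodic_eq_disc_function[OF slash_series_holomorphic[OF k(2)] slash_series_periodic[OF _ k(2)] slash_series_bounded[OF _ k(2)]] by blast
  define c where "c = (\<lambda>n. (deriv ^^ n) h 0 / fact n)"
  obtain g' where g': "g' holomorphic_on ball 0 1"
    and hg: "\<And>q. q \<in> ball 0 1 \<Longrightarrow> h q = (\<Sum>n<L+1. c n * q ^ n) + q ^ (L + 1) * g' q"
    using holomorphic_disc_factor[OF h, of "L + 1"] unfolding c_def by blast
  have cb: "norm (c n) \<le> 35 / 2 ^ k * exp (2 * pi * real n * 2)" for n
    unfolding c_def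
  proof (rule taylor_coefficient_bound[OF h])
    fix z assume "Im z = 2" "\<bar>Re z\<bar> \<le> 1/2"
    then show "norm (h (nome z)) \<le> 35 / 2 ^ k"
      using slash_series_bound_at_2[of z k m] sh[of z] k(2) by simp
  qed simp
  define D where "D = (\<lambda>z. f z - nome z ^ m - slash_series k m z)"
  define Q where "Q = (\<lambda>z. a * nome z ^ L - (\<Sum>n<L+1. c n * nome z ^ n))"
  define T where "T = (\<lambda>z. D z - Q z)"
  define wt where "wt = (\<lambda>z. exp (- real k * log_eta z))"
  have wt0: "wt z > 0" for z by (simp add: wt_def)
  \<comment> \<open>\<open>47 = 35 + 12\<close>: the Fourier coefficients of \<open>S\<close> and
    the free coefficient of \<open>f\<close>.\<close>
  define B where "B = 47 * approx_error k"
  have E: "exp (382/1000 * real k) \<le> approx_error k" unfolding approx_error_def by simp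
  have QB: "norm (Q z) * wt z \<le> B" if y: "4/5 \<le> Im z" "Im z \<le> 2" for z
  proof -
    have "norm (\<Sum>n<L+1. c n * nome z ^ n) * wt z \<le> (\<Sum>n<L+1. norm (c n * nome z ^ n)) * wt z"
      using wt0[of z] by (intro mult_right_mono norm_sum) auto
    also have "\<dots> = (\<Sum>n<L+1. norm (c n * nome z ^ n) * wt z)" by (rule sum_distrib_right)
    also have "\<dots> \<le> (\<Sum>n<L+1. 35 * exp (382/1000 * real k))"
      unfolding wt_def by (intro sum_mono coefficient_term_bound y cb) (use k in auto)
    also have "\<dots> = 35 * (real L + 1) * exp (382/1000 * real k)" unfolding sum_constant by (simp add: algebra_simps)
    also have "\<dots> \<le> 35 * (real k + 1) * exp (382/1000 * real k)"
    proof -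
      have "real L \<le> real k" using k(3) by linarith
      then show ?thesis by (intro mult_right_mono) auto
    qed
    finally have 1: "norm (\<Sum>n<L+1. c n * nome z ^ n) * wt z \<le> 35 * approx_error k" by (simp only: approx_error_def mult.assoc)
    have 2: "norm (a * nome z ^ L) * wt z \<le> 12 * approx_error k"
    proof (cases "a = 0")
      case False
      then have "norm (a * nome z ^ L) * wt z \<le> 12 * exp (382/1000 * real k)"
        unfolding wt_def using a by (intro extra_term_bound y k) auto
      then show ?thesis using E by linarith
    qed (simp add: approx_error_def)
    have "norm (Q z) * wt z \<le> (norm (a * nome z ^ L) + norm (\<Sum>n<L+1. c n * nome z ^ n)) * wt z"
      unfolding Q_def using wt0[of z] by (intro mult_right_mono norm_triangle_ineq4) auto
    also have "\<dots> \<le> B" using 1 2 by (simp add: B_def distrib_right)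
    finally show ?thesis .
  qed
  have Tg: "T z = nome z ^ (L + 1) * (g (nome z) - g' (nome z))" if "Im z > 0" for z
    using fg[OF that] sh[OF that] hg[of "nome z"] norm_nome_less_1[OF that]
    by (simp add: T_def D_def Q_def algebra_simps)
  \<comment> \<open>One \<open>B\<close> pays for the defect \<open>R\<close>, the other two for
    \<open>Q\<close> at \<open>z\<close> and at \<open>- 1 / z\<close>.\<close>
  have step: "norm (T z) * wt z \<le> 3 * B + norm (T (- 1 / z)) * wt (- 1 / z)" if z: "Im z = 4/5" "\<bar>Re z\<bar> \<le> 1/2" for z
  proof -
    define w where "w = - 1 / z"
    have Iz: "Im z > 0" using z by simp
    then have z0: "z \<noteq> 0" by auto
    have n2: "(norm z)^2 = (Re z)^2 + (4/5)^2" by (simp add: cmod_power2 z)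
    have "(Re z)^2 \<le> (1/2)^2" using z(2) by (metis abs_ge_zero power2_abs power_mono)
    then have nb: "(norm z)^2 \<le> 89/100" "(norm z)^2 \<ge> 64/100" unfolding n2 by (simp_all add: power2_eq_square)
    have "4/5 \<le> 4/5 / N" "4/5 / N \<le> 2" if "N \<le> 89/100" "64/100 \<le> N" for N :: real
      using that by (simp_all add: le_divide_eq divide_le_eq)
    then have Iw: "4/5 \<le> Im w" "Im w \<le> 2"
      unfolding w_def Im_minus_inverse z(1) using nb by auto
    define R where "R = (nome (of_nat m * (- 1 / z)) + slash_series k m (- 1 / z)) / z ^ k - (nome (of_nat m * z) + slash_series k m z)"
    have R: "norm R \<le> 32 / (3/2) ^ k" unfolding R_def by (rule slash_series_defect[OF z k(1,2)])
    have "f z = f w / z ^ k" using fm(3)[OF Iz] z0 by (simp add: w_def)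
    then have DR: "D z = D w / z ^ k + R"
      unfolding D_def R_def nome_of_nat_mult w_def[symmetric] by (simp add: add_divide_distrib diff_divide_distrib)
    have wtw: "wt w = wt z / norm z ^ k"
    proof -
      have "norm z ^ k = exp (real k * ln (norm z))" using z0 by (simp add: exp_of_nat_mult)
      moreover have "exp (- real k * (ln (norm z) + log_eta z)) = exp (- real k * log_eta z) / exp (real k * ln (norm z))"
        unfolding exp_diff[symmetric] by (simp add: algebra_simps)
      ultimately show ?thesis unfolding wt_def w_def log_eta_inversion[OF Iz] by simp
    qed
    have "norm (D z) * wt z \<le> (norm (D w) / norm z ^ k + norm R) * wt z"
      unfolding DR using wt0[of z] by (intro mult_right_mono order_trans[OF norm_triangle_ineq]) (auto simp: norm_divide norm_power)
    also have "\<dots> = norm (D w) * wt w + norm R * wt z" unfolding wtw by (simp add: distrib_right)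
    also have "norm R * wt z \<le> 32 * exp (382/1000 * real k)"
    proof -
      have "- log_eta z \<le> pi / 6 * Im z + 143/10000" using log_eta_near[of z] z by linarith
      then have "- log_eta z \<le> 44/100" using pi_bounds unfolding z(1) by simp
      then have "real k * (- log_eta z) \<le> real k * (44/100)" by (rule mult_left_mono) simp
      then have "wt z \<le> exp (real k * (44/100))" by (simp add: wt_def)
      moreover have "norm R \<le> 32 * exp (- (1/3) * real k)"
        using R inverse_power_le_exp[of "1/3" "3/2" k] by simp
      ultimately have "norm R * wt z \<le> (32 * exp (- (1/3) * real k)) * exp (real k * (44/100))"
        using wt0[of z] by (intro mult_mono) auto
      also have "\<dots> \<le> 32 * exp (382/1000 * real k)" unfolding mult.assoc mult_exp_exp by (simp add: algebra_simps)
      finally show ?thesis .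
    qed
    also have "32 * exp (382/1000 * real k) \<le> B" using E exp_gt_zero[of "382/1000 * real k"] unfolding B_def by linarith
    finally have Dz: "norm (D z) * wt z \<le> norm (D w) * wt w + B" by simp
    have "norm (D w) * wt w \<le> (norm (T w) + norm (Q w)) * wt w"
      using norm_triangle_ineq[of "T w" "Q w"] wt0[of w] by (intro mult_right_mono) (auto simp: T_def)
    also have "\<dots> \<le> norm (T w) * wt w + B" using QB[OF Iw] by (simp add: distrib_right)
    finally have Dw: "norm (D w) * wt w \<le> norm (T w) * wt w + B" .
    have "norm (T z) * wt z \<le> (norm (D z) + norm (Q z)) * wt z"
      unfolding T_def using wt0[of z] by (intro mult_right_mono norm_triangle_ineq4) auto
    also have "\<dots> \<le> norm (D z) * wt z + B" using QB[of z] z by (simp add: distrib_right)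
    finally show ?thesis using Dz Dw unfolding w_def by linarith
  qed
  have TB: "norm (T z) * wt z \<le> 11 * (3 * B)"
    unfolding wt_def
  proof (rule modular_contraction[where g = "\<lambda>q. g q - g' q" and N = "L + 1"])
    show "(\<lambda>q. g q - g' q) holomorphic_on ball 0 1" by (intro holomorphic_intros g g')
    show "k + 2 \<le> 12 * (L + 1)" by (rule k)
  qed (use Tg step z in \<open>simp_all add: wt_def\<close>)
  have "norm (D z) * wt z \<le> (norm (T z) + norm (Q z)) * wt z"
    using norm_triangle_ineq[of "T z" "Q z"] wt0[of z] by (intro mult_right_mono) (auto simp: T_def)
  also have "\<dots> \<le> 34 * B" using TB QB[OF z] by (simp add: distrib_right)
  finally have DB: "norm (D z) * wt z \<le> 34 * B" .
  have "norm (D z) = (norm (D z) * wt z) * exp (real k * log_eta z)"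
    by (simp add: wt_def mult.assoc flip: exp_add)
  \<comment> \<open>Undoing the weight gains the rate \<open>0.4045\<close> against the
    \<open>0.382\<close> contained in \<open>B\<close>; the net rate \<open>0.0225\<close> exceeds
    \<open>1/50\<close>, and \<open>34 * 47 = 1598\<close>.\<close>
  also have "\<dots> \<le> (34 * B) * exp (real k * (- 4045/10000))"
  proof (rule mult_mono[OF DB])
    have "log_eta z \<le> - pi / 6 * Im z + 143/10000" using log_eta_near[OF z(1)] by linarith
    also have "\<dots> \<le> - pi / 6 * (4/5) + 143/10000" using z(1) by simp
    also have "\<dots> \<le> - 4045/10000" using pi_bounds by simp
    finally have "real k * log_eta z \<le> real k * (- 4045/10000)" by (intro mult_left_mono) auto
    then show "exp (real k * log_eta z) \<le> exp (real k * (- 4045/10000))" by simp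
  qed (auto simp: B_def approx_error_def)
  also have "\<dots> = 1598 * (real k + 1) * exp (- (real k * (225/10000)))"
    by (simp add: B_def approx_error_def mult_exp_exp mult.assoc) (simp add: algebra_simps)
  also have "\<dots> \<le> 1600 * (real k + 1) * exp (- (real k / 50))"
    by (intro mult_mono) auto
  finally show ?thesis by (simp add: D_def)
qed

section \<open>The Miller basis\<close>

text \<open>Hides \<open>l\<close> and \<open>k'\<close> behind the weight, so that assertions about
  large weights become \<open>eventually\<close> statements in \<open>k\<close> that are uniform in
  \<open>f\<close>.\<close>

definition miller :: "nat \<Rightarrow> nat \<Rightarrow> (complex \<Rightarrow> complex) \<Rightarrow> bool" where
  "miller m k f \<longleftrightarrow> (\<exists>l k'. k' \<in> {0, 4, 6, 8, 10, 14} \<and> k = 12 * l + k' \<and> 1 \<le> m \<and> m \<le> l \<and> miller_form k l m f)"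

lemma miller_even: "miller m k f \<Longrightarrow> even k"
  by (auto simp: miller_def)

lemma miller_ge_12: "miller m k f \<Longrightarrow> k \<ge> 12"
  by (auto simp: miller_def)

lemma miller_modular: "miller m k f \<Longrightarrow> modular_form k f"
  by (auto simp: miller_def miller_form_def)

lemma modular_formD:
  assumes "modular_form k f"
  shows "f holomorphic_on upper_half_plane" "\<And>z. Im z > 0 \<Longrightarrow> f (z + 1) = f z"
    "\<And>z. Im z > 0 \<Longrightarrow> f (- 1 / z) = z ^ k * f z"
  using assms by (auto simp: modular_form_def upper_half_plane_def)

lemma exp_eq_nome_power: "exp (2 * pi * \<i> * of_nat n * z) = nome z ^ n"
  unfolding nome_def exp_of_nat_mult[symmetric] by (simp add: mult_ac)

lemma miller_form_factor:
  assumes f: "miller_form k l m f" and m: "m \<le> l"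
  obtains g where "g holomorphic_on ball 0 1"
    "\<And>z. Im z > 0 \<Longrightarrow> f z = nome z ^ m + nome z ^ (l + 1) * g (nome z)"
proof -
  obtain a where a: "has_q_expansion f a" "a m = 1" "\<And>n. n \<le> l \<Longrightarrow> n \<noteq> m \<Longrightarrow> a n = 0"
    using f by (auto simp: miller_form_def)
  have s: "(\<lambda>n. a n * nome z ^ n) sums f z" if "Im z > 0" for z
    using a(1) that unfolding has_q_expansion_def upper_half_plane_def exp_eq_nome_power by blast
  define h where "h = (\<lambda>q. \<Sum>n. a n * q ^ n)"
  have h: "(\<lambda>n. a n * q ^ n) sums h q" if q: "q \<in> ball 0 1" for q
  proof (cases "q = 0")
    case True
    have "(\<lambda>n. a n * 0 ^ n) sums a 0" by (rule powser_sums_zero)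
    then show ?thesis unfolding h_def True by (simp add: sums_iff)
  next
    case False
    have "Im (Ln q / (2 * pi * \<i>)) > 0"
      unfolding Im_Ln_over[OF False] using q False by (simp add: divide_neg_pos)
    from s[OF this] show ?thesis unfolding h_def nome_Ln[OF False] by (simp add: sums_iff)
  qed
  obtain g where g: "g holomorphic_on ball 0 1"
    and hg: "\<And>q. q \<in> ball 0 1 \<Longrightarrow> h q = (\<Sum>n<l+1. a n * q ^ n) + q ^ (l + 1) * g q"
    using power_series_factor[of a h "l + 1", OF h] by metis
  have "(\<Sum>n<l+1. a n * q ^ n) = q ^ m" for q
  proof -
    have "(\<Sum>n<l+1. a n * q ^ n) = (\<Sum>n\<in>{m}. a n * q ^ n)"
      by (rule sum.mono_neutral_right) (use m a(3) in auto)
    then show ?thesis using a(2) by simp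
  qed
  moreover have "f z = h (nome z)" if "Im z > 0" for z
    using s[OF that] h[of "nome z"] norm_nome_less_1[OF that] sums_unique2 by auto
  ultimately have "f z = nome z ^ m + nome z ^ (l + 1) * g (nome z)" if "Im z > 0" for z
    using hg[of "nome z"] norm_nome_less_1[OF that] that by simp
  with g that show ?thesis by blast
qed

lemma miller_approximation:
  assumes f: "miller m k f" and z: "4/5 \<le> Im z" "Im z \<le> 2"
  shows "norm (f z - nome z ^ m - slash_series k m z) \<le> 1600 * (real k + 1) * exp (- (real k / 50))"
proof -
  obtain l k' where k': "k' \<in> {0, 4, 6, 8, 10, 14}" and k: "k = 12 * l + k'" and m: "1 \<le> m" "m \<le> l"
    and mf: "miller_form k l m f" using f by (auto simp: miller_def)
  have mod: "modular_form k f" by (rule miller_modular[OF f])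
  obtain g where g: "g holomorphic_on ball 0 1"
    and fg: "\<And>z. Im z > 0 \<Longrightarrow> f z = nome z ^ m + nome z ^ (l + 1) * g (nome z)"
    using miller_form_factor[OF mf m(2)] by blast
  have k2: "even k" "k \<ge> 2" using miller_even[OF f] miller_ge_12[OF f] by auto
  show ?thesis
  proof (cases "k' = 14")
    case False
    then have b: "12 * l \<le> k" "k + 2 \<le> 12 * (l + 1)" using k' k by auto
    show ?thesis
      by (rule main_approximation[OF mod k2 b g, where a = 0]) (use fg z in auto)
  next
    case True
    define L where "L = l + 1"
    have kL: "k = 12 * L + 2" using k True by (simp add: L_def)
    have a: "norm (g 0) \<le> exp (367/1000 * (12 * real L))"
      by (rule weight_2_constant_term[of L f g m]) (use mod kL g fg in \<open>auto simp: L_def\<close>)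
    obtain g2 where g2: "g2 holomorphic_on ball 0 1" "\<And>q. q \<in> ball 0 1 \<Longrightarrow> g q = g 0 + q * g2 q"
      using holomorphic_disc_factor[OF g, of 1] by auto
    have ee: "f z = nome z ^ m + g 0 * nome z ^ L + nome z ^ (L + 1) * g2 (nome z)" if "Im z > 0" for z
    proof -
      have e: "g (nome z) = g 0 + nome z * g2 (nome z)" by (rule g2(2)) (use norm_nome_less_1[OF that] in simp)
      show ?thesis unfolding fg[OF that] L_def e by (simp add: algebra_simps)
    qed
    have b: "12 * L \<le> k" "k + 2 \<le> 12 * (L + 1)" "k \<le> 12 * L + 2" using kL by auto
    show ?thesis
      by (rule main_approximation[OF mod k2 b(1,2) g2(1) ee _ z]) (use a b(3) in blast)+
  qed
qed

text \<open>The combination keeps the leading term \<open>q^m\<close>, so for two Miller forms the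
  bound of \<open>weight_2_constant_term\<close> holds for every \<open>t\<close>. This makes the
  free coefficient unique.\<close>

lemma modular_form_combination:
  assumes "modular_form k f" "modular_form k g"
  shows "modular_form k (\<lambda>z. f z + t * (f z - g z))"
proof -
  obtain B C where "\<And>z. Im z \<ge> 1 \<Longrightarrow> norm (f z) \<le> B" "\<And>z. Im z \<ge> 1 \<Longrightarrow> norm (g z) \<le> C"
    using assms by (auto simp: modular_form_def)
  then have "norm (f z + t * (f z - g z)) \<le> B + norm t * (B + C)" if "Im z \<ge> 1" for z
    using that by (intro order_trans[OF norm_triangle_ineq] add_mono)
      (auto simp: norm_mult intro!: mult_left_mono order_trans[OF norm_triangle_ineq4] add_mono)
  then have "\<exists>B. \<forall>z. Im z \<ge> 1 \<longrightarrow> norm (f z + t * (f z - g z)) \<le> B" by blast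
  then show ?thesis
    using assms unfolding modular_form_def by (auto intro!: holomorphic_intros simp: algebra_simps)
qed

text \<open>The difference vanishes to an order above \<open>k / 12\<close> and has no defect under
  the inversion, so the contraction with \<open>A = 0\<close> annihilates it. For
  \<open>k' = 14\<close> the coefficients of \<open>q^(l+1)\<close> are first shown to agree: along
  \<open>f1 + t (f1 - f2)\<close> this coefficient is affine in \<open>t\<close> and
  bounded.\<close>

lemma miller_unique:
  assumes k': "k' \<in> {0, 4, 6, 8, 10, 14}" and k: "k = 12 * l + k'" and m: "m \<le> l"
    and f: "miller_form k l m f1" "miller_form k l m f2" and z: "Im z \<ge> 4/5"
  shows "f1 z = f2 z"
proof -
  have mod: "modular_form k f1" "modular_form k f2" using f by (auto simp: miller_form_def)
  obtain g1 where g1: "g1 holomorphic_on ball 0 1"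
    and fg1: "\<And>z. Im z > 0 \<Longrightarrow> f1 z = nome z ^ m + nome z ^ (l + 1) * g1 (nome z)"
    using miller_form_factor[OF f(1) m] by blast
  obtain g2 where g2: "g2 holomorphic_on ball 0 1"
    and fg2: "\<And>z. Im z > 0 \<Longrightarrow> f2 z = nome z ^ m + nome z ^ (l + 1) * g2 (nome z)"
    using miller_form_factor[OF f(2) m] by blast
  have "\<exists>N G. G holomorphic_on ball 0 1 \<and> (\<forall>z. Im z > 0 \<longrightarrow> f1 z - f2 z = nome z ^ N * G (nome z)) \<and> k + 2 \<le> 12 * N"
  proof (cases "k' = 14")
    case False
    then have "k + 2 \<le> 12 * (l + 1)" using k' k by auto
    then show ?thesis
      by (intro exI[of _ "l + 1"] exI[of _ "\<lambda>q. g1 q - g2 q"])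
         (auto intro!: holomorphic_intros g1 g2 simp: fg1 fg2 algebra_simps)
  next
    case True
    define L where "L = l + 1"
    have kL: "k = 12 * L + 2" using k True by (simp add: L_def)
    define C where "C = exp (367/1000 * (12 * real L))"
    have b: "norm (g1 0 + t * (g1 0 - g2 0)) \<le> C" for t
      unfolding C_def
    proof (rule weight_2_constant_term)
      show "modular_form (12 * L + 2) (\<lambda>z. f1 z + t * (f1 z - f2 z))"
        using modular_form_combination[OF mod] kL by simp
      show "(\<lambda>q. g1 q + t * (g1 q - g2 q)) holomorphic_on ball 0 1" by (intro holomorphic_intros g1 g2)
      show "f1 z + t * (f1 z - f2 z) = nome z ^ m + nome z ^ L * (g1 (nome z) + t * (g1 (nome z) - g2 (nome z)))" if "Im z > 0" for z
        unfolding fg1[OF that] fg2[OF that] L_def by (simp add: algebra_simps)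
    qed
    have "g1 0 - g2 0 = 0"
    proof (rule ccontr)
      assume d: "g1 0 - g2 0 \<noteq> 0"
      define t where "t = (of_real (C + 1) - g1 0) / (g1 0 - g2 0)"
      have "g1 0 + t * (g1 0 - g2 0) = of_real (C + 1)" using d by (simp add: t_def)
      then have "norm (of_real (C + 1) :: complex) \<le> C" using b[of t] by simp
      then show False unfolding norm_of_real by linarith
    qed
    moreover obtain G where G: "G holomorphic_on ball 0 1" "\<And>q. q \<in> ball 0 1 \<Longrightarrow> g1 q - g2 q = (g1 0 - g2 0) + q * G q"
    proof -
      have h: "(\<lambda>q. g1 q - g2 q) holomorphic_on ball 0 1" by (intro holomorphic_intros g1 g2)
      from holomorphic_disc_factor[OF h, of 1] show ?thesis using that by auto
    qed
    ultimately have "f1 z - f2 z = nome z ^ (L + 1) * G (nome z)" if "Im z > 0" for z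
    proof -
      have "nome z \<in> ball 0 1" using norm_nome_less_1[OF that] by simp
      from G(2)[OF this] \<open>g1 0 - g2 0 = 0\<close> have "g1 (nome z) = g2 (nome z) + nome z * G (nome z)" by (simp add: algebra_simps)
      then show ?thesis unfolding fg1[OF that] fg2[OF that] by (simp add: L_def algebra_simps)
    qed
    then show ?thesis using G(1) kL by (intro exI[of _ "L + 1"] exI[of _ G]) auto
  qed
  then obtain N G where G: "G holomorphic_on ball 0 1" and T: "\<And>z. Im z > 0 \<Longrightarrow> f1 z - f2 z = nome z ^ N * G (nome z)"
    and N: "k + 2 \<le> 12 * N" by blast
  have "norm (f1 z - f2 z) * exp (- real k * log_eta z) \<le> 11 * 0"
  proof (rule modular_contraction[OF G _ N _ z, where T = "\<lambda>z. f1 z - f2 z"])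
    fix z :: complex assume "Im z = 4/5"
    then have Iz: "Im z > 0" by simp
    then have z0: "z \<noteq> 0" by auto
    have "norm z ^ k = exp (real k * ln (norm z))" using z0 by (simp add: exp_of_nat_mult)
    moreover have "exp (- real k * (ln (norm z) + log_eta z)) = exp (- real k * log_eta z) / exp (real k * ln (norm z))"
      unfolding exp_diff[symmetric] by (simp add: algebra_simps)
    ultimately have "exp (- real k * log_eta (- 1 / z)) = exp (- real k * log_eta z) / norm z ^ k"
      unfolding log_eta_inversion[OF Iz] by simp
    moreover have "norm (f1 (- 1 / z) - f2 (- 1 / z)) = norm z ^ k * norm (f1 z - f2 z)"
      unfolding modular_formD(3)[OF mod(1) Iz] modular_formD(3)[OF mod(2) Iz]
      by (simp add: norm_mult norm_power flip: right_diff_distrib)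
    ultimately show "norm (f1 z - f2 z) * exp (- real k * log_eta z)
       \<le> 0 + norm (f1 (- 1 / z) - f2 (- 1 / z)) * exp (- real k * log_eta (- 1 / z))"
      using z0 by simp
  qed (use T in auto)
  then have "norm (f1 z - f2 z) \<le> 0" by (simp add: mult_le_0_iff)
  then show ?thesis by simp
qed

lemma nome_minus_cnj: "nome (- cnj z) = cnj (nome z)"
  by (simp add: nome_def exp_cnj)

text \<open>The function \<open>cnj (f (- cnj z))\<close> is a modular form with the conjugate
  Fourier coefficients, hence a Miller form of the same type, and it equals \<open>f\<close> by
  uniqueness.\<close>

lemma miller_reflection:
  assumes f: "miller m k f" and z: "Im z \<ge> 4/5"
  shows "f (- cnj z) = cnj (f z)"
proof -
  obtain l k' where k': "k' \<in> {0, 4, 6, 8, 10, 14}" and k: "k = 12 * l + k'" and m: "1 \<le> m" "m \<le> l"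
    and mf: "miller_form k l m f" using f by (auto simp: miller_def)
  have mod: "modular_form k f" by (rule miller_modular[OF f])
  have ev: "even k" by (rule miller_even[OF f])
  define fc where "fc = (\<lambda>z. cnj (f (- cnj z)))"
  have "fc holomorphic_on upper_half_plane"
  proof -
    have "f \<circ> uminus holomorphic_on (cnj ` upper_half_plane)"
      by (rule holomorphic_on_compose_gen[OF _ modular_formD(1)[OF mod]])
         (auto intro!: holomorphic_intros simp: upper_half_plane_def)
    then have "cnj \<circ> (f \<circ> uminus) \<circ> cnj holomorphic_on upper_half_plane"
      by (rule holomorphic_on_compose_cnj_cnj) (simp add: upper_half_plane_def open_halfspace_Im_gt)
    then show ?thesis by (simp add: fc_def o_def)
  qed
  moreover have "fc (z + 1) = fc z" if "Im z > 0" for z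
    using modular_formD(2)[OF mod, of "- cnj z - 1"] that by (simp add: fc_def)
  moreover have "fc (- 1 / z) = z ^ k * fc z" if "Im z > 0" for z
  proof -
    have "- cnj (- 1 / z) = - 1 / (- cnj z)" by simp
    then have "fc (- 1 / z) = cnj ((- cnj z) ^ k * f (- cnj z))"
      unfolding fc_def using modular_formD(3)[OF mod, of "- cnj z"] that by simp
    then show ?thesis using ev by (simp add: fc_def)
  qed
  moreover obtain B where B: "\<And>z. Im z \<ge> 1 \<Longrightarrow> norm (f z) \<le> B" using mod by (auto simp: modular_form_def)
  then have "norm (fc z) \<le> B" if "Im z \<ge> 1" for z using that by (simp add: fc_def)
  ultimately have "modular_form k fc" unfolding modular_form_def by (auto simp: upper_half_plane_def)
  moreover obtain a where a: "has_q_expansion f a" "a m = 1" "\<And>n. n \<le> l \<Longrightarrow> n \<noteq> m \<Longrightarrow> a n = 0"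
    using mf by (auto simp: miller_form_def)
  have "has_q_expansion fc (\<lambda>n. cnj (a n))"
    unfolding has_q_expansion_def
  proof
    fix z assume "z \<in> upper_half_plane"
    then have "- cnj z \<in> upper_half_plane" by (simp add: upper_half_plane_def)
    then have "(\<lambda>n. a n * nome (- cnj z) ^ n) sums f (- cnj z)"
      using a(1) unfolding has_q_expansion_def exp_eq_nome_power by blast
    then have "(\<lambda>n. cnj (a n * nome (- cnj z) ^ n)) sums cnj (f (- cnj z))" by (subst sums_cnj)
    then show "(\<lambda>n. cnj (a n) * exp (2 * pi * \<i> * of_nat n * z)) sums fc z"
      unfolding exp_eq_nome_power by (simp add: fc_def nome_minus_cnj)
  qed
  ultimately have "miller_form k l m fc" unfolding miller_form_def using a by auto
  from miller_unique[OF k' k m(2) this mf z] have "cnj (f (- cnj z)) = f z" by (simp only: fc_def)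
  then show ?thesis by (metis complex_cnj_cnj)
qed

text \<open>\<open>1617 = 1600 + 16 + 1\<close>: the main approximation, the terms with
  \<open>|d| \<ge> 2\<close> and the term \<open>d = -1\<close>.\<close>

definition decay :: "nat \<Rightarrow> real" where
  "decay k = 1617 * (real k + 1) * exp (- (real k / 50))"

text \<open>The rectangle reaches beyond the left half of the fundamental domain to leave room for
  Cauchy estimates. From \<open>Re z \<le> 1/10\<close> and \<open>Im z \<ge> 4/5\<close> one gets
  \<open>|z - 1| \<ge> 6/5\<close>, which makes the term \<open>d = -1\<close> exponentially
  small.\<close>

lemma miller_three_terms:
  assumes f: "miller m k f" and z: "4/5 \<le> Im z" "Im z \<le> 2" "- 6/10 \<le> Re z" "Re z \<le> 1/10"
  shows "norm (f z - (nome z ^ m + nome (- of_nat m / z) / z ^ k + nome (- of_nat m / (z + 1)) / (z + 1) ^ k)) \<le> decay k"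
proof -
  have k2: "k \<ge> 2" using miller_ge_12[OF f] by simp
  have Iz: "Im z > 0" using z by simp
  have 1: "norm (f z - nome z ^ m - slash_series k m z) \<le> 1600 * (real k + 1) * exp (- (real k / 50))"
    by (rule miller_approximation[OF f z(1,2)])
  have R: "\<bar>Re z\<bar> \<le> 6/10" using z by (simp add: abs_le_iff)
  have "norm (slash_series k m z - (slash_term k m 0 z + slash_term k m 1 z + slash_term k m (- 1) z)) \<le> 16 / (14/10) ^ k"
  proof (rule slash_series_near[OF Iz k2])
    fix d :: int assume "\<bar>d\<bar> \<ge> 2"
    then have "\<bar>real_of_int d\<bar> \<ge> 2" by linarith
    then show "norm (z + of_int d) \<ge> 14/10 * \<bar>of_int d\<bar> / 2"
      using norm_add_of_int_ge_Re[OF R, of d] by linarith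
  qed simp
  also have "\<dots> \<le> 16 / (12/10) ^ k" by (intro frac_le power_mono) auto
  finally have 2: "norm (slash_series k m z - (slash_term k m 0 z + slash_term k m 1 z + slash_term k m (- 1) z)) \<le> 16 / (12/10) ^ k" .
  have 3: "norm (slash_term k m (- 1) z) \<le> 1 / (12/10) ^ k"
  proof -
    have "(9/10)^2 + (4/5)^2 \<le> (1 - Re z)^2 + (Im z)^2" using z by (intro add_mono power_mono) auto
    also have "\<dots> = norm (z + of_int (- 1))^2" by (simp add: cmod_power2 power2_commute)
    finally have "(12/10)^2 \<le> norm (z + of_int (- 1))^2" by (simp add: power2_eq_square)
    then have "12/10 \<le> norm (z + of_int (- 1))" by (rule power2_le_imp_le) simp
    then have "1 / norm (z + of_int (- 1)) ^ k \<le> 1 / (12/10) ^ k" by (intro frac_le power_mono) auto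
    then show ?thesis using norm_slash_term_le[OF Iz, of k m "- 1"] by linarith
  qed
  have 4: "1 / (12/10) ^ k \<le> exp (- (real k / 50))"
  proof -
    have "1 / (12/10) ^ k \<le> exp (- (1/6) * real k)" by (rule inverse_power_le_exp) auto
    also have "\<dots> \<le> exp (- (real k / 50))" by simp
    finally show ?thesis .
  qed
  have e: "f z - (nome z ^ m + nome (- of_nat m / z) / z ^ k + nome (- of_nat m / (z + 1)) / (z + 1) ^ k)
      = (f z - nome z ^ m - slash_series k m z)
        + (slash_series k m z - (slash_term k m 0 z + slash_term k m 1 z + slash_term k m (- 1) z)) + slash_term k m (- 1) z"
    by (simp add: slash_term_def)
  have "norm (f z - (nome z ^ m + nome (- of_nat m / z) / z ^ k + nome (- of_nat m / (z + 1)) / (z + 1) ^ k))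
     \<le> 1600 * (real k + 1) * exp (- (real k / 50)) + 16 / (12/10) ^ k + 1 / (12/10) ^ k"
    unfolding e by (intro norm_triangle_mono 1 2 3)
  also have "\<dots> \<le> 1600 * (real k + 1) * exp (- (real k / 50)) + 17 * exp (- (real k / 50))" using 4 by simp
  also have "\<dots> \<le> decay k"
  proof -
    have "17 * exp (- (real k / 50)) \<le> 17 * (real k + 1) * exp (- (real k / 50))" by (intro mult_right_mono) auto
    then show ?thesis unfolding decay_def by (simp add: algebra_simps)
  qed
  finally show ?thesis .
qed

text \<open>A factor \<open>exp (k / 200)\<close> absorbs the linear one:
  \<open>1/50 - 1/200 = 3/200\<close> and \<open>1617 * 200 = 323400\<close>.\<close>

lemma decay_le: "decay k \<le> 323400 * exp (- (3 / 200 * real k))"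
proof -
  have "real k + 1 \<le> 200 * exp (real k / 200)"
    using mult_left_mono[OF exp_ge_add_one_self[of "real k / 200"], of 200] by (simp add: distrib_left)
  then have "decay k \<le> 1617 * (200 * exp (real k / 200)) * exp (- (real k / 50))"
    unfolding decay_def by (intro mult_right_mono mult_left_mono) auto
  also have "\<dots> = 323400 * exp (- (3 / 200 * real k))" by (simp add: mult_exp_exp)
  finally show ?thesis .
qed

lemma decay_nonneg: "decay k \<ge> 0"
  by (simp add: decay_def)

text \<open>With \<open>C = 4 \<pi> m\<close> the factor \<open>exp (k / 100 + C)\<close> bounds the
  normalisation on \<open>box (1 / 50)\<close>. The rate \<open>3/200 - 1/100 = 1/200\<close>
  remains.\<close>

lemma decay_exp_tendsto: "(\<lambda>k. decay k * exp (real k / 100 + C)) \<longlonglongrightarrow> 0"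
proof (rule tendsto_sandwich[of "\<lambda>_. 0" _ _ "\<lambda>k. 323400 * exp C * exp (- 1 / 200) ^ k"])
  show "\<forall>\<^sub>F k in sequentially. decay k * exp (real k / 100 + C) \<le> 323400 * exp C * exp (- 1 / 200) ^ k"
  proof (rule always_eventually, rule allI)
    fix k
    have "decay k * exp (real k / 100 + C) \<le> 323400 * exp (- (3 / 200 * real k)) * exp (real k / 100 + C)"
      by (intro mult_right_mono decay_le) auto
    also have "\<dots> = 323400 * exp (C + real k * (- 1 / 200))" by (simp add: mult.assoc mult_exp_exp algebra_simps)
    also have "\<dots> = 323400 * exp C * exp (- 1 / 200) ^ k" unfolding exp_add exp_of_nat_mult by simp
    finally show "decay k * exp (real k / 100 + C) \<le> 323400 * exp C * exp (- 1 / 200) ^ k" .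
  qed
  show "(\<lambda>k. 323400 * exp C * exp (- 1 / 200) ^ k) \<longlonglongrightarrow> 0"
    by (intro tendsto_mult_right_zero LIMSEQ_power_zero) simp
qed (auto simp: decay_nonneg)

section \<open>Restriction to the arc\<close>

definition phase :: "nat \<Rightarrow> nat \<Rightarrow> complex \<Rightarrow> complex" where
  "phase k m \<theta> = of_nat k * \<theta> / 2 + 2 * of_real pi * of_nat m * cos \<theta>"

text \<open>The parameter is complex: a point off the unit circle has
  \<open>Im \<theta> = - ln |z|\<close>, so zeros off the arc turn into non-real zeros of the same
  function. The exponential factor balances \<open>q^m\<close> against the term
  \<open>d = 0\<close>.\<close>

definition arc_fun :: "(complex \<Rightarrow> complex) \<Rightarrow> nat \<Rightarrow> nat \<Rightarrow> complex \<Rightarrow> complex" where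
  "arc_fun f k m \<theta> = exp (\<i> * of_nat k * \<theta> / 2 + 2 * of_real pi * of_nat m * sin \<theta>) * f (exp (\<i> * \<theta>))"

definition arc_rest :: "(complex \<Rightarrow> complex) \<Rightarrow> nat \<Rightarrow> nat \<Rightarrow> complex \<Rightarrow> complex" where
  "arc_rest f k m \<theta> = arc_fun f k m \<theta> - 2 * cos (phase k m \<theta>)"

text \<open>The term \<open>d = 1\<close> in the normalisation of \<open>arc_fun\<close>: it is as large as the cosine only within \<open>O(1/k)\<close> of
  the corner.\<close>

definition third_exponent :: "nat \<Rightarrow> complex \<Rightarrow> complex" where
  "third_exponent m \<theta> = 2 * of_real pi * of_nat m * sin \<theta> - 2 * of_real pi * \<i> * of_nat m / (1 + exp (\<i> * \<theta>))"

definition third_term :: "nat \<Rightarrow> nat \<Rightarrow> complex \<Rightarrow> complex" where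
  "third_term k m \<theta> = exp (third_exponent m \<theta>) / (2 * cos (\<theta> / 2)) ^ k"

definition strip :: "complex set" where
  "strip = {\<theta>. 0 < Re \<theta> \<and> Re \<theta> < pi}"

lemma open_strip: "open strip"
proof -
  have e: "strip = {\<theta>. 0 < Re \<theta>} \<inter> {\<theta>. Re \<theta> < pi}" unfolding strip_def by blast
  show ?thesis unfolding e by (rule open_Int[OF open_halfspace_Re_gt open_halfspace_Re_lt])
qed

lemma Re_exp_ii: "Re (exp (\<i> * \<theta>)) = exp (- Im \<theta>) * cos (Re \<theta>)"
  and Im_exp_ii: "Im (exp (\<i> * \<theta>)) = exp (- Im \<theta>) * sin (Re \<theta>)"
  by (simp_all add: Re_exp Im_exp)

lemma Im_exp_ii_pos: "\<theta> \<in> strip \<Longrightarrow> Im (exp (\<i> * \<theta>)) > 0"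
  unfolding Im_exp_ii by (auto simp: strip_def intro!: mult_pos_pos sin_gt_zero)

lemma one_plus_exp_ii: "1 + exp (\<i> * \<theta>) = exp (\<i> * \<theta> / 2) * (2 * cos (\<theta> / 2))"
proof -
  have "exp (\<i> * \<theta> / 2) * exp (\<i> * \<theta> / 2) = exp (\<i> * \<theta>)" by (simp flip: exp_add)
  moreover have "exp (\<i> * \<theta> / 2) * exp (- (\<i> * \<theta> / 2)) = 1" by (simp flip: exp_add)
  moreover have "u * (2 * ((u + v) / 2)) = u * u + u * v" for u v :: complex by (simp add: algebra_simps)
  ultimately show ?thesis unfolding cos_exp_eq times_divide_eq_right by (simp only: add.commute)
qed

lemma one_plus_exp_ii_nonzero: "\<theta> \<in> strip \<Longrightarrow> 1 + exp (\<i> * \<theta>) \<noteq> 0"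
  using Im_exp_ii_pos[of \<theta>] by (auto simp: complex_eq_iff)

lemma cos_half_nonzero: "\<theta> \<in> strip \<Longrightarrow> cos (\<theta> / 2) \<noteq> 0"
  using one_plus_exp_ii[of \<theta>] one_plus_exp_ii_nonzero[of \<theta>] by auto

lemma three_terms_on_arc:
  assumes \<theta>: "\<theta> \<in> strip"
  defines "z \<equiv> exp (\<i> * \<theta>)"
  shows "exp (\<i> * of_nat k * \<theta> / 2 + 2 * of_real pi * of_nat m * sin \<theta>) *
      (nome z ^ m + nome (- of_nat m / z) / z ^ k + nome (- of_nat m / (z + 1)) / (z + 1) ^ k)
    = 2 * cos (phase k m \<theta>) + third_term k m \<theta>"
proof -
  define E where "E = exp (\<i> * of_nat k * \<theta> / 2 + 2 * of_real pi * of_nat m * sin \<theta>)"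
  have zk: "z ^ k = exp (\<i> * of_nat k * \<theta>)"
    unfolding z_def exp_of_nat_mult[symmetric] by (simp add: mult_ac)
  have ze: "z = cos \<theta> + \<i> * sin \<theta>" unfolding z_def by (rule exp_Euler)
  have iz: "1 / z = cos \<theta> - \<i> * sin \<theta>"
    using exp_Euler[of "- \<theta>"] unfolding z_def by (simp add: exp_minus inverse_eq_divide)
  have 1: "E * nome z ^ m = exp (\<i> * phase k m \<theta>)"
    unfolding E_def nome_of_nat_mult[symmetric] unfolding nome_def mult_exp_exp ze phase_def
    by (rule arg_cong[of _ _ exp]) (simp add: algebra_simps)
  have 2: "E * (nome (- of_nat m / z) / z ^ k) = exp (- (\<i> * phase k m \<theta>))"
  proof -
    have "- of_nat m / z = - of_nat m * (cos \<theta> - \<i> * sin \<theta>)" unfolding iz[symmetric] by simp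
    then have "E * (nome (- of_nat m / z) / z ^ k) = exp (\<i> * of_nat k * \<theta> / 2 + 2 * of_real pi * of_nat m * sin \<theta>
       + (2 * of_real pi * \<i> * (- of_nat m * (cos \<theta> - \<i> * sin \<theta>)) - \<i> * of_nat k * \<theta>))"
      unfolding E_def zk nome_def exp_diff exp_add by simp
    also have "\<i> * of_nat k * \<theta> / 2 + 2 * of_real pi * of_nat m * sin \<theta>
       + (2 * of_real pi * \<i> * (- of_nat m * (cos \<theta> - \<i> * sin \<theta>)) - \<i> * of_nat k * \<theta>) = - (\<i> * phase k m \<theta>)"
      unfolding phase_def by (simp add: algebra_simps)
    finally show ?thesis .
  qed
  have 3: "E * (nome (- of_nat m / (z + 1)) / (z + 1) ^ k) = third_term k m \<theta>"
  proof -
    have "z + 1 = exp (\<i> * \<theta> / 2) * (2 * cos (\<theta> / 2))" unfolding z_def using one_plus_exp_ii[of \<theta>] by (simp add: add.commute)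
    then have k: "(z + 1) ^ k = exp (\<i> * of_nat k * \<theta> / 2) * (2 * cos (\<theta> / 2)) ^ k"
      by (simp add: power_mult_distrib mult_ac flip: exp_of_nat_mult)
    have "nome (- of_nat m / (z + 1)) = exp (- (2 * of_real pi * \<i> * of_nat m / (1 + z)))"
    proof -
      have "of_real (2 * pi) * \<i> * (- of_nat m / w) = - (2 * of_real pi * \<i> * of_nat m / w)" for w :: complex by simp
      then show ?thesis unfolding nome_def add.commute[of z 1] by simp
    qed
    then have n: "nome (- of_nat m / (z + 1)) = exp (- (2 * of_real pi * \<i> * of_nat m / (1 + z)))" .
    have "exp (a + b) * (exp (- c) / (exp a * P)) = exp (b - c) / P" for a b c P :: complex
      by (simp add: exp_add exp_diff exp_minus divide_inverse)
    then show ?thesis unfolding k n third_term_def third_exponent_def E_def z_def[symmetric] .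
  qed
  have "E * (nome z ^ m + nome (- of_nat m / z) / z ^ k + nome (- of_nat m / (z + 1)) / (z + 1) ^ k)
     = exp (\<i> * phase k m \<theta>) + exp (- (\<i> * phase k m \<theta>)) + third_term k m \<theta>"
    unfolding distrib_left 1 2 3 ..
  then show ?thesis unfolding E_def cos_exp_eq by simp
qed

definition box :: "real \<Rightarrow> complex set" where
  "box \<delta> = {\<theta>. pi / 2 - \<delta> \<le> Re \<theta> \<and> Re \<theta> \<le> 2 * pi / 3 + \<delta> \<and> \<bar>Im \<theta>\<bar> \<le> \<delta>}"

lemma exp_one_fiftieth: "exp (1 / 50 :: real) \<le> 50 / 49"
proof -
  have "49 / 50 \<le> exp (- (1 / 50 :: real))" using exp_ge_add_one_self[of "- (1 / 50 :: real)"] by simp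
  then have "inverse (exp (- (1 / 50 :: real))) \<le> inverse (49 / 50)" by (intro le_imp_inverse_le) auto
  then show ?thesis unfolding exp_minus[symmetric] by simp
qed

lemma cos_two_pi_thirds: "cos (2 * pi / 3) = - 1 / 2" and sin_two_pi_thirds: "sin (2 * pi / 3) = sqrt 3 / 2"
proof -
  have e: "2 * pi / 3 = pi - pi / 3" by simp
  show "cos (2 * pi / 3) = - 1 / 2" "sin (2 * pi / 3) = sqrt 3 / 2"
    unfolding e cos_pi_minus sin_pi_minus cos_60 sin_60 by simp_all
qed

text \<open>The half-width \<open>1/50\<close> is small enough for the rectangle of
  \<open>miller_three_terms\<close>: the sine of the real part is at least \<open>0.85\<close>, and
  \<open>|exp (\<i> \<theta>)|\<close> lies between \<open>49/50\<close> and
  \<open>50/49\<close>.\<close>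

lemma box_image:
  assumes "\<theta> \<in> box (1 / 50)"
  defines "z \<equiv> exp (\<i> * \<theta>)"
  shows "4/5 \<le> Im z" "Im z \<le> 2" "- 6/10 \<le> Re z" "Re z \<le> 1/10" "\<theta> \<in> strip"
proof -
  define x y where "x = Re \<theta>" and "y = Im \<theta>"
  have x: "pi / 2 - 1 / 50 \<le> x" "x \<le> 2 * pi / 3 + 1 / 50" and y: "\<bar>y\<bar> \<le> 1 / 50"
    using assms(1) by (auto simp: box_def x_def y_def)
  have xr: "0 < x" "x < pi" using x pi_bounds by linarith+
  show "\<theta> \<in> strip" using xr by (simp add: strip_def x_def)
  have s50: "sin (1 / 50) \<le> (1 / 50 :: real)" by (rule sin_x_le_x) simp
  have s50': "sin (1 / 50) \<ge> (0 :: real)" using pi_bounds by (intro sin_ge_zero) linarith+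
  have "cos x \<le> cos (pi / 2 - 1 / 50)" using x xr pi_bounds by (intro cos_monotone_0_pi_le) linarith+
  also have "\<dots> = sin (1 / 50)" by (simp add: cos_diff)
  finally have c1: "cos x \<le> 1 / 50" using s50 by linarith
  have "- 1 / 2 - 1 / 50 \<le> cos (2 * pi / 3 + 1 / 50)"
  proof -
    have "sqrt 3 \<le> 2" by (rule real_le_lsqrt) auto
    then have "sqrt 3 / 2 * sin (1 / 50) \<le> 1 * (1 / 50)" using s50 s50' by (intro mult_mono) auto
    then show ?thesis unfolding cos_add cos_two_pi_thirds sin_two_pi_thirds using cos_le_one[of "1 / 50 :: real"] by linarith
  qed
  also have "\<dots> \<le> cos x" using x xr pi_bounds by (intro cos_monotone_0_pi_le) linarith+
  finally have c2: "- 52 / 100 \<le> cos x" by simp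
  have s0: "sin x \<ge> 0" using xr by (intro sin_ge_zero) auto
  have "\<bar>cos x\<bar> \<le> 52 / 100" using c1 c2 by (simp add: abs_le_iff)
  then have "(cos x)^2 \<le> (52 / 100)^2" by (metis abs_ge_zero power2_abs power_mono)
  then have "(85 / 100)^2 \<le> (sin x)^2" using sin_cos_squared_add[of x] by (simp add: power2_eq_square)
  then have s: "85 / 100 \<le> sin x" by (rule power2_le_imp_le[OF _ s0])
  have e1: "exp (- y) \<le> 50 / 49"
    by (rule order_trans[OF _ exp_one_fiftieth]) (use y in \<open>simp add: abs_le_iff\<close>)
  have e2: "49 / 50 \<le> exp (- y)" using exp_ge_add_one_self[of "- y"] y by (simp add: abs_le_iff)
  have Re: "Re z = exp (- y) * cos x" and Im: "Im z = exp (- y) * sin x"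
    unfolding z_def Re_exp_ii Im_exp_ii x_def y_def by simp_all
  have "49 / 50 * (85 / 100) \<le> exp (- y) * sin x" using e2 s by (intro mult_mono) auto
  then show "4/5 \<le> Im z" unfolding Im by simp
  have "exp (- y) * sin x \<le> 50 / 49 * 1" using e1 s0 by (intro mult_mono) auto
  then show "Im z \<le> 2" unfolding Im by simp
  have "exp (- y) * (- cos x) \<le> 50 / 49 * (52 / 100)"
  proof -
    have "exp (- y) * (- cos x) \<le> exp (- y) * (52 / 100)" using c2 by (intro mult_left_mono) auto
    also have "\<dots> \<le> 50 / 49 * (52 / 100)" using e1 by (intro mult_right_mono) auto
    finally show ?thesis .
  qed
  then show "- 6/10 \<le> Re z" unfolding Re by simp
  have "exp (- y) * cos x \<le> 50 / 49 * (1 / 50)"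
  proof -
    have "exp (- y) * cos x \<le> exp (- y) * (1 / 50)" using c1 by (intro mult_left_mono) auto
    also have "\<dots> \<le> 50 / 49 * (1 / 50)" using e1 by (intro mult_right_mono) auto
    finally show ?thesis .
  qed
  then show "Re z \<le> 1/10" unfolding Re by simp
qed

text \<open>The error of the three terms is multiplied by the normalising exponential;
  \<open>|Im \<theta>| \<le> 1/50\<close> and \<open>Re (sin \<theta>) \<le> 2\<close> account for
  \<open>k / 100\<close> and \<open>4 \<pi> m\<close>.\<close>

lemma arc_rest_approx:
  assumes f: "miller m k f" and \<theta>: "\<theta> \<in> box (1 / 50)"
  shows "norm (arc_rest f k m \<theta> - third_term k m \<theta>) \<le> decay k * exp (real k / 100 + 4 * pi * real m)"
proof -
  define z where "z = exp (\<i> * \<theta>)"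
  define E where "E = exp (\<i> * of_nat k * \<theta> / 2 + 2 * of_real pi * of_nat m * sin \<theta>)"
  note b = box_image[OF \<theta>, folded z_def]
  have "arc_rest f k m \<theta> - third_term k m \<theta>
     = E * (f z - (nome z ^ m + nome (- of_nat m / z) / z ^ k + nome (- of_nat m / (z + 1)) / (z + 1) ^ k))"
    unfolding arc_rest_def arc_fun_def right_diff_distrib E_def z_def three_terms_on_arc[OF b(5)] by simp
  then have "norm (arc_rest f k m \<theta> - third_term k m \<theta>) = norm E *
      norm (f z - (nome z ^ m + nome (- of_nat m / z) / z ^ k + nome (- of_nat m / (z + 1)) / (z + 1) ^ k))"
    by (simp add: norm_mult)
  also have "\<dots> \<le> exp (real k / 100 + 4 * pi * real m) * decay k"
  proof (intro mult_mono miller_three_terms[OF f b(1-4)])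
    have I: "\<bar>Im \<theta>\<bar> \<le> 1 / 50" using \<theta> by (simp add: box_def)
    have e: "exp (Im \<theta>) \<le> 50 / 49" "exp (- Im \<theta>) \<le> 50 / 49"
      by (rule order_trans[OF _ exp_one_fiftieth]; use I in \<open>simp add: abs_le_iff\<close>)+
    have "Re (sin \<theta>) \<le> 2"
    proof -
      have "sin (Re \<theta>) * ((exp (Im \<theta>) + exp (- Im \<theta>)) / 2) \<le> 1 * 2" using e by (intro mult_mono) auto
      then show ?thesis by (simp add: Re_sin)
    qed
    then have "real m * Re (sin \<theta>) \<le> real m * 2" by (intro mult_left_mono) auto
    then have "2 * pi * (real m * Re (sin \<theta>)) \<le> 2 * pi * (real m * 2)" by (rule mult_left_mono) simp
    moreover have "real k * (- Im \<theta>) \<le> real k * (1 / 50)" using I by (intro mult_left_mono) (auto simp: abs_le_iff)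
    moreover have "norm E = exp (2 * pi * (real m * Re (sin \<theta>)) + real k * (- Im \<theta>) / 2)"
      unfolding E_def by simp
    ultimately show "norm E \<le> exp (real k / 100 + 4 * pi * real m)"
      unfolding \<open>norm E = _\<close> exp_le_cancel_iff by linarith
  qed auto
  finally show ?thesis by (simp add: mult.commute)
qed

lemma arc_rest_holomorphic:
  assumes f: "f holomorphic_on upper_half_plane"
  shows "arc_rest f k m holomorphic_on strip"
proof -
  have "(f \<circ> (\<lambda>\<theta>. exp (\<i> * \<theta>))) holomorphic_on strip"
    by (rule holomorphic_on_compose_gen[OF _ f])
       (auto intro!: holomorphic_intros Im_exp_ii_pos simp: upper_half_plane_def simp del: Im_exp)
  then have "(\<lambda>\<theta>. f (exp (\<i> * \<theta>))) holomorphic_on strip" by (simp add: o_def)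
  then show ?thesis
    unfolding arc_rest_def[abs_def] arc_fun_def phase_def by (intro holomorphic_intros) auto
qed

section \<open>Derivative and size of the term d = 1 along the arc\<close>

lemma third_exponent_deriv:
  assumes "\<theta> \<in> strip"
  shows "(third_exponent m has_field_derivative 2 * of_real pi * of_nat m * (cos \<theta> - 1 / (2 * cos (\<theta> / 2))^2)) (at \<theta>)"
proof -
  define w where "w = 1 + exp (\<i> * \<theta>)"
  have w0: "w \<noteq> 0" unfolding w_def by (rule one_plus_exp_ii_nonzero[OF assms])
  have c0: "cos (\<theta> / 2) \<noteq> 0" by (rule cos_half_nonzero[OF assms])
  have i: "((\<lambda>\<theta>. 1 + exp (\<i> * \<theta>)) has_field_derivative (\<i> * exp (\<i> * \<theta>))) (at \<theta>)"
    by (auto intro!: derivative_eq_intros)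
  have "((\<lambda>\<theta>. inverse (1 + exp (\<i> * \<theta>))) has_field_derivative - (inverse w * (\<i> * exp (\<i> * \<theta>)) * inverse w)) (at \<theta>)"
    unfolding w_def by (rule DERIV_inverse'[OF i]) (use w0 in \<open>simp add: w_def\<close>)
  from DERIV_diff[OF DERIV_cmult[OF DERIV_sin] DERIV_cmult[OF this], of "2 * of_real pi * of_nat m" "2 * of_real pi * \<i> * of_nat m"]
  have "(third_exponent m has_field_derivative (2 * of_real pi * of_nat m * cos \<theta> -
      2 * of_real pi * \<i> * of_nat m * (- (inverse w * (\<i> * exp (\<i> * \<theta>)) * inverse w)))) (at \<theta>)"
    unfolding third_exponent_def[abs_def] divide_inverse .
  moreover have "exp (\<i> * \<theta>) * (inverse w * inverse w) = 1 / (2 * cos (\<theta> / 2))^2"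
  proof -
    have "exp (\<i> * \<theta> / 2) * exp (\<i> * \<theta> / 2) = exp (\<i> * \<theta>)" by (simp flip: exp_add)
    then have "w * w = exp (\<i> * \<theta>) * (2 * cos (\<theta> / 2))^2"
      unfolding w_def one_plus_exp_ii by (simp add: power2_eq_square mult_ac)
    then have "inverse w * inverse w = inverse (exp (\<i> * \<theta>)) * inverse ((2 * cos (\<theta> / 2))^2)"
      by (simp only: inverse_mult_distrib[symmetric])
    moreover have "X * (inverse X * C) = C" if "X \<noteq> 0" for X C :: complex using that by simp
    ultimately show ?thesis by (simp only: exp_not_eq_zero not_False_eq_True inverse_eq_divide)
  qed
  then have "2 * of_real pi * of_nat m * cos \<theta> - 2 * of_real pi * \<i> * of_nat m * (- (inverse w * (\<i> * exp (\<i> * \<theta>)) * inverse w))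
     = 2 * of_real pi * of_nat m * (cos \<theta> - 1 / (2 * cos (\<theta> / 2))^2)"
    by (simp add: right_diff_distrib mult_ac)
  ultimately show ?thesis by simp
qed

lemma third_term_deriv:
  assumes "\<theta> \<in> strip"
  shows "(third_term k m has_field_derivative third_term k m \<theta> *
     (2 * of_real pi * of_nat m * (cos \<theta> - 1 / (2 * cos (\<theta> / 2))^2) + of_nat k / 2 * (sin (\<theta> / 2) / cos (\<theta> / 2)))) (at \<theta>)"
proof -
  define c where "c = 2 * cos (\<theta> / 2)"
  define s where "s = sin (\<theta> / 2)"
  have c0: "c \<noteq> 0" using cos_half_nonzero[OF assms] by (simp add: c_def)
  have d: "((\<lambda>\<theta>. 2 * cos (\<theta> / 2)) has_field_derivative - s) (at \<theta>)"
    unfolding s_def by (auto intro!: derivative_eq_intros)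
  define D where "D = 2 * of_real pi * of_nat m * (cos \<theta> - 1 / (2 * cos (\<theta> / 2))^2)"
  have e: "((\<lambda>\<theta>. exp (third_exponent m \<theta>)) has_field_derivative exp (third_exponent m \<theta>) * D) (at \<theta>)"
    unfolding D_def by (rule DERIV_chain2[OF DERIV_exp third_exponent_deriv[OF assms]])
  have p: "((\<lambda>\<theta>. (2 * cos (\<theta> / 2)) ^ k) has_field_derivative of_nat k * c ^ (k - 1) * - s) (at \<theta>)"
    using DERIV_power[OF d, of k] by (simp add: c_def mult_ac)
  have "(third_term k m has_field_derivative
     (exp (third_exponent m \<theta>) * D * c ^ k - exp (third_exponent m \<theta>) * (of_nat k * c ^ (k - 1) * - s)) / (c ^ k * c ^ k)) (at \<theta>)"
    unfolding third_term_def[abs_def] c_def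
    by (rule DERIV_divide[OF e p[unfolded c_def]]) (use c0 in \<open>simp add: c_def\<close>)
  moreover have "(exp (third_exponent m \<theta>) * D * c ^ k - exp (third_exponent m \<theta>) * (of_nat k * c ^ (k - 1) * - s)) / (c ^ k * c ^ k)
     = third_term k m \<theta> * (D + of_nat k / 2 * (s / (c / 2)))"
  proof (cases k)
    case (Suc j)
    have "(X * D * (c * p) - X * (K * p * - s)) / ((c * p) * (c * p)) = X / (c * p) * (D + K / 2 * (s / (c / 2)))" if "p \<noteq> 0" for X K p
      using c0 that by (simp add: field_simps)
    from this[of "c ^ j" "exp (third_exponent m \<theta>)" "of_nat k"] show ?thesis
      using c0 unfolding third_term_def c_def[symmetric] Suc by simp
  qed (simp add: third_term_def)
  ultimately show ?thesis unfolding D_def s_def c_def by simp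
qed

text \<open>The power of \<open>2 cos (\<theta> / 2)\<close> supplies \<open>exp (- k s / 2)\<close>
  at distance \<open>s\<close> from the corner. Half of that rate is given up to absorb the exponent
  \<open>6 \<pi> m s\<close> of the numerator, which leaves \<open>1/4\<close>.\<close>

definition decay_arc :: "nat \<Rightarrow> real \<Rightarrow> real" where
  "decay_arc k x = exp (- (real k * (2 * pi / 3 - x) / 4))"

lemma cos_ge_quadratic:
  fixes t :: real
  assumes "0 \<le> t" "t \<le> 1"
  shows "1 - t^2 / 2 \<le> cos t"
proof -
  have "sin (t / 2) \<le> t / 2" by (rule sin_x_le_x) (use assms in simp)
  moreover have "0 \<le> sin (t / 2)" by (rule sin_ge_zero) (use assms pi_bounds in linarith)+
  ultimately have "(sin (t / 2))^2 \<le> (t / 2)^2" by (rule power_mono)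
  moreover have "cos t = 1 - 2 * (sin (t / 2))^2" using cos_double_sin[of "t / 2"] by simp
  ultimately show ?thesis by (simp add: power_divide)
qed

text \<open>With \<open>t = (2 \<pi> / 3 - x) / 2\<close> the right side is
  \<open>cos t + sqrt 3 * sin t\<close>. Its slope \<open>sqrt 3\<close> at 0 exceeds that of
  \<open>exp t\<close>, with enough room up to \<open>t = 3/10\<close>.\<close>

lemma two_cos_half_ge:
  assumes "pi / 2 \<le> x" "x \<le> 2 * pi / 3"
  shows "exp ((2 * pi / 3 - x) / 2) \<le> 2 * cos (x / 2)"
proof -
  define t where "t = (2 * pi / 3 - x) / 2"
  have "t \<le> (2 * pi / 3 - pi / 2) / 2" using assms(1) unfolding t_def by simp
  also have "\<dots> \<le> 3/10" using pi_bounds by simp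
  finally have t: "0 \<le> t" "t \<le> 3/10" using assms(2) unfolding t_def by simp_all
  have e: "x / 2 = pi / 3 - t" by (simp add: t_def field_simps)
  have "2 * cos (x / 2) = cos t + sqrt 3 * sin t" unfolding e cos_diff by (simp add: cos_60 sin_60)
  moreover have "1 - t^2 / 2 \<le> cos t" by (rule cos_ge_quadratic) (use t in auto)
  moreover have "17/10 * (t - t^3 / 6) \<le> sqrt 3 * sin t"
  proof (rule mult_mono)
    show "17/10 \<le> sqrt 3" by (rule real_le_rsqrt) (simp add: power2_eq_square)
    have "\<bar>sin t - (\<Sum>k<3. sin_coeff k * t ^ k)\<bar> \<le> inverse (fact 3) * \<bar>t\<bar> ^ 3" by (rule Maclaurin_sin_bound)
    then have "\<bar>sin t - t\<bar> \<le> t ^ 3 / 6"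
      using t by (simp add: eval_nat_numeral sin_coeff_def)
    then show "t - t^3 / 6 \<le> sin t" by linarith
    show "0 \<le> t - t^3 / 6"
    proof -
      have "t * t^2 \<le> t * 1" using t by (intro mult_left_mono power_le_one) auto
      then show ?thesis using t by (simp add: power3_eq_cube power2_eq_square)
    qed
  qed auto
  moreover have "exp t \<le> 1 + t + t^2" using t by (intro exp_bound) auto
  moreover have "t^2 \<le> 3/10 * t" unfolding power2_eq_square by (rule mult_right_mono) (use t in auto)
  moreover have "t^3 \<le> t^2"
    using mult_right_mono[of t 1 "t^2"] t by (simp add: power3_eq_cube power2_eq_square)
  moreover have "e \<le> c + S" if "1 - p2 / 2 \<le> c" "17/10 * (t - p3 / 6) \<le> S" "e \<le> 1 + t + p2" "p2 \<le> 3/10 * t" "p3 \<le> p2"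
    for e c S p2 p3 :: real using that t by (simp add: field_simps)
  ultimately show ?thesis unfolding t_def[symmetric] by metis
qed

lemma norm_sin_sq: "norm (sin z)^2 = (sin (Re z))^2 + (exp (Im z) - inverse (exp (Im z)))^2 / 4"
proof -
  have "Re (of_real pi / 2 - z) = pi / 2 - Re z" "Im (of_real pi / 2 - z) = - Im z" by simp_all
  then show ?thesis
    unfolding sin_cos_eq[of z] norm_cos_squared by (simp add: sin_cos_eq exp_minus power2_commute)
qed

text \<open>Off the real axis the squared norms of sine and cosine grow by the same
  \<open>sinh^2\<close>, so their ratio stays below \<open>tan (\<pi> / 3) = sqrt 3\<close>. This is
  the origin of the \<open>sqrt 3\<close> in the derivative bounds.\<close>

lemma norm_cos_half_ge:
  assumes "pi / 2 \<le> Re \<theta>" "Re \<theta> \<le> 2 * pi / 3"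
  shows "cos (Re \<theta> / 2) \<le> norm (cos (\<theta> / 2))" "1/2 \<le> norm (cos (\<theta> / 2))"
    "norm (sin (\<theta> / 2)) \<le> sqrt 3 * norm (cos (\<theta> / 2))"
proof -
  have c: "1/2 \<le> cos (Re \<theta> / 2)"
  proof -
    have "cos (pi / 3) \<le> cos (Re \<theta> / 2)" using assms pi_bounds by (intro cos_monotone_0_pi_le) linarith+
    then show ?thesis by (simp add: cos_60)
  qed
  define E where "E = (exp (Im \<theta> / 2) - inverse (exp (Im \<theta> / 2)))^2 / 4"
  have E: "E \<ge> 0" by (simp add: E_def)
  have n: "norm (cos (\<theta> / 2))^2 = (cos (Re \<theta> / 2))^2 + E" "norm (sin (\<theta> / 2))^2 = (sin (Re \<theta> / 2))^2 + E"
    unfolding norm_cos_squared norm_sin_sq E_def by simp_all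
  have "(cos (Re \<theta> / 2))^2 \<le> norm (cos (\<theta> / 2))^2" unfolding n using E by simp
  then show 1: "cos (Re \<theta> / 2) \<le> norm (cos (\<theta> / 2))" by (rule power2_le_imp_le) simp
  then show "1/2 \<le> norm (cos (\<theta> / 2))" using c by linarith
  have "(1/2)^2 \<le> (cos (Re \<theta> / 2))^2" using c by (intro power_mono) auto
  then have "(sin (Re \<theta> / 2))^2 + E \<le> 3 * ((cos (Re \<theta> / 2))^2 + E)"
    using sin_cos_squared_add[of "Re \<theta> / 2"] E by (simp add: power2_eq_square)
  then have "norm (sin (\<theta> / 2))^2 \<le> (sqrt 3 * norm (cos (\<theta> / 2)))^2"
    unfolding power_mult_distrib n by simp
  then show "norm (sin (\<theta> / 2)) \<le> sqrt 3 * norm (cos (\<theta> / 2))" by (rule power2_le_imp_le) simp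
qed

lemma box_strip: "pi / 2 \<le> Re \<theta> \<Longrightarrow> Re \<theta> \<le> 2 * pi / 3 \<Longrightarrow> \<theta> \<in> strip"
  unfolding strip_def mem_Collect_eq using pi_gt_zero by (intro conjI) linarith+

lemma norm_cos_le_2:
  assumes "\<bar>Im \<theta>\<bar> \<le> 1 / 50"
  shows "norm (cos \<theta>) \<le> 2"
proof -
  have "norm (exp (\<i> * \<theta>) + exp (- (\<i> * \<theta>))) \<le> exp (- Im \<theta>) + exp (Im \<theta>)"
    by (rule order_trans[OF norm_triangle_ineq]) simp
  moreover have "exp (Im \<theta>) \<le> 50 / 49" "exp (- Im \<theta>) \<le> 50 / 49"
    by (rule order_trans[OF _ exp_one_fiftieth]; use assms in \<open>simp add: abs_le_iff\<close>)+
  ultimately show ?thesis unfolding cos_exp_eq norm_divide by simp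
qed

lemma norm_third_exponent_deriv_le:
  assumes "pi / 2 \<le> Re \<theta>" "Re \<theta> \<le> 2 * pi / 3" "\<bar>Im \<theta>\<bar> \<le> 1 / 50"
  shows "norm (2 * of_real pi * of_nat m * (cos \<theta> - 1 / (2 * cos (\<theta> / 2))^2)) \<le> 6 * pi * real m"
proof -
  have "1 \<le> norm (2 * cos (\<theta> / 2))" using norm_cos_half_ge(2)[OF assms(1,2)] by (simp add: norm_mult)
  then have "1 \<le> norm (2 * cos (\<theta> / 2))^2" by (rule one_le_power)
  then have "norm (1 / (2 * cos (\<theta> / 2))^2) \<le> 1" unfolding norm_divide norm_power by (simp add: divide_le_eq)
  then have "norm (cos \<theta> - 1 / (2 * cos (\<theta> / 2))^2) \<le> 2 + 1"
    by (intro order_trans[OF norm_triangle_ineq4] add_mono norm_cos_le_2[OF assms(3)])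
  then have "2 * pi * real m * norm (cos \<theta> - 1 / (2 * cos (\<theta> / 2))^2) \<le> 2 * pi * real m * 3"
    by (intro mult_left_mono) auto
  then show ?thesis by (simp add: norm_mult)
qed

text \<open>At the corner the exponent is purely imaginary, all three terms having the same modulus
  there. The derivative is at most \<open>6 \<pi> m\<close>, and the mean value inequality does the
  rest.\<close>

lemma Re_third_exponent_le:
  assumes "pi / 2 \<le> Re \<theta>" "Re \<theta> \<le> 2 * pi / 3" "\<bar>Im \<theta>\<bar> \<le> 1 / 50"
  shows "Re (third_exponent m \<theta>) \<le> 6 * pi * real m * ((2 * pi / 3 - Re \<theta>) + \<bar>Im \<theta>\<bar>)"
proof -
  define \<theta>0 :: complex where "\<theta>0 = of_real (2 * pi / 3)"
  define S where "S = {\<theta>. pi / 2 \<le> Re \<theta>} \<inter> {\<theta>. Re \<theta> \<le> 2 * pi / 3} \<inter> {\<theta>. Im \<theta> \<le> 1 / 50} \<inter> {\<theta>. Im \<theta> \<ge> - 1 / 50}"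
  have S: "\<theta> \<in> S \<longleftrightarrow> pi / 2 \<le> Re \<theta> \<and> Re \<theta> \<le> 2 * pi / 3 \<and> \<bar>Im \<theta>\<bar> \<le> 1 / 50" for \<theta>
    by (auto simp: S_def abs_le_iff)
  have "convex S" unfolding S_def
    by (intro convex_Int convex_halfspace_Re_ge convex_halfspace_Re_le convex_halfspace_Im_ge convex_halfspace_Im_le)
  then have "norm (third_exponent m \<theta> - third_exponent m \<theta>0) \<le> 6 * pi * real m * norm (\<theta> - \<theta>0)"
  proof (rule field_differentiable_bound)
    fix w assume "w \<in> S"
    then have w: "pi / 2 \<le> Re w" "Re w \<le> 2 * pi / 3" "\<bar>Im w\<bar> \<le> 1 / 50" unfolding S by auto
    show "(third_exponent m has_field_derivative 2 * of_real pi * of_nat m * (cos w - 1 / (2 * cos (w / 2))^2)) (at w within S)"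
      by (rule has_field_derivative_at_within[OF third_exponent_deriv[OF box_strip[OF w(1,2)]]])
    show "norm (2 * of_real pi * of_nat m * (cos w - 1 / (2 * cos (w / 2))^2)) \<le> 6 * pi * real m"
      by (rule norm_third_exponent_deriv_le[OF w])
  next
    show "\<theta> \<in> S" using assms unfolding S by simp
    show "\<theta>0 \<in> S" unfolding S \<theta>0_def using pi_gt_zero by simp
  qed
  moreover have "Re (third_exponent m \<theta>0) = 0"
  proof -
    have e: "1 + exp (\<i> * \<theta>0) = Complex (1/2) (sqrt 3 / 2)"
      by (simp add: complex_eq_iff \<theta>0_def Re_exp Im_exp cos_two_pi_thirds sin_two_pi_thirds)
    have "1 / Complex (1/2) (sqrt 3 / 2) = Complex (1/2) (- sqrt 3 / 2)"
      by (simp add: complex_eq_iff Re_divide Im_divide power2_eq_square)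
    then have "third_exponent m \<theta>0 = 2 * of_real pi * of_nat m * sin \<theta>0 - 2 * of_real pi * \<i> * of_nat m * Complex (1/2) (- sqrt 3 / 2)"
      unfolding third_exponent_def e by (metis (no_types, lifting) mult.right_neutral times_divide_eq_right)
    moreover have "sin \<theta>0 = of_real (sqrt 3 / 2)" unfolding \<theta>0_def sin_of_real sin_two_pi_thirds ..
    ultimately show ?thesis by simp
  qed
  moreover have "norm (\<theta> - \<theta>0) \<le> (2 * pi / 3 - Re \<theta>) + \<bar>Im \<theta>\<bar>"
    using cmod_le[of "\<theta> - \<theta>0"] assms by (simp add: \<theta>0_def)
  then have "6 * pi * real m * norm (\<theta> - \<theta>0) \<le> 6 * pi * real m * ((2 * pi / 3 - Re \<theta>) + \<bar>Im \<theta>\<bar>)"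
    by (intro mult_left_mono) auto
  moreover have "Re (third_exponent m \<theta> - third_exponent m \<theta>0) \<le> norm (third_exponent m \<theta> - third_exponent m \<theta>0)"
    by (rule complex_Re_le_cmod)
  moreover have "Re (third_exponent m \<theta> - third_exponent m \<theta>0) = Re (third_exponent m \<theta>) - Re (third_exponent m \<theta>0)" by simp
  ultimately show ?thesis by linarith
qed

lemma norm_third_term_le:
  assumes "pi / 2 \<le> Re \<theta>" "Re \<theta> \<le> 2 * pi / 3" "\<bar>Im \<theta>\<bar> \<le> 1 / 50"
    and k: "24 * pi * real m \<le> real k" "real k * \<bar>Im \<theta>\<bar> \<le> 4"
  shows "norm (third_term k m \<theta>) \<le> decay_arc k (Re \<theta>) * exp (24 * pi * real m / real k)"
proof -
  define s where "s = 2 * pi / 3 - Re \<theta>"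
  have s: "s \<ge> 0" using assms(2) by (simp add: s_def)
  have "exp (s / 2) \<le> norm (2 * cos (\<theta> / 2))"
    using two_cos_half_ge[OF assms(1,2)] norm_cos_half_ge(1)[OF assms(1,2)] by (simp add: s_def norm_mult)
  then have "exp (s / 2) ^ k \<le> norm (2 * cos (\<theta> / 2)) ^ k" by (rule power_mono) simp
  then have "exp (real k * s / 2) \<le> norm (2 * cos (\<theta> / 2)) ^ k" unfolding exp_of_nat_mult[symmetric] by simp
  moreover have "exp (Re (third_exponent m \<theta>)) \<le> exp (6 * pi * real m * (s + \<bar>Im \<theta>\<bar>))"
    using Re_third_exponent_le[OF assms(1-3)] by (simp add: s_def)
  ultimately have "norm (third_term k m \<theta>) \<le> exp (6 * pi * real m * (s + \<bar>Im \<theta>\<bar>)) / exp (real k * s / 2)"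
    unfolding third_term_def norm_divide norm_power norm_exp_eq_Re by (intro frac_le) auto
  also have "\<dots> = exp (6 * pi * real m * (s + \<bar>Im \<theta>\<bar>) - real k * s / 2)" by (simp add: exp_diff)
  also have "\<dots> \<le> exp (- (real k * s / 4) + 24 * pi * real m / real k)"
  proof -
    have "6 * pi * real m * s \<le> real k / 4 * s" using k s by (intro mult_right_mono) auto
    moreover have "6 * pi * real m * \<bar>Im \<theta>\<bar> \<le> 24 * pi * real m / real k"
    proof (cases "m = 0")
      case False
      then have "24 * pi * real m > 0" by simp
      then have k0: "real k > 0" using k(1) by linarith
      have "6 * pi * real m * (real k * \<bar>Im \<theta>\<bar>) \<le> 6 * pi * real m * 4" using k(2) by (intro mult_left_mono) auto
      then show ?thesis using k0 by (simp add: field_simps)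
    qed simp
    ultimately show ?thesis by (simp add: distrib_left)
  qed
  also have "\<dots> = decay_arc k (Re \<theta>) * exp (24 * pi * real m / real k)"
    unfolding exp_add decay_arc_def s_def ..
  finally show ?thesis .
qed

lemma third_term_holomorphic: "third_term k m holomorphic_on strip"
  by (rule holomorphic_onI, rule field_differentiable_at_within)
     (use third_term_deriv in \<open>auto simp: field_differentiable_def\<close>)

text \<open>The band \<open>k |Im \<theta>| \<le> 4\<close> is matched to
  \<open>zero_near_arc\<close>, which excludes zeros above it. The derivative is measured in units
  of \<open>k / 2\<close>, the main part of the speed of the phase; in these units the logarithmic
  derivative of the term \<open>d = 1\<close> is \<open>tan (\<theta> / 2)\<close> to leading order,
  with the value \<open>sqrt 3\<close> at the corner.\<close>

definition arc_good :: "nat \<Rightarrow> real \<Rightarrow> nat \<Rightarrow> (complex \<Rightarrow> complex) \<Rightarrow> bool" where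
  "arc_good m \<epsilon> k f \<longleftrightarrow> miller m k f \<and> 400 \<le> k \<and> 8 * pi * real m \<le> \<epsilon> * real k \<and>
     (\<forall>\<theta>. pi / 2 \<le> Re \<theta> \<longrightarrow> Re \<theta> \<le> 2 * pi / 3 \<longrightarrow> real k * \<bar>Im \<theta>\<bar> \<le> 4 \<longrightarrow>
        norm (arc_rest f k m \<theta>) \<le> decay_arc k (Re \<theta>) + \<epsilon> \<and>
        norm (deriv (arc_rest f k m) \<theta>) \<le> real k / 2 * (sqrt 3 * decay_arc k (Re \<theta>) + \<epsilon>))"

lemma decay_arc_le_1: "x \<le> 2 * pi / 3 \<Longrightarrow> decay_arc k x \<le> 1"
  unfolding decay_arc_def by simp

lemma decay_arc_pos: "decay_arc k x > 0"
  by (simp add: decay_arc_def)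

lemma arc_good_if_small:
  assumes f: "miller m k f" and \<epsilon>: "0 < \<epsilon>" "\<epsilon> \<le> 1"
    and k: "400 \<le> k" "96 * pi * real m \<le> \<epsilon> * real k"
    and a: "decay k * exp (real k / 100 + 4 * pi * real m) \<le> \<epsilon> / 400"
    and b: "exp (24 * pi * real m / real k) \<le> 1 + \<epsilon> / 4"
  shows "arc_good m \<epsilon> k f"
  unfolding arc_good_def
proof (intro conjI allI impI f k(1))
  show "8 * pi * real m \<le> \<epsilon> * real k"
    by (rule order_trans[OF _ k(2)]) simp
  fix \<theta> :: complex assume \<theta>: "pi / 2 \<le> Re \<theta>" "Re \<theta> \<le> 2 * pi / 3" "real k * \<bar>Im \<theta>\<bar> \<le> 4"
  define c where "c = decay_arc k (Re \<theta>)"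
  have c: "0 < c" "c \<le> 1" unfolding c_def using decay_arc_pos decay_arc_le_1[OF \<theta>(2)] by auto
  have k0: "real k > 0" "real k \<ge> 400" using k(1) by linarith+
  have "400 * \<bar>Im \<theta>\<bar> \<le> real k * \<bar>Im \<theta>\<bar>" using k0 by (intro mult_right_mono) auto
  then have I: "\<bar>Im \<theta>\<bar> \<le> 1 / 100" using \<theta>(3) by linarith
  then have I2: "\<bar>Im \<theta>\<bar> \<le> 1 / 50" by linarith
  have st: "\<theta> \<in> strip" by (rule box_strip[OF \<theta>(1,2)])
  have "24 * pi * real m \<le> 96 * pi * real m" by simp
  also have "\<dots> \<le> 1 * real k" by (rule order_trans[OF k(2)]) (use \<epsilon> k0 in \<open>intro mult_right_mono, auto\<close>)
  finally have k24: "24 * pi * real m \<le> real k" by simp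
  have "norm (third_term k m \<theta>) \<le> c * exp (24 * pi * real m / real k)"
    unfolding c_def by (rule norm_third_term_le[OF \<theta>(1,2) I2 k24 \<theta>(3)])
  also have "\<dots> \<le> c * (1 + \<epsilon> / 4)" using b c by (intro mult_left_mono) auto
  also have "\<dots> \<le> c + \<epsilon> / 4" using c \<epsilon> by (simp add: distrib_left mult_left_le_one_le)
  finally have C: "norm (third_term k m \<theta>) \<le> c + \<epsilon> / 4" .
  define err where "err = (\<lambda>\<theta>. arc_rest f k m \<theta> - third_term k m \<theta>)"
  have rest_hol: "arc_rest f k m holomorphic_on strip"
    by (rule arc_rest_holomorphic[OF modular_formD(1)[OF miller_modular[OF f]]])
  have err_hol: "err holomorphic_on strip"
    unfolding err_def by (intro holomorphic_intros rest_hol third_term_holomorphic)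
  have box: "w \<in> box (1 / 50)" if "dist \<theta> w \<le> 1 / 100" for w
  proof -
    have "\<bar>Re (\<theta> - w)\<bar> \<le> 1 / 100" "\<bar>Im (\<theta> - w)\<bar> \<le> 1 / 100"
      using that abs_Re_le_cmod[of "\<theta> - w"] abs_Im_le_cmod[of "\<theta> - w"] unfolding dist_norm by linarith+
    then have "\<bar>Re \<theta> - Re w\<bar> \<le> 1 / 100" "\<bar>Im \<theta> - Im w\<bar> \<le> 1 / 100" by simp_all
    then show ?thesis unfolding box_def mem_Collect_eq using \<theta>(1,2) I by (intro conjI) linarith+
  qed
  have err: "norm (err w) \<le> \<epsilon> / 400" if "dist \<theta> w \<le> 1 / 100" for w
    unfolding err_def by (rule order_trans[OF arc_rest_approx[OF f box[OF that]] a])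
  have sub: "cball \<theta> (1 / 100) \<subseteq> strip" using box box_image(5) by auto
  \<comment> \<open>The radius \<open>1/100\<close> is what remains to the boundary of the box,
    since \<open>k \<ge> 400\<close> gives \<open>|Im \<theta>| \<le> 1/100\<close>. The loss of a
    factor 100 explains the assumed \<open>\<epsilon> / 400\<close>.\<close>
  have "norm ((deriv ^^ 1) err \<theta>) \<le> fact 1 * (\<epsilon> / 400) / (1 / 100) ^ 1"
  proof (rule Cauchy_inequality)
    show "err holomorphic_on ball \<theta> (1 / 100)" by (rule holomorphic_on_subset[OF err_hol]) (use sub ball_subset_cball in blast)
    show "continuous_on (cball \<theta> (1 / 100)) err"
      by (rule continuous_on_subset[OF holomorphic_on_imp_continuous_on[OF err_hol] sub])
    show "norm (err w) \<le> \<epsilon> / 400" if "norm (\<theta> - w) = 1 / 100" for w using err[of w] that by (simp add: dist_norm)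
  qed simp
  then have err': "norm (deriv err \<theta>) \<le> \<epsilon> / 4" by simp
  have "norm (arc_rest f k m \<theta>) \<le> norm (err \<theta>) + norm (third_term k m \<theta>)"
    unfolding err_def using norm_triangle_ineq[of "arc_rest f k m \<theta> - third_term k m \<theta>" "third_term k m \<theta>"] by simp
  then show "norm (arc_rest f k m \<theta>) \<le> decay_arc k (Re \<theta>) + \<epsilon>"
    using C err[of \<theta>] \<epsilon> unfolding c_def by simp
  define D where "D = 2 * of_real pi * of_nat m * (cos \<theta> - 1 / (2 * cos (\<theta> / 2))^2) + of_nat k / 2 * (sin (\<theta> / 2) / cos (\<theta> / 2))"
  have d1: "(third_term k m has_field_derivative third_term k m \<theta> * D) (at \<theta>)"
    unfolding D_def by (rule third_term_deriv[OF st])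
  have d2: "(err has_field_derivative deriv err \<theta>) (at \<theta>)" by (rule holomorphic_derivI[OF err_hol open_strip st])
  have "((\<lambda>\<theta>. err \<theta> + third_term k m \<theta>) has_field_derivative (deriv err \<theta> + third_term k m \<theta> * D)) (at \<theta>)"
    by (rule DERIV_add[OF d2 d1])
  then have dr: "deriv (arc_rest f k m) \<theta> = deriv err \<theta> + third_term k m \<theta> * D"
    by (simp add: err_def DERIV_imp_deriv)
  have "norm D \<le> 6 * pi * real m + real k / 2 * sqrt 3"
  proof -
    have "cos (\<theta> / 2) \<noteq> 0" by (rule cos_half_nonzero[OF st])
    then have "norm (sin (\<theta> / 2) / cos (\<theta> / 2)) \<le> sqrt 3"
      using norm_cos_half_ge(3)[OF \<theta>(1,2)] by (simp add: norm_divide divide_le_eq)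
    then have "real k / 2 * norm (sin (\<theta> / 2) / cos (\<theta> / 2)) \<le> real k / 2 * sqrt 3" by (intro mult_left_mono) auto
    then have "norm (of_nat k / 2 * (sin (\<theta> / 2) / cos (\<theta> / 2))) \<le> real k / 2 * sqrt 3" by (simp add: norm_mult norm_divide)
    then show ?thesis unfolding D_def
      by (intro order_trans[OF norm_triangle_ineq] add_mono norm_third_exponent_deriv_le[OF \<theta>(1,2) I2])
  qed
  also have "\<dots> \<le> real k / 2 * (sqrt 3 + \<epsilon> / 8)" using k(2) by (simp add: distrib_left mult_ac)
  finally have D: "norm D \<le> real k / 2 * (sqrt 3 + \<epsilon> / 8)" .
  have s3: "sqrt 3 \<le> 2" by (rule real_le_lsqrt) auto
  have "norm (deriv (arc_rest f k m) \<theta>) \<le> norm (deriv err \<theta>) + norm (third_term k m \<theta>) * norm D"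
    unfolding dr using norm_triangle_ineq[of "deriv err \<theta>" "third_term k m \<theta> * D"] by (simp add: norm_mult)
  also have "\<dots> \<le> \<epsilon> / 4 + (c + \<epsilon> / 4) * (real k / 2 * (sqrt 3 + \<epsilon> / 8))"
    using C D err' c \<epsilon> by (intro add_mono mult_mono) auto
  also have "\<dots> \<le> real k / 2 * (\<epsilon> / 8) + real k / 2 * ((c + \<epsilon> / 4) * (sqrt 3 + \<epsilon> / 8))"
    using mult_right_mono[of 400 "real k" "\<epsilon> / 16"] k0 \<epsilon> by (intro add_mono) (simp_all add: mult_ac)
  also have "real k / 2 * (\<epsilon> / 8) + real k / 2 * ((c + \<epsilon> / 4) * (sqrt 3 + \<epsilon> / 8)) = real k / 2 * (\<epsilon> / 8 + (c + \<epsilon> / 4) * (sqrt 3 + \<epsilon> / 8))"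
    by (simp add: distrib_left)
  also have "\<dots> \<le> real k / 2 * (sqrt 3 * c + \<epsilon>)"
  proof (rule mult_left_mono)
    have "c * \<epsilon> \<le> 1 * \<epsilon>" "\<epsilon> * sqrt 3 \<le> \<epsilon> * 2" "\<epsilon> * \<epsilon> \<le> \<epsilon> * 1"
      using c \<epsilon> s3 by (auto intro: mult_right_mono mult_left_mono)
    moreover have "\<epsilon> / 8 + (c + \<epsilon> / 4) * (sqrt 3 + \<epsilon> / 8) = \<epsilon> / 8 + sqrt 3 * c + (c * \<epsilon>) / 8 + (\<epsilon> * sqrt 3) / 4 + (\<epsilon> * \<epsilon>) / 32"
      by (simp add: algebra_simps)
    moreover have "A \<le> S + \<epsilon>" if "u \<le> 1 * \<epsilon>" "v \<le> \<epsilon> * 2" "w \<le> \<epsilon> * 1" "A = \<epsilon> / 8 + S + u / 8 + v / 4 + w / 32"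
      for A S u v w :: real using that \<epsilon> by (simp add: field_simps)
    ultimately show "\<epsilon> / 8 + (c + \<epsilon> / 4) * (sqrt 3 + \<epsilon> / 8) \<le> sqrt 3 * c + \<epsilon>" by blast
  qed simp
  finally show "norm (deriv (arc_rest f k m) \<theta>) \<le> real k / 2 * (sqrt 3 * decay_arc k (Re \<theta>) + \<epsilon>)"
    unfolding c_def by simp
qed

lemma eventually_arc_good:
  assumes \<epsilon>: "0 < \<epsilon>" "\<epsilon> \<le> 1"
  shows "\<forall>\<^sub>F k in sequentially. \<forall>f. miller m k f \<longrightarrow> arc_good m \<epsilon> k f"
proof -
  have 1: "\<forall>\<^sub>F k in sequentially. decay k * exp (real k / 100 + 4 * pi * real m) < \<epsilon> / 400"
    using decay_exp_tendsto \<epsilon> by (intro order_tendstoD(2)) auto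
  have "(\<lambda>k. exp (24 * pi * real m / real k)) \<longlonglongrightarrow> exp 0"
    by (intro tendsto_intros tendsto_divide_0[OF tendsto_const] filterlim_at_top_imp_at_infinity filterlim_real_sequentially)
  then have 2: "\<forall>\<^sub>F k in sequentially. exp (24 * pi * real m / real k) < 1 + \<epsilon> / 4"
    using \<epsilon> by (intro order_tendstoD(2)[where y = "exp 0"]) auto
  have 3: "\<forall>\<^sub>F k in sequentially. 96 * pi * real m / \<epsilon> \<le> real k"
    using eventually_ge_at_top[of "nat \<lceil>96 * pi * real m / \<epsilon>\<rceil>"] unfolding nat_ceiling_le_eq .
  show ?thesis using 1 2 3 eventually_ge_at_top[of 400]
  proof eventually_elim
    case (elim k)
    then have "96 * pi * real m \<le> \<epsilon> * real k" using \<epsilon> by (simp add: field_simps)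
    then show ?case using elim \<epsilon> by (intro allI impI arc_good_if_small) auto
  qed
qed

section \<open>The real function on the arc: phase, zeros off the axis, Wronskian and
  simplicity\<close>

definition real_phase :: "nat \<Rightarrow> nat \<Rightarrow> real \<Rightarrow> real" where
  "real_phase k m x = real k * x / 2 + 2 * pi * real m * cos x"

lemma phase_of_real: "phase k m (of_real x) = of_real (real_phase k m x)"
  by (simp add: phase_def real_phase_def flip: cos_of_real)

text \<open>On the unit circle \<open>- cnj z = - 1 / z\<close>, so reflection and inversion
  together give \<open>cnj (f z) = z^k f z\<close>. The factor \<open>exp (\<i> k x / 2)\<close> is
  a square root of \<open>z^k\<close> and makes the product real.\<close>

lemma arc_fun_real:
  assumes f: "miller m k f" and x: "pi / 2 \<le> x" "x \<le> 2 * pi / 3"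
  shows "Im (arc_fun f k m (of_real x)) = 0"
proof -
  define z where "z = exp (\<i> * of_real x)"
  have "complex_of_real x \<in> box (1 / 50)" using x by (simp add: box_def)
  note b = box_image[OF this, folded z_def]
  have "norm z = 1" by (simp add: z_def)
  then have "cnj z * z = 1" using complex_norm_square[of z] by (simp add: mult.commute)
  moreover have "z \<noteq> 0" by (simp add: z_def)
  ultimately have "cnj z = 1 / z" by (simp add: eq_divide_eq)
  then have "- cnj z = - 1 / z" by simp
  moreover have "f (- cnj z) = cnj (f z)" by (rule miller_reflection[OF f b(1)])
  moreover have "f (- 1 / z) = z ^ k * f z"
    using modular_formD(3)[OF miller_modular[OF f], of z] b(1) by simp
  ultimately have c: "cnj (f z) = z ^ k * f z" by simp
  define a where "a = \<i> * of_nat k * of_real x / 2"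
  define r where "r = 2 * pi * real m * sin x"
  have E: "arc_fun f k m (of_real x) = exp (a + of_real r) * f z"
    unfolding arc_fun_def a_def r_def z_def by (simp add: sin_of_real[symmetric])
  have "cnj (exp (a + of_real r)) = exp (- a + of_real r)" by (simp add: exp_cnj a_def)
  moreover have "z ^ k = exp (a + a)" unfolding z_def a_def exp_of_nat_mult[symmetric] by (simp add: mult_ac)
  ultimately have "cnj (arc_fun f k m (of_real x)) = exp (- a + of_real r) * exp (a + a) * f z"
    unfolding E complex_cnj_mult c by simp
  also have "exp (- a + of_real r) * exp (a + a) = exp (a + of_real r)" unfolding mult_exp_exp by (simp add: algebra_simps)
  finally have "cnj (arc_fun f k m (of_real x)) = arc_fun f k m (of_real x)" unfolding E .
  then show ?thesis by (simp add: complex_eq_iff)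
qed

lemma arc_rest_real:
  assumes f: "miller m k f" and x: "pi / 2 \<le> x" "x \<le> 2 * pi / 3"
  shows "Im (arc_rest f k m (of_real x)) = 0"
  using arc_fun_real[OF assms] unfolding arc_rest_def phase_of_real by (simp add: cos_of_real)

lemma abs_Im_cos_le:
  assumes "\<bar>Im \<theta>\<bar> \<le> 1"
  shows "\<bar>Im (cos \<theta>)\<bar> \<le> 2 * \<bar>Im \<theta>\<bar>"
proof -
  have d: "exp t - exp (- t) \<le> 4 * t" "exp (- t) \<le> exp t" if "0 \<le> t" "t \<le> 1" for t :: real
  proof -
    have "exp t \<le> 1 + t + t^2" using that by (rule exp_bound)
    moreover have "t^2 \<le> t" using that by (simp add: power2_eq_square mult_left_le_one_le)
    moreover have "1 - t \<le> exp (- t)" using exp_ge_add_one_self[of "- t"] by simp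
    ultimately show "exp t - exp (- t) \<le> 4 * t" using that by linarith
    show "exp (- t) \<le> exp t" using that by simp
  qed
  have "\<bar>exp (- Im \<theta>) - exp (Im \<theta>)\<bar> \<le> 4 * \<bar>Im \<theta>\<bar>"
    using d[of "\<bar>Im \<theta>\<bar>"] assms by (cases "Im \<theta> \<ge> 0") auto
  then have "\<bar>sin (Re \<theta>)\<bar> * \<bar>exp (- Im \<theta>) - exp (Im \<theta>)\<bar> \<le> 1 * (4 * \<bar>Im \<theta>\<bar>)" by (intro mult_mono) auto
  then show ?thesis by (simp add: Im_cos abs_mult)
qed

text \<open>At a zero, the real part of the cosine bounds \<open>cos X\<close> and, as the remainder is real on the real axis, its
  imaginary part bounds \<open>sin X\<close> through the derivative of the remainder; both bounds together contradict
  \<open>cos^2 X + sin^2 X = 1\<close>.\<close>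

lemma arc_fun_nonzero_off_axis:
  assumes g: "arc_good m \<epsilon> k f" and \<epsilon>: "0 < \<epsilon>" "\<epsilon> < 1" and c2: "c2 < 1"
    and \<theta>: "pi / 2 \<le> Re \<theta>" "Re \<theta> \<le> 2 * pi / 3" "real k * \<bar>Im \<theta>\<bar> \<le> 4" "Im \<theta> \<noteq> 0"
    and c: "decay_arc k (Re \<theta>) + \<epsilon> \<le> c2" "sqrt 3 * decay_arc k (Re \<theta>) + \<epsilon> \<le> (1 - \<epsilon>) * sqrt 3 * c2"
  shows "arc_fun f k m \<theta> \<noteq> 0"
proof
  assume zero: "arc_fun f k m \<theta> = 0"
  define y where "y = \<bar>Im \<theta>\<bar>"
  have y: "y > 0" using \<theta>(4) by (simp add: y_def)
  have f: "miller m k f" and k: "400 \<le> k" "8 * pi * real m \<le> \<epsilon> * real k"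
    and R: "\<And>\<theta>. pi / 2 \<le> Re \<theta> \<Longrightarrow> Re \<theta> \<le> 2 * pi / 3 \<Longrightarrow> real k * \<bar>Im \<theta>\<bar> \<le> 4 \<Longrightarrow>
        norm (arc_rest f k m \<theta>) \<le> decay_arc k (Re \<theta>) + \<epsilon> \<and>
        norm (deriv (arc_rest f k m) \<theta>) \<le> real k / 2 * (sqrt 3 * decay_arc k (Re \<theta>) + \<epsilon>)"
    using g unfolding arc_good_def by blast+
  have k0: "real k \<ge> 400" using k(1) by simp
  have "400 * y \<le> real k * y" using k0 y by (intro mult_right_mono) auto
  then have y1: "y \<le> 1" using \<theta>(3) unfolding y_def by linarith
  define X where "X = Re (phase k m \<theta>)"
  define V where "V = Im (phase k m \<theta>)"
  have V: "real k / 2 * (1 - \<epsilon>) * y \<le> \<bar>V\<bar>"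
  proof -
    have e: "V = real k / 2 * Im \<theta> + 2 * pi * real m * Im (cos \<theta>)" unfolding V_def phase_def by simp
    have "2 * pi * real m * \<bar>Im (cos \<theta>)\<bar> \<le> 2 * pi * real m * (2 * y)"
      unfolding y_def by (intro mult_left_mono abs_Im_cos_le) (use y1 in \<open>auto simp: y_def\<close>)
    also have "\<dots> \<le> real k / 2 * \<epsilon> * y" using mult_right_mono[OF k(2), of "y / 2"] y by (simp add: mult_ac)
    finally have "\<bar>2 * pi * real m * Im (cos \<theta>)\<bar> \<le> real k / 2 * \<epsilon> * y" by (simp add: abs_mult)
    moreover have "\<bar>real k / 2 * Im \<theta>\<bar> = real k / 2 * y" by (simp add: abs_mult y_def)
    ultimately have "real k / 2 * y - real k / 2 * \<epsilon> * y \<le> \<bar>V\<bar>" unfolding e by linarith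
    then show ?thesis by (simp add: algebra_simps)
  qed
  have rest: "2 * cos (phase k m \<theta>) = - arc_rest f k m \<theta>" using zero unfolding arc_rest_def by simp
  have "\<bar>cos X\<bar> \<le> c2 / 2"
  proof -
    have "2 \<le> exp V + exp (- V)"
      using exp_ge_add_one_self[of V] exp_ge_add_one_self[of "- V"] by linarith
    then have "1 \<le> (exp V + exp (- V)) / 2" by simp
    then have "\<bar>cos X\<bar> * 1 \<le> \<bar>cos X\<bar> * ((exp V + exp (- V)) / 2)" by (intro mult_left_mono) auto
    also have "\<dots> = \<bar>Re (cos (phase k m \<theta>))\<bar>" unfolding Re_cos X_def V_def by (simp add: abs_mult)
    also have "2 * \<bar>Re (cos (phase k m \<theta>))\<bar> = \<bar>Re (2 * cos (phase k m \<theta>))\<bar>" by simp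
    finally have "2 * \<bar>cos X\<bar> \<le> \<bar>Re (2 * cos (phase k m \<theta>))\<bar>" by simp
    also have "\<dots> \<le> norm (arc_rest f k m \<theta>)" unfolding rest using abs_Re_le_cmod[of "- arc_rest f k m \<theta>"] by simp
    also have "\<dots> \<le> c2" using R[OF \<theta>(1-3)] c(1) by linarith
    finally show ?thesis by simp
  qed
  then have cosX: "(cos X)^2 \<le> (c2 / 2)^2" by (metis abs_ge_zero power2_abs power_mono)
  have "\<bar>sin X\<bar> \<le> sqrt 3 * c2 / 2"
  proof -
    have "norm (arc_rest f k m \<theta> - arc_rest f k m (of_real (Re \<theta>)))
       \<le> real k / 2 * (sqrt 3 * decay_arc k (Re \<theta>) + \<epsilon>) * norm (\<theta> - of_real (Re \<theta>))"
    proof (rule field_differentiable_bound[OF convex_closed_segment])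
      fix w assume "w \<in> closed_segment (of_real (Re \<theta>)) \<theta>"
      then obtain u where u: "0 \<le> u" "u \<le> 1" and w: "w = (1 - u) *\<^sub>R of_real (Re \<theta>) + u *\<^sub>R \<theta>"
        by (auto simp: closed_segment_def)
      have Rw: "Re w = Re \<theta>" unfolding w by (simp add: algebra_simps)
      have "\<bar>Im w\<bar> \<le> \<bar>Im \<theta>\<bar>" unfolding w using u by (simp add: abs_mult mult_left_le_one_le)
      then have "real k * \<bar>Im w\<bar> \<le> 4" using \<theta>(3) by (meson mult_left_mono of_nat_0_le_iff order_trans)
      then show "norm (deriv (arc_rest f k m) w) \<le> real k / 2 * (sqrt 3 * decay_arc k (Re \<theta>) + \<epsilon>)"
        using R[of w] \<theta>(1,2) Rw by simp
      have "w \<in> strip" by (rule box_strip) (use \<theta> Rw in auto)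
      then show "(arc_rest f k m has_field_derivative deriv (arc_rest f k m) w) (at w within closed_segment (of_real (Re \<theta>)) \<theta>)"
        by (rule has_field_derivative_at_within[OF holomorphic_derivI[OF
            arc_rest_holomorphic[OF modular_formD(1)[OF miller_modular[OF f]]] open_strip]])
    qed auto
    also have "norm (\<theta> - of_real (Re \<theta>)) = y"
    proof -
      have "\<theta> - of_real (Re \<theta>) = \<i> * of_real (Im \<theta>)" by (simp add: complex_eq_iff)
      then show ?thesis by (simp add: y_def norm_mult)
    qed
    finally have n: "norm (arc_rest f k m \<theta> - arc_rest f k m (of_real (Re \<theta>))) \<le> real k / 2 * (sqrt 3 * decay_arc k (Re \<theta>) + \<epsilon>) * y" .
    have "\<bar>Im (arc_rest f k m \<theta>)\<bar> = \<bar>Im (arc_rest f k m \<theta> - arc_rest f k m (of_real (Re \<theta>)))\<bar>"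
      using arc_rest_real[OF f \<theta>(1,2)] by simp
    also have "\<dots> \<le> real k / 2 * (sqrt 3 * decay_arc k (Re \<theta>) + \<epsilon>) * y"
      by (rule order_trans[OF abs_Im_le_cmod n])
    also have "\<dots> \<le> real k / 2 * ((1 - \<epsilon>) * sqrt 3 * c2) * y"
      using c(2) y by (intro mult_right_mono mult_left_mono) auto
    finally have 1: "\<bar>Im (arc_rest f k m \<theta>)\<bar> \<le> real k / 2 * ((1 - \<epsilon>) * sqrt 3 * c2) * y" .
    \<comment> \<open>\<open>|sinh V| \<ge> |V|\<close>, and \<open>|V|\<close> is at least
      \<open>k / 2 * (1 - \<epsilon>) * y\<close>. Both sides are then proportional to
      \<open>y\<close>, which cancels.\<close>
    have "\<bar>V\<bar> \<le> \<bar>(exp V - inverse (exp V)) / 2\<bar>" by (rule real_le_abs_sinh)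
    then have "\<bar>sin X\<bar> * \<bar>V\<bar> \<le> \<bar>sin X\<bar> * \<bar>(exp V - inverse (exp V)) / 2\<bar>" by (intro mult_left_mono) auto
    also have "\<dots> = \<bar>Im (cos (phase k m \<theta>))\<bar>"
      unfolding Im_cos X_def V_def by (simp add: abs_mult exp_minus abs_minus_commute)
    finally have "2 * (\<bar>sin X\<bar> * \<bar>V\<bar>) \<le> \<bar>Im (2 * cos (phase k m \<theta>))\<bar>" by simp
    then have 2: "2 * (\<bar>sin X\<bar> * \<bar>V\<bar>) \<le> \<bar>Im (arc_rest f k m \<theta>)\<bar>" unfolding rest by simp
    have "2 * (\<bar>sin X\<bar> * (real k / 2 * (1 - \<epsilon>) * y)) \<le> 2 * (\<bar>sin X\<bar> * \<bar>V\<bar>)"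
      using V by (intro mult_left_mono) auto
    then have "2 * (\<bar>sin X\<bar> * (real k / 2 * (1 - \<epsilon>) * y)) \<le> real k / 2 * ((1 - \<epsilon>) * sqrt 3 * c2) * y"
      using 1 2 by linarith
    moreover have "real k / 2 * ((1 - \<epsilon>) * sqrt 3 * c2) * y = (sqrt 3 * c2) * (real k / 2 * (1 - \<epsilon>) * y)" by simp
    ultimately have "(2 * \<bar>sin X\<bar>) * (real k / 2 * (1 - \<epsilon>) * y) \<le> (sqrt 3 * c2) * (real k / 2 * (1 - \<epsilon>) * y)"
      by (simp only: mult.assoc)
    moreover have "real k / 2 * (1 - \<epsilon>) * y > 0" using k0 \<epsilon> y by (intro mult_pos_pos) auto
    ultimately have "2 * \<bar>sin X\<bar> \<le> sqrt 3 * c2" by (rule mult_right_le_imp_le)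
    then show ?thesis by simp
  qed
  then have "(sin X)^2 \<le> (sqrt 3 * c2 / 2)^2" by (metis abs_ge_zero power2_abs power_mono)
  then have "(sin X)^2 \<le> 3 * c2^2 / 4" by (simp add: power_divide power_mult_distrib)
  moreover have "(cos X)^2 \<le> c2^2 / 4" using cosX by (simp add: power_divide)
  ultimately have "1 \<le> c2^2" using sin_cos_squared_add[of X] by linarith
  moreover have "c2 \<ge> 0" using c(1) decay_arc_pos[of k "Re \<theta>"] \<epsilon> by linarith
  then have "c2^2 < 1" using c2 by (simp add: power_less_one_iff abs_square_less_1)
  ultimately show False by simp
qed

lemma real_phase_deriv: "(real_phase k m has_real_derivative (real k / 2 - 2 * pi * real m * sin x)) (at x)"
  unfolding real_phase_def[abs_def] by (auto intro!: derivative_eq_intros)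

lemma real_phase_deriv_ge:
  assumes "arc_good m \<epsilon> k f"
  shows "real k / 2 * (1 - \<epsilon>) \<le> real k / 2 - 2 * pi * real m * sin x"
proof -
  have "2 * pi * real m * sin x \<le> 2 * pi * real m * 1" by (intro mult_left_mono) auto
  also have "\<dots> \<le> real k / 2 * \<epsilon>"
  proof -
    have "8 * pi * real m \<le> \<epsilon> * real k" using assms unfolding arc_good_def by blast
    moreover have "4 * pi * real m \<le> 8 * pi * real m" by simp
    ultimately have "4 * pi * real m \<le> \<epsilon> * real k" by linarith
    then show ?thesis by (simp add: mult_ac)
  qed
  finally show ?thesis unfolding right_diff_distrib by simp
qed

lemma real_phase_strict_mono:
  assumes g: "arc_good m \<epsilon> k f" and \<epsilon>: "\<epsilon> < 1" and xy: "x < y"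
  shows "real_phase k m x < real_phase k m y"
proof (rule DERIV_pos_imp_increasing[OF xy])
  fix t
  have "real k / 2 * (1 - \<epsilon>) > 0" using g \<epsilon> unfolding arc_good_def by simp
  then show "\<exists>d. (real_phase k m has_real_derivative d) (at t) \<and> 0 < d"
    using real_phase_deriv[of k m t] real_phase_deriv_ge[OF g, of t] by (intro exI conjI) (assumption, linarith)
qed

definition real_arc_fun :: "(complex \<Rightarrow> complex) \<Rightarrow> nat \<Rightarrow> nat \<Rightarrow> real \<Rightarrow> real" where
  "real_arc_fun f k m x = Re (arc_fun f k m (of_real x))"

lemma arc_zero_iff:
  assumes f: "miller m k f" and x: "pi / 2 \<le> x" "x \<le> 2 * pi / 3"
  shows "f (exp (\<i> * of_real x)) = 0 \<longleftrightarrow> real_arc_fun f k m x = 0"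
proof -
  have "f (exp (\<i> * of_real x)) = 0 \<longleftrightarrow> arc_fun f k m (of_real x) = 0" by (simp add: arc_fun_def)
  then show ?thesis using arc_fun_real[OF assms] by (simp add: real_arc_fun_def complex_eq_iff[of _ 0])
qed

lemma real_arc_fun_eq: "real_arc_fun f k m x = 2 * cos (real_phase k m x) + Re (arc_rest f k m (of_real x))"
  unfolding real_arc_fun_def arc_rest_def phase_of_real by (simp add: cos_of_real)

lemma real_arc_fun_deriv:
  assumes f: "miller m k f" and x: "pi / 2 \<le> x" "x \<le> 2 * pi / 3"
  shows "(real_arc_fun f k m has_real_derivative
     (- 2 * sin (real_phase k m x) * (real k / 2 - 2 * pi * real m * sin x) + Re (deriv (arc_rest f k m) (of_real x)))) (at x)"
proof -
  have st: "complex_of_real x \<in> strip" by (rule box_strip) (use x in auto)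
  have "(arc_rest f k m has_field_derivative deriv (arc_rest f k m) (of_real x)) (at (of_real x))"
    by (rule holomorphic_derivI[OF arc_rest_holomorphic[OF modular_formD(1)[OF miller_modular[OF f]]] open_strip st])
  then have "((\<lambda>x. arc_rest f k m (of_real x)) has_vector_derivative deriv (arc_rest f k m) (of_real x)) (at x)"
    by (rule has_vector_derivative_real_field)
  then have 1: "((\<lambda>x. Re (arc_rest f k m (of_real x))) has_real_derivative Re (deriv (arc_rest f k m) (of_real x))) (at x)"
    by (rule has_field_derivative_Re)
  have "((\<lambda>x. 2 * cos (real_phase k m x)) has_real_derivative
     - 2 * sin (real_phase k m x) * (real k / 2 - 2 * pi * real m * sin x)) (at x)"
    by (rule derivative_eq_intros real_phase_deriv refl | simp)+
  from DERIV_add[OF this 1] show ?thesis unfolding real_arc_fun_eq[abs_def] .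
qed

text \<open>By the Cauchy-Schwarz inequality the derivative of the ratio \<open>arc_fun / sin(phase)\<close> is negative,
  since the remainder and its derivative are bounded by \<open>c\<close> and \<open>sqrt 3 c\<close> times the natural scales, with \<open>c < 1\<close>.\<close>

lemma wronskian_neg:
  assumes g: "arc_good m \<epsilon> k f" and \<epsilon>: "0 < \<epsilon>" "\<epsilon> < 1" and c2: "c2 < 1"
    and x: "pi / 2 \<le> x" "x \<le> 2 * pi / 3"
    and c: "decay_arc k x + \<epsilon> \<le> c2" "sqrt 3 * decay_arc k x + \<epsilon> \<le> (1 - \<epsilon>) * sqrt 3 * c2"
  defines "P \<equiv> real_phase k m x" and "d \<equiv> real k / 2 - 2 * pi * real m * sin x"
  shows "(- 2 * sin P * d + Re (deriv (arc_rest f k m) (of_real x))) * sin P - real_arc_fun f k m x * (cos P * d) < 0"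
    and "\<bar>Re (arc_rest f k m (of_real x))\<bar> \<le> c2"
proof -
  define n where "n = Re (arc_rest f k m (of_real x))"
  define n' where "n' = Re (deriv (arc_rest f k m) (of_real x))"
  have R: "norm (arc_rest f k m (of_real x)) \<le> decay_arc k x + \<epsilon>"
    "norm (deriv (arc_rest f k m) (of_real x)) \<le> real k / 2 * (sqrt 3 * decay_arc k x + \<epsilon>)"
    using g x unfolding arc_good_def by (auto dest!: spec[of _ "complex_of_real x"])
  have n: "\<bar>n\<bar> \<le> c2" unfolding n_def using R(1) c(1) abs_Re_le_cmod order_trans by metis
  then show "\<bar>Re (arc_rest f k m (of_real x))\<bar> \<le> c2" by (simp add: n_def)
  have c20: "c2 > 0" using c(1) decay_arc_pos[of k x] \<epsilon> by linarith
  have d: "real k / 2 * (1 - \<epsilon>) \<le> d" unfolding d_def by (rule real_phase_deriv_ge[OF g])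
  have "real k / 2 * (1 - \<epsilon>) > 0" using g \<epsilon> unfolding arc_good_def by simp
  then have d0: "d > 0" using d by linarith
  have "\<bar>n'\<bar> \<le> real k / 2 * (sqrt 3 * decay_arc k x + \<epsilon>)"
    unfolding n'_def by (rule order_trans[OF abs_Re_le_cmod R(2)])
  also have "\<dots> \<le> real k / 2 * ((1 - \<epsilon>) * sqrt 3 * c2)" using c(2) by (intro mult_left_mono) auto
  also have "\<dots> = (real k / 2 * (1 - \<epsilon>)) * (sqrt 3 * c2)" by simp
  also have "\<dots> \<le> d * (sqrt 3 * c2)" using d c20 by (intro mult_right_mono) auto
  finally have n': "\<bar>n'\<bar> \<le> d * (sqrt 3 * c2)" .
  have "(n' * sin P - n * d * cos P)^2 \<le> n'^2 + (n * d)^2"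
  proof -
    have "(a * s - b * c)^2 + (a * c + b * s)^2 = (a^2 + b^2) * (s^2 + c^2)" for a b s c :: real
      by (simp add: power2_eq_square algebra_simps)
    from this[of n' "sin P" "n * d" "cos P"]
    have "(n' * sin P - n * d * cos P)^2 + (n' * cos P + n * d * sin P)^2 = (n'^2 + (n * d)^2) * ((sin P)^2 + (cos P)^2)" .
    moreover have "(n' * cos P + n * d * sin P)^2 \<ge> 0" by simp
    ultimately show ?thesis unfolding sin_cos_squared_add mult_1_right by linarith
  qed
  also have "\<dots> \<le> (d * (sqrt 3 * c2))^2 + (c2 * d)^2"
  proof (rule add_mono)
    show "n'^2 \<le> (d * (sqrt 3 * c2))^2" using n' by (metis abs_ge_zero power2_abs power_mono)
    have "\<bar>n * d\<bar> \<le> c2 * d" using n d0 by (simp add: abs_mult)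
    then show "(n * d)^2 \<le> (c2 * d)^2" by (metis abs_ge_zero power2_abs power_mono)
  qed
  \<comment> \<open>\<open>3 + 1 = 4\<close>: derivative and value bounds combine to exactly the
    \<open>2 d\<close> of the cosine, and only the factor \<open>c2 < 1\<close> makes the inequality
    strict.\<close>
  also have "\<dots> = (2 * c2 * d)^2" by (simp add: power_mult_distrib)
  finally have "n' * sin P - n * d * cos P \<le> 2 * c2 * d" by (rule power2_le_imp_le) (use c20 d0 in auto)
  also have "\<dots> < 2 * d" using c2 d0 by simp
  finally have lt: "n' * sin P - n * d * cos P < 2 * d" .
  have "(- 2 * s * d + a) * s - (2 * c + b) * (c * d) = - 2 * d * (s^2 + c^2) + (a * s - b * d * c)" for a b s c :: real
    by (simp add: power2_eq_square algebra_simps)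
  then have "(- 2 * sin P * d + n') * sin P - (2 * cos P + n) * (cos P * d) = - 2 * d * ((sin P)^2 + (cos P)^2) + (n' * sin P - n * d * cos P)" .
  also have "\<dots> < 0" using lt by simp
  finally show "(- 2 * sin P * d + Re (deriv (arc_rest f k m) (of_real x))) * sin P - real_arc_fun f k m x * (cos P * d) < 0"
    unfolding real_arc_fun_eq n_def n'_def P_def .
qed

lemma sin_nonzero_between:
  assumes "of_int j * pi < t" "t < (of_int j + 1) * pi"
  shows "sin t \<noteq> (0 :: real)"
proof
  assume "sin t = 0"
  then obtain i :: int where t: "t = of_int i * pi" by (auto simp: sin_zero_iff_int2)
  have "real_of_int j < of_int i" "real_of_int i < of_int (j + 1)"
    using assms unfolding t by (simp_all add: mult_less_cancel_right_pos)
  then have "j < i" "i < j + 1" unfolding of_int_less_iff .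
  then show False by simp
qed

text \<open>Inside a cell \<open>sin\<close> of the phase has no zero, and the quotient of
  \<open>real_arc_fun\<close> by it is strictly decreasing, hence vanishes at most once. Bounds at
  the right end \<open>x2\<close> suffice, as \<open>decay_arc\<close> increases towards the
  corner.\<close>

lemma zeros_in_same_cell:
  assumes g: "arc_good m \<epsilon> k f" and \<epsilon>: "0 < \<epsilon>" "\<epsilon> < 1" and c2: "c2 < 1"
    and x: "pi / 2 \<le> x1" "x1 < x2" "x2 \<le> 2 * pi / 3"
    and c: "decay_arc k x2 + \<epsilon> \<le> c2" "sqrt 3 * decay_arc k x2 + \<epsilon> \<le> (1 - \<epsilon>) * sqrt 3 * c2"
    and z: "real_arc_fun f k m x1 = 0" "real_arc_fun f k m x2 = 0"
  shows "\<lfloor>real_phase k m x1 / pi\<rfloor> \<noteq> \<lfloor>real_phase k m x2 / pi\<rfloor>"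
proof
  assume eq: "\<lfloor>real_phase k m x1 / pi\<rfloor> = \<lfloor>real_phase k m x2 / pi\<rfloor>"
  define j where "j = \<lfloor>real_phase k m x1 / pi\<rfloor>"
  have f: "miller m k f" using g by (simp add: arc_good_def)
  have cx: "decay_arc k t + \<epsilon> \<le> c2" "sqrt 3 * decay_arc k t + \<epsilon> \<le> (1 - \<epsilon>) * sqrt 3 * c2" if "t \<le> x2" for t
  proof -
    have "real k * (2 * pi / 3 - x2) \<le> real k * (2 * pi / 3 - t)" using that by (intro mult_left_mono) auto
    then have d: "decay_arc k t \<le> decay_arc k x2" by (simp add: decay_arc_def)
    then have "sqrt 3 * decay_arc k t \<le> sqrt 3 * decay_arc k x2" by (intro mult_left_mono) auto
    with d c show "decay_arc k t + \<epsilon> \<le> c2" "sqrt 3 * decay_arc k t + \<epsilon> \<le> (1 - \<epsilon>) * sqrt 3 * c2" by linarith+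
  qed
  \<comment> \<open>Where the sine vanishes the cosine term has modulus 2, and a remainder below 1
    cannot cancel it. So \<open>x1\<close> is not the left end of its cell.\<close>
  have "sin (real_phase k m x1) \<noteq> 0"
  proof
    assume s: "sin (real_phase k m x1) = 0"
    then have "\<bar>cos (real_phase k m x1)\<bar> = 1" using sin_zero_abs_cos_one by blast
    moreover have "\<bar>Re (arc_rest f k m (of_real x1))\<bar> \<le> c2"
      by (rule wronskian_neg(2)[OF g \<epsilon> c2 _ _ cx]) (use x in auto)
    ultimately show False using z(1) c2 unfolding real_arc_fun_eq by linarith
  qed
  then have "real_phase k m x1 \<noteq> of_int j * pi" by (metis sin_zero_iff_int2)
  moreover have "of_int j * pi \<le> real_phase k m x1"
  proof -
    have "of_int j \<le> real_phase k m x1 / pi" unfolding j_def by (rule of_int_floor_le)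
    then show ?thesis by (simp add: pos_le_divide_eq)
  qed
  ultimately have lo: "of_int j * pi < real_phase k m x1" by simp
  have hi: "real_phase k m x2 < (of_int j + 1) * pi"
  proof -
    have "real_phase k m x2 / pi < of_int j + 1" unfolding j_def eq by (rule real_of_int_floor_add_one_gt)
    then show ?thesis by (simp add: pos_divide_less_eq)
  qed
  have sn: "sin (real_phase k m t) \<noteq> 0" if "x1 \<le> t" "t \<le> x2" for t
  proof (rule sin_nonzero_between)
    show "of_int j * pi < real_phase k m t"
      using lo real_phase_strict_mono[OF g \<epsilon>(2), of x1 t] that by (cases "x1 = t") auto
    show "real_phase k m t < (of_int j + 1) * pi"
      using hi real_phase_strict_mono[OF g \<epsilon>(2), of t x2] that by (cases "t = x2") auto
  qed
  have "(\<lambda>t. real_arc_fun f k m t / sin (real_phase k m t)) x1 > (\<lambda>t. real_arc_fun f k m t / sin (real_phase k m t)) x2"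
  proof (rule DERIV_neg_imp_decreasing[OF x(2)])
    fix t assume t: "x1 \<le> t" "t \<le> x2"
    define P where "P = real_phase k m t"
    define d where "d = real k / 2 - 2 * pi * real m * sin t"
    define h' where "h' = - 2 * sin P * d + Re (deriv (arc_rest f k m) (of_real t))"
    have tr: "pi / 2 \<le> t" "t \<le> 2 * pi / 3" using t x by auto
    have 1: "(real_arc_fun f k m has_real_derivative h') (at t)"
      unfolding h'_def P_def d_def by (rule real_arc_fun_deriv[OF f tr])
    have 2: "((\<lambda>t. sin (real_phase k m t)) has_real_derivative (cos P * d)) (at t)"
      unfolding P_def d_def by (rule DERIV_chain2[OF DERIV_sin real_phase_deriv])
    have s: "sin P \<noteq> 0" unfolding P_def by (rule sn[OF t])
    have "((\<lambda>t. real_arc_fun f k m t / sin (real_phase k m t)) has_real_derivative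
       (h' * sin P - real_arc_fun f k m t * (cos P * d)) / (sin P * sin P)) (at t)"
      unfolding P_def by (rule DERIV_divide[OF 1 2[unfolded P_def]]) (use s in \<open>simp add: P_def\<close>)
    moreover have "h' * sin P - real_arc_fun f k m t * (cos P * d) < 0"
      unfolding h'_def P_def d_def by (rule wronskian_neg(1)[OF g \<epsilon> c2 tr cx[OF t(2)]])
    then have "(h' * sin P - real_arc_fun f k m t * (cos P * d)) / (sin P * sin P) < 0"
      using s by (intro divide_neg_pos) (auto simp: zero_less_mult_iff)
    ultimately show "\<exists>y. ((\<lambda>t. real_arc_fun f k m t / sin (real_phase k m t)) has_real_derivative y) (at t) \<and> y < 0" by blast
  qed
  then show False using z by simp
qed

text \<open>At a zero the Wronskian reduces to the derivative of \<open>real_arc_fun\<close> times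
  the sine of the phase. A vanishing derivative of \<open>f\<close> would make it 0, whereas it is
  negative.\<close>

lemma simple_zero_on_arc:
  assumes g: "arc_good m \<epsilon> k f" and \<epsilon>: "0 < \<epsilon>" "\<epsilon> < 1" and c2: "c2 < 1"
    and x: "pi / 2 \<le> x" "x \<le> 2 * pi / 3"
    and c: "decay_arc k x + \<epsilon> \<le> c2" "sqrt 3 * decay_arc k x + \<epsilon> \<le> (1 - \<epsilon>) * sqrt 3 * c2"
    and z: "f (exp (\<i> * of_real x)) = 0"
  shows "zorder f (exp (\<i> * of_real x)) = 1"
proof -
  have f: "miller m k f" using g by (simp add: arc_good_def)
  define w where "w = exp (\<i> * complex_of_real x)"
  have st: "complex_of_real x \<in> strip" by (rule box_strip) (use x in auto)
  have wH: "w \<in> upper_half_plane" using Im_exp_ii_pos[OF st] by (simp add: w_def upper_half_plane_def)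
  have opH: "open upper_half_plane" unfolding upper_half_plane_def by (rule open_halfspace_Im_gt)
  have hol: "f holomorphic_on upper_half_plane" by (rule modular_formD(1)[OF miller_modular[OF f]])
  have rz: "real_arc_fun f k m x = 0" using z arc_zero_iff[OF f x] by simp
  have "deriv f w \<noteq> 0"
  proof
    assume d0: "deriv f w = 0"
    define E where "E = (\<lambda>\<theta>. exp (\<i> * of_nat k * \<theta> / 2 + 2 * of_real pi * of_nat m * sin \<theta>))"
    have "(f has_field_derivative 0) (at w)" using holomorphic_derivI[OF hol opH wH] d0 by simp
    then have "((\<lambda>\<theta>. f (exp (\<i> * \<theta>))) has_field_derivative 0 * (exp (\<i> * of_real x) * \<i>)) (at (of_real x))"
      unfolding w_def by (rule DERIV_chain2) (auto intro!: derivative_eq_intros)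
    moreover have "E field_differentiable at (of_real x)"
    proof -
      have "E holomorphic_on UNIV" unfolding E_def by (intro holomorphic_intros) auto
      then show ?thesis by (simp add: holomorphic_on_open field_differentiable_def)
    qed
    then obtain E' where "(E has_field_derivative E') (at (of_real x))" by (auto simp: field_differentiable_def)
    ultimately have "((\<lambda>\<theta>. E \<theta> * f (exp (\<i> * \<theta>))) has_field_derivative
       (E' * f (exp (\<i> * of_real x)) + 0 * (exp (\<i> * of_real x) * \<i>) * E (of_real x))) (at (of_real x))"
      by (intro DERIV_mult)
    then have "(arc_fun f k m has_field_derivative 0) (at (of_real x))"
      using z by (simp add: arc_fun_def[abs_def] E_def)
    then have "((\<lambda>x. arc_fun f k m (of_real x)) has_vector_derivative 0) (at x)" by (rule has_vector_derivative_real_field)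
    then have "(real_arc_fun f k m has_real_derivative Re 0) (at x)"
      unfolding real_arc_fun_def[abs_def] by (rule has_field_derivative_Re)
    from DERIV_unique[OF real_arc_fun_deriv[OF f x] this]
    have "- 2 * sin (real_phase k m x) * (real k / 2 - 2 * pi * real m * sin x) + Re (deriv (arc_rest f k m) (of_real x)) = 0" by simp
    with wronskian_neg(1)[OF g \<epsilon> c2 x c] rz show False by simp
  qed
  then show ?thesis unfolding w_def[symmetric]
    by (intro zorder_zero_eqI[OF hol opH wH]) (use z in \<open>auto simp: w_def\<close>)
qed

section \<open>Zeros away from the arc\<close>

text \<open>Write \<open>f = q^m (1 + G q)\<close> with \<open>G\<close> holomorphic at the cusp. By
  the maximum principle \<open>|G|\<close> above height 2 is at most its maximum on that line, where
  \<open>f - q^m\<close> is exponentially small.\<close>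

lemma eventually_no_zeros_above:
  "\<forall>\<^sub>F k in sequentially. \<forall>f. miller m k f \<longrightarrow> (\<forall>z. Im z \<ge> 2 \<longrightarrow> f z \<noteq> 0)"
proof -
  have "\<forall>\<^sub>F k in sequentially. decay k * exp (real k / 100 + 4 * pi * real m) < 1 / 2"
    by (intro order_tendstoD(2)[OF decay_exp_tendsto]) simp
  then show ?thesis
  proof eventually_elim
    case (elim k)
    show ?case
    proof (intro allI impI)
      fix f z assume f: "miller m k f" and z: "Im z \<ge> 2"
      obtain l k' where m: "1 \<le> m" "m \<le> l" and mf: "miller_form k l m f" using f by (auto simp: miller_def)
      obtain g where g: "g holomorphic_on ball 0 1"
        and fg: "\<And>z. Im z > 0 \<Longrightarrow> f z = nome z ^ m + nome z ^ (l + 1) * g (nome z)"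
        using miller_form_factor[OF mf m(2)] by blast
      define G where "G = (\<lambda>q. q ^ (l + 1 - m) * g q)"
      have G: "G holomorphic_on ball 0 1" unfolding G_def by (intro holomorphic_intros g)
      have fG: "f z = nome z ^ m * (1 + G (nome z))" if "Im z > 0" for z
      proof -
        have "nome z ^ (l + 1) = nome z ^ m * nome z ^ (l + 1 - m)" using m by (simp flip: power_add)
        then show ?thesis unfolding fg[OF that] G_def by (simp add: algebra_simps)
      qed
      obtain z1 where z1: "Im z1 = 2" "\<bar>Re z1\<bar> \<le> 1/2"
        and mx: "\<And>q. norm q \<le> exp (- 2 * pi * 2) \<Longrightarrow> norm (G q) \<le> norm (G (nome z1))"
        using disc_maximum[OF G, of 2] by auto
      have nq: "norm (nome z1 ^ m) = exp (- (4 * pi * real m))"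
        unfolding norm_power norm_nome z1 exp_of_nat_mult[symmetric] by (simp add: mult_ac)
      have k2: "k \<ge> 2" using miller_ge_12[OF f] by simp
      have "norm (nome z1 ^ m) * norm (G (nome z1)) = norm (f z1 - nome z1 ^ m)"
        using fG[of z1] z1 by (simp add: algebra_simps flip: norm_mult)
      also have "\<dots> \<le> norm (f z1 - nome z1 ^ m - slash_series k m z1) + norm (slash_series k m z1)"
        using norm_triangle_ineq[of "f z1 - nome z1 ^ m - slash_series k m z1" "slash_series k m z1"] by simp
      also have "\<dots> \<le> 1600 * (real k + 1) * exp (- (real k / 50)) + 35 / 2 ^ k"
        using z1 by (intro add_mono miller_approximation[OF f] slash_series_bound_at_2[OF _ _ k2]) auto
      also have "35 / 2 ^ k \<le> 35 * (real k + 1) * exp (- (real k / 50))"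
      proof -
        have "35 / 2 ^ k \<le> 35 * exp (- (69/100) * real k)" using two_power_le[of k] by simp
        also have "\<dots> \<le> 35 * 1 * exp (- (real k / 50))" by simp
        also have "\<dots> \<le> 35 * (real k + 1) * exp (- (real k / 50))" by (intro mult_right_mono) auto
        finally show ?thesis .
      qed
      also have "1600 * (real k + 1) * exp (- (real k / 50)) + 35 * (real k + 1) * exp (- (real k / 50)) \<le> 2 * decay k"
        unfolding decay_def by (simp flip: distrib_right)
      finally have "exp (- (4 * pi * real m)) * norm (G (nome z1)) \<le> 2 * decay k" unfolding nq by simp
      then have "exp (4 * pi * real m) * (exp (- (4 * pi * real m)) * norm (G (nome z1))) \<le> exp (4 * pi * real m) * (2 * decay k)"
        by (rule mult_left_mono) simp
      moreover have "exp (4 * pi * real m) * (exp (- (4 * pi * real m)) * norm (G (nome z1))) = norm (G (nome z1))"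
        by (simp add: exp_minus)
      moreover have "exp (4 * pi * real m) * (2 * decay k) = 2 * (decay k * exp (4 * pi * real m))" by simp
      ultimately have "norm (G (nome z1)) \<le> 2 * (decay k * exp (4 * pi * real m))" by simp
      also have "\<dots> \<le> 2 * (decay k * exp (real k / 100 + 4 * pi * real m))"
        using decay_nonneg[of k] by (intro mult_left_mono) auto
      also have "\<dots> < 1" using elim by simp
      finally have "norm (G (nome z1)) < 1" .
      moreover have "norm (G (nome z)) \<le> norm (G (nome z1))" by (rule mx) (use z in \<open>simp add: norm_nome\<close>)
      ultimately have "norm (G (nome z)) < 1" by linarith
      then have "1 + G (nome z) \<noteq> 0" by (metis add_eq_0_iff less_irrefl norm_minus_cancel norm_one)
      then show "f z \<noteq> 0" using fG[of z] z by simp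
    qed
  qed
qed

text \<open>Passing to \<open>- 1 / w\<close> lowers the imaginary part and enlarges the
  \<open>nome\<close> factor by at most \<open>exp (8 \<pi> m ln |w|)\<close>. The condition on
  \<open>k\<close> lets one half of the power \<open>|w|^(-k)\<close> absorb this.\<close>

lemma norm_inverted_term_le:
  assumes w: "norm w \<ge> 1" "0 < Im w" "Im w \<le> 2" and z: "Im z = Im w" and k: "16 * pi * real m \<le> real k"
  shows "norm (nome (- of_nat m / w) / w ^ k) \<le> norm (nome z ^ m) * exp (- (real k * ln (norm w) / 2))"
proof -
  define L where "L = ln (norm w)"
  have L: "L \<ge> 0" using w by (simp add: L_def)
  have nw: "norm w = exp L" using w(1) unfolding L_def by (subst exp_ln) auto
  have I: "Im (of_nat m * u) = real m * Im u" for u by simp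
  have "- of_nat m / w = of_nat m * (- 1 / w)" by simp
  then have "Im (- of_nat m / w) = real m * (Im w / (norm w)^2)" by (simp only: I Im_minus_inverse)
  also have "Im w / (norm w)^2 = Im w * exp (- (2 * L))"
    unfolding nw by (simp add: exp_minus divide_inverse exp_double)
  finally have "norm (nome (- of_nat m / w)) = exp (- 2 * pi * (real m * (Im w * exp (- (2 * L)))))"
    unfolding norm_nome by simp
  moreover have "norm (w ^ k) = exp (real k * L)" unfolding norm_power nw by (simp add: exp_of_nat_mult)
  ultimately have "norm (nome (- of_nat m / w) / w ^ k) = exp (- 2 * pi * (real m * (Im w * exp (- (2 * L)))) - real k * L)"
    by (simp add: norm_divide exp_diff)
  also have "\<dots> \<le> exp (- 2 * pi * real m * Im w - real k * L / 2)"
  proof -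
    have "1 - exp (- (2 * L)) \<le> 2 * L" using exp_ge_add_one_self[of "- (2 * L)"] by simp
    then have "Im w * (1 - exp (- (2 * L))) \<le> 2 * (2 * L)" using w L by (intro mult_mono) auto
    then have "2 * pi * real m * (Im w * (1 - exp (- (2 * L)))) \<le> 2 * pi * real m * (2 * (2 * L))" by (intro mult_left_mono) auto
    also have "\<dots> \<le> real k * L / 2" using mult_right_mono[OF k, of "L / 2"] L by (simp add: mult_ac)
    finally show ?thesis by (simp add: algebra_simps)
  qed
  also have "\<dots> = exp (- 2 * pi * real m * Im w) * exp (- (real k * L / 2))" by (simp flip: exp_add)
  also have "exp (- 2 * pi * real m * Im w) = norm (nome z ^ m)"
    unfolding norm_power norm_nome z exp_of_nat_mult[symmetric] by (simp add: mult_ac)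
  finally show ?thesis unfolding L_def .
qed

text \<open>Otherwise both inverted terms are at most \<open>1/5\<close> of \<open>|q^m|\<close>, by
  \<open>exp (- 2) \<le> 1/5\<close> and by \<open>|z + 1| \<ge> |z|\<close> for
  \<open>Re z \<ge> - 1/2\<close>, and the error is at most half of it. Since
  \<open>1/5 + 1/5 + 1/2 < 1\<close>, they cannot cancel \<open>q^m\<close>.\<close>

lemma zero_near_arc:
  assumes f: "miller m k f" and k: "16 * pi * real m \<le> real k"
    and d: "decay k * exp (4 * pi * real m) \<le> 1 / 2"
    and z: "norm z \<ge> 1" "- 1 / 2 \<le> Re z" "Re z \<le> 0" "0 < Im z" "Im z \<le> 2" and fz: "f z = 0"
  shows "real k * ln (norm z) < 4"
proof (rule ccontr)
  assume "\<not> real k * ln (norm z) < 4"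
  then have L: "real k * ln (norm z) \<ge> 4" by simp
  have "(Re z)^2 \<le> (1/2)^2" using z by (intro power2_le_iff_abs_le[THEN iffD2]) auto
  moreover have "1 \<le> (Re z)^2 + (Im z)^2" using z(1) by (metis cmod_power2 one_le_power)
  ultimately have "(4/5)^2 \<le> (Im z)^2" by (simp add: power2_eq_square)
  then have I: "4/5 \<le> Im z" by (rule power2_le_imp_le) (use z in simp)
  have "norm z \<le> norm (z + 1)"
  proof (rule power2_le_imp_le)
    show "(norm z)^2 \<le> (norm (z + 1))^2" unfolding cmod_power2 using z by (simp add: power2_eq_square algebra_simps)
  qed simp
  have e: "exp (- (real k * ln (norm w) / 2)) \<le> 1 / 5" if "norm z \<le> norm w" for w
  proof -
    have "ln (norm z) \<le> ln (norm w)" using that z by (subst ln_le_cancel_iff) auto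
    then have "real k * ln (norm z) \<le> real k * ln (norm w)" by (rule mult_left_mono) simp
    then have "real k * ln (norm w) \<ge> 4" using L by linarith
    then have "exp (- (real k * ln (norm w) / 2)) \<le> exp (- (real 1 * 2))" by simp
    also have "\<dots> \<le> 1 / 5" by (rule exp_neg_power_bound) auto
    finally show ?thesis .
  qed
  define q where "q = norm (nome z ^ m)"
  have t0: "norm (nome (- of_nat m / z) / z ^ k) \<le> q * (1 / 5)"
    unfolding q_def by (rule order_trans[OF norm_inverted_term_le[OF z(1,4,5) refl k]]) (intro mult_left_mono e, auto)
  have t1: "norm (nome (- of_nat m / (z + 1)) / (z + 1) ^ k) \<le> q * (1 / 5)"
  proof -
    have "norm (nome (- of_nat m / (z + 1)) / (z + 1) ^ k) \<le> q * exp (- (real k * ln (norm (z + 1)) / 2))"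
      unfolding q_def by (rule norm_inverted_term_le) (use z k \<open>norm z \<le> norm (z + 1)\<close> in auto)
    also have "\<dots> \<le> q * (1 / 5)" by (intro mult_left_mono e \<open>norm z \<le> norm (z + 1)\<close>) (simp add: q_def)
    finally show ?thesis .
  qed
  have q: "exp (- (4 * pi * real m)) \<le> q"
  proof -
    have "pi * real m * Im z \<le> pi * real m * 2" using z by (intro mult_left_mono) auto
    then show ?thesis unfolding q_def norm_power norm_nome exp_of_nat_mult[symmetric] by (simp add: mult_ac)
  qed
  have "decay k = decay k * exp (4 * pi * real m) * exp (- (4 * pi * real m))" by (simp add: mult.assoc mult_exp_exp)
  also have "\<dots> \<le> 1 / 2 * q" using d q by (intro mult_mono) auto
  finally have dq: "decay k \<le> q / 2" by simp
  have "norm (f z - (nome z ^ m + nome (- of_nat m / z) / z ^ k + nome (- of_nat m / (z + 1)) / (z + 1) ^ k)) \<le> decay k"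
    by (rule miller_three_terms[OF f I]) (use z in auto)
  then have "norm (nome z ^ m + nome (- of_nat m / z) / z ^ k + nome (- of_nat m / (z + 1)) / (z + 1) ^ k) \<le> decay k"
    unfolding fz by (simp only: diff_0 norm_minus_cancel)
  moreover have "q \<le> norm (nome z ^ m + nome (- of_nat m / z) / z ^ k + nome (- of_nat m / (z + 1)) / (z + 1) ^ k)
     + norm (nome (- of_nat m / z) / z ^ k) + norm (nome (- of_nat m / (z + 1)) / (z + 1) ^ k)"
  proof -
    have "norm (a :: complex) \<le> norm (a + b + c) + norm b + norm c" for a b c
      using norm_triangle_ineq4[of "a + b + c" "b + c"] norm_triangle_ineq[of b c] by (simp add: add.assoc)
    then show ?thesis unfolding q_def .
  qed
  moreover have "q > 0" using q by (rule less_le_trans[rotated]) simp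
  ultimately show False using t0 t1 dq by linarith
qed

text \<open>A zero of order 3 or more would make \<open>|f|\<close> smaller than any fixed multiple
  of the squared distance near \<open>z\<close>.\<close>

lemma zorder_le_2:
  assumes hol: "f holomorphic_on S" "open S" "connected S" "z \<in> S" and fz: "f z = 0" and c: "c > 0" "\<delta> > 0" "ball z \<delta> \<subseteq> S"
    and low: "\<And>w. 0 < norm (w - z) \<Longrightarrow> norm (w - z) < \<delta> \<Longrightarrow> c * norm (w - z)^2 \<le> norm (f w)"
  shows "zorder f z = 1 \<or> zorder f z = 2"
proof -
  define n where "n = zorder f z"
  have "\<exists>w\<in>S. f w \<noteq> 0"
  proof -
    define w where "w = z + of_real (\<delta> / 2)"
    have n: "norm (w - z) = \<delta> / 2" using c by (simp add: w_def)
    then have "w \<in> S" using c by (auto simp: dist_norm norm_minus_commute intro!: subsetD[OF c(3)])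
    moreover have "c * norm (w - z)^2 \<le> norm (f w)" by (rule low) (use n c in auto)
    then have "f w \<noteq> 0" using n c by (auto simp: mult_le_0_iff)
    ultimately show ?thesis by blast
  qed
  from zorder_exist_zero[OF hol this] fz obtain r g where n: "n > 0" and r: "r > 0"
    and g: "g holomorphic_on cball z r" and fg: "\<And>w. w \<in> cball z r \<Longrightarrow> f w = g w * (w - z) ^ nat n"
    unfolding n_def by metis
  have "n < 3"
  proof (rule ccontr)
    assume "\<not> n < 3"
    then have n3: "nat n \<ge> 3" by simp
    obtain B where B: "\<And>w. w \<in> cball z r \<Longrightarrow> norm (g w) \<le> B"
      using compact_imp_bounded[OF compact_continuous_image[OF holomorphic_on_imp_continuous_on[OF g] compact_cball]]
      unfolding bounded_iff by blast
    have B0: "B \<ge> 0" using B[of z] r norm_ge_zero[of "g z"] by (meson centre_in_cball less_imp_le order_trans)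
    define t where "t = min (min (r / 2) (\<delta> / 2)) (min 1 (c / (2 * (B + 1))))"
    have "0 < c / (2 * (B + 1))" using c B0 by (intro divide_pos_pos) auto
    then have t0: "t > 0" using r c by (simp add: t_def)
    have "t \<le> r / 2" "t \<le> \<delta> / 2" "t \<le> 1" "t \<le> c / (2 * (B + 1))" unfolding t_def by linarith+
    then have t: "t > 0" "t \<le> r" "t < \<delta>" "t \<le> 1" "t \<le> c / (2 * (B + 1))"
      using r c t0 by linarith+
    define w where "w = z + of_real t"
    have nw: "norm (w - z) = t" using t by (simp add: w_def)
    have wr: "w \<in> cball z r" using t nw by (simp add: dist_norm norm_minus_commute)
    have "c * t^2 \<le> norm (f w)" using low[of w] nw t by simp
    also have "\<dots> = norm (g w) * t ^ nat n" unfolding fg[OF wr] by (simp add: norm_mult norm_power nw)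
    also have "\<dots> \<le> B * t ^ 3" using B[OF wr] t n3 B0 by (intro mult_mono power_decreasing) auto
    finally have "c * t^2 \<le> (B * t) * t^2" by (simp add: power3_eq_cube power2_eq_square mult.assoc)
    then have "c \<le> B * t" using t by (simp add: mult_le_cancel_right)
    also have "\<dots> \<le> (B + 1) * (c / (2 * (B + 1)))" using t B0 by (intro mult_mono) auto
    also have "\<dots> = c / 2" using B0 by (simp add: field_simps)
    finally show False using c by simp
  qed
  with n show ?thesis unfolding n_def by linarith
qed

section \<open>Zeros near the corner\<close>

definition rho :: complex where
  "rho = Complex (- 1 / 2) (sqrt 3 / 2)"

lemma rho_sq: "rho ^ 2 = - 1 - rho"
  by (simp add: rho_def complex_eq_iff power2_eq_square)

lemma rho_cube: "rho ^ 3 = 1"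
proof -
  have "rho ^ 3 = rho * rho ^ 2" by (simp add: power3_eq_cube power2_eq_square)
  also have "\<dots> = - rho - rho ^ 2" by (subst rho_sq) (simp add: algebra_simps power2_eq_square)
  finally show ?thesis unfolding rho_sq by simp
qed

lemma norm_rho: "norm rho = 1" "norm (rho + 1) = 1"
  by (simp_all add: rho_def cmod_def power2_eq_square)

lemma rho_nonzero: "rho \<noteq> 0" "rho + 1 \<noteq> 0"
  using norm_rho by auto

lemma rho_inverse: "1 / rho = - rho - 1" "1 / (rho + 1) = - rho"
proof -
  have e: "x * (- x - 1) = - (x ^ 2) - x" "(x + 1) * (- x) = - (x ^ 2) - x" for x :: complex
    by (simp_all add: power2_eq_square algebra_simps)
  have "rho * (- rho - 1) = 1" unfolding e rho_sq by simp
  then show "1 / rho = - rho - 1" using rho_nonzero by (simp add: field_simps)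
  have "(rho + 1) * (- rho) = 1" unfolding e rho_sq by simp
  then have "(rho + 1) * (- rho) / (rho + 1) = 1 / (rho + 1)" by (rule arg_cong)
  then show "1 / (rho + 1) = - rho" using rho_nonzero(2) by (simp only: nonzero_mult_div_cancel_left not_False_eq_True)
qed

lemma rho_powers:
  assumes "even k"
  shows "1 / rho ^ k = rho ^ (2 * k)" "1 / (rho + 1) ^ k = rho ^ k"
proof -
  have r1: "1 / rho = rho ^ 2" unfolding rho_inverse rho_sq by simp
  have "1 / rho ^ k = (1 / rho) ^ k" by (simp add: power_divide)
  then show "1 / rho ^ k = rho ^ (2 * k)" unfolding r1 power_mult .
  have "1 / (rho + 1) ^ k = (1 / (rho + 1)) ^ k" by (simp add: power_divide)
  then show "1 / (rho + 1) ^ k = rho ^ k" unfolding rho_inverse(2) using assms by simp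
qed

lemma rho_power_mod: "rho ^ k = rho ^ (k mod 3)"
proof -
  have "rho ^ k = rho ^ (3 * (k div 3) + k mod 3)" by simp
  then show ?thesis unfolding power_add power_mult rho_cube by simp
qed

text \<open>\<open>1 / rho = - rho - 1\<close> and \<open>1 / (rho + 1) = - rho\<close>, so both
  arguments are \<open>m * rho\<close> up to an integer, and all three terms share the factor
  \<open>nome rho ^ m\<close> at the corner.\<close>

lemma nome_at_rho: "nome (- of_nat m / rho) = nome rho ^ m" "nome (- of_nat m / (rho + 1)) = nome rho ^ m"
proof -
  have "- of_nat m / rho = - of_nat m * (1 / rho)" by simp
  also have "\<dots> = of_nat m * rho + of_int (int m)" unfolding rho_inverse by (simp add: algebra_simps)
  finally show "nome (- of_nat m / rho) = nome rho ^ m"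
    unfolding nome_of_nat_mult[symmetric] by (simp only: nome_add nome_of_int mult_1_right)
  have "- of_nat m / (rho + 1) = - of_nat m * (1 / (rho + 1))" by simp
  also have "\<dots> = of_nat m * rho" unfolding rho_inverse by simp
  finally show "nome (- of_nat m / (rho + 1)) = nome rho ^ m" by (simp add: nome_of_nat_mult)
qed

section \<open>Expansion of the three terms around the corner at scale 1/k\<close>

lemma norm_exp_minus_1_le:
  fixes w :: complex
  assumes "norm w \<le> 1"
  shows "norm (exp w - 1) \<le> 3 * norm w"
proof -
  have "norm (exp w - (\<Sum>k\<le>0. w ^ k / fact k)) \<le> exp \<bar>Re w\<bar> * norm w ^ Suc 0 / fact 0" by (rule Taylor_exp)
  then have "norm (exp w - 1) \<le> exp \<bar>Re w\<bar> * norm w" by simp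
  also have "\<dots> \<le> 3 * norm w"
  proof (rule mult_right_mono)
    have "exp \<bar>Re w\<bar> \<le> exp 1" using abs_Re_le_cmod[of w] assms by simp
    then show "exp \<bar>Re w\<bar> \<le> 3" using exp_le by linarith
  qed simp
  finally show ?thesis .
qed

text \<open>With \<open>v = u / (k w)\<close> the power \<open>(1 + v)^k\<close> is
  \<open>exp (u / w)\<close> up to the error \<open>d2\<close> in the exponent; \<open>d1\<close> is
  the change in the exponent of \<open>nome\<close>. The constant is \<open>36 = 3 * 3 * 4\<close>,
  from \<open>exp 1 \<le> 3\<close>, from \<open>|exp d - 1| \<le> 3 |d|\<close> and from the bound
  for \<open>d\<close>.\<close>

lemma inverted_term_near:
  assumes w: "norm w = 1" and u: "norm u \<le> 1" and k: "8 * (pi * real m + 1) \<le> real k"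
  shows "norm (nome (- of_nat m / (w + u / of_nat k)) / (w + u / of_nat k) ^ k - nome (- of_nat m / w) / w ^ k * exp (- u / w))
     \<le> norm (nome (- of_nat m / w)) * (36 * (pi * real m + 1) / real k)"
proof -
  have "0 \<le> pi * real m" by simp
  moreover have "8 * (pi * real m) + 8 \<le> real k" using k by (simp add: distrib_left)
  ultimately have k8: "real k \<ge> 8" by linarith
  then have k0: "k > 0" by simp
  have w0: "w \<noteq> 0" using w by auto
  define v where "v = u / (of_nat k * w)"
  have v: "norm v \<le> 1 / real k" using u w unfolding v_def norm_divide norm_mult by (simp add: divide_right_mono)
  have "1 / real k \<le> 1 / 8" using k8 by (intro divide_left_mono) auto
  then have v8: "norm v \<le> 1 / 8" using v by linarith
  have v1: "1 + v \<noteq> 0"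
  proof
    assume "1 + v = 0"
    then have "v = - 1" by (simp add: add_eq_0_iff)
    then show False using v8 by simp
  qed
  define w' where "w' = w + u / of_nat k"
  have w': "w' = w * (1 + v)" using w0 k0 by (simp add: w'_def v_def field_simps)
  have w'0: "w' \<noteq> 0" unfolding w' using w0 v1 by simp
  define d1 where "d1 = 2 * of_real pi * \<i> * of_nat m * (1 / w - 1 / w')"
  define d2 where "d2 = of_nat k * (Ln (1 + v) - v)"
  have nv: "norm (1 + v) \<ge> 7 / 8" using norm_triangle_ineq2[of 1 "- v"] v8 by simp
  have d1: "norm d1 \<le> 4 * pi * real m / real k"
  proof -
    have "1 / w - 1 / (w * a) = (a - 1) / (w * a)" if "a \<noteq> 0" for a using w0 that by (simp add: field_simps)
    from this[OF v1] have "1 / w - 1 / w' = v / (w * (1 + v))" unfolding w' by simp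
    then have "norm (1 / w - 1 / w') = norm v / norm (1 + v)" using w by (simp add: norm_divide norm_mult)
    also have "\<dots> \<le> (1 / real k) / (1 / 2)" using v nv by (intro frac_le) auto
    finally have "2 * pi * real m * norm (1 / w - 1 / w') \<le> 2 * pi * real m * (2 / real k)" by (intro mult_left_mono) auto
    then show ?thesis unfolding d1_def by (simp add: norm_mult)
  qed
  have d2: "norm d2 \<le> 2 / real k"
  proof -
    have "norm (Ln (1 + v) - v) \<le> norm v^2 / (1 - norm v)" by (rule Ln_approx_linear) (use v8 in simp)
    also have "\<dots> \<le> (1 / real k)^2 / (1 / 2)" using v v8 by (intro frac_le power_mono) auto
    finally have "real k * norm (Ln (1 + v) - v) \<le> real k * ((1 / real k)^2 / (1 / 2))" by (intro mult_left_mono) auto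
    also have "\<dots> = 2 / real k" using k0 by (simp add: power2_eq_square)
    finally show ?thesis unfolding d2_def by (simp add: norm_mult)
  qed
  define d where "d = d1 - d2"
  have nd: "norm d \<le> 4 * (pi * real m + 1) / real k"
  proof -
    have "norm d \<le> 4 * pi * real m / real k + 2 / real k"
      unfolding d_def by (rule order_trans[OF norm_triangle_ineq4 add_mono[OF d1 d2]])
    also have "\<dots> \<le> 4 * (pi * real m + 1) / real k" using k0 by (simp add: divide_right_mono flip: add_divide_distrib)
    finally show ?thesis .
  qed
  have "4 * (pi * real m + 1) / real k \<le> 1" using k k0 by (simp add: divide_le_eq)
  then have nd1: "norm d \<le> 1" using nd by linarith
  have E: "nome (- of_nat m / w') / w' ^ k = nome (- of_nat m / w) / w ^ k * exp (- u / w) * exp d"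
  proof -
    have "(1 + v) ^ k = exp (of_nat k * Ln (1 + v))" using v1 by (simp add: exp_of_nat_mult)
    also have "of_nat k * Ln (1 + v) = u / w + d2" using k0 w0 by (simp add: d2_def v_def right_diff_distrib)
    finally have p: "w' ^ k = w ^ k * (exp (u / w) * exp d2)" unfolding w' power_mult_distrib exp_add by simp
    have "nome (- of_nat m / w') = exp (2 * of_real pi * \<i> * (- of_nat m / w) + d1)"
      unfolding nome_def d1_def by (rule arg_cong[of _ _ exp]) (simp add: algebra_simps)
    then have n: "nome (- of_nat m / w') = nome (- of_nat m / w) * exp d1"
      unfolding exp_add nome_def by simp
    show ?thesis unfolding p n d_def by (simp add: exp_diff exp_minus divide_inverse)
  qed
  have "nome (- of_nat m / w') / w' ^ k - nome (- of_nat m / w) / w ^ k * exp (- u / w)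
     = nome (- of_nat m / w) / w ^ k * exp (- u / w) * (exp d - 1)"
    unfolding E right_diff_distrib by simp
  then have "norm (nome (- of_nat m / w') / w' ^ k - nome (- of_nat m / w) / w ^ k * exp (- u / w))
     = norm (nome (- of_nat m / w)) * (norm (exp (- u / w)) * norm (exp d - 1))"
    using w by (simp add: norm_mult norm_divide norm_power)
  also have "\<dots> \<le> norm (nome (- of_nat m / w)) * (3 * (3 * (4 * (pi * real m + 1) / real k)))"
  proof (intro mult_left_mono mult_mono)
    have "Re (- u / w) \<le> 1" using complex_Re_le_cmod[of "- u / w"] u w by (simp add: norm_divide)
    then have "exp (Re (- u / w)) \<le> exp 1" by simp
    then show "norm (exp (- u / w)) \<le> 3" unfolding norm_exp_eq_Re using exp_le by linarith
    show "norm (exp d - 1) \<le> 3 * (4 * (pi * real m + 1) / real k)"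
      by (rule order_trans[OF norm_exp_minus_1_le[OF nd1]]) (rule mult_left_mono[OF nd], simp)
  qed auto
  finally show ?thesis unfolding w'_def by simp
qed

text \<open>The limit of \<open>f (rho + u / k) / nome rho ^ m\<close> for \<open>k\<close> in a fixed residue class modulo 3.\<close>

definition corner_limit :: "nat \<Rightarrow> complex \<Rightarrow> complex" where
  "corner_limit k u = 1 + rho ^ (2 * k) * exp ((rho + 1) * u) + rho ^ k * exp (rho * u)"

text \<open>For even \<open>k\<close> this is the order of vanishing at \<open>rho\<close> forced by
  the weight, and for every \<open>k\<close> the exact order of \<open>corner_limit\<close> at 0,
  where the leading terms are \<open>3\<close>, \<open>- (1 + 2 rho) u\<close> and
  \<open>- u^2 / 2\<close>.\<close>

definition corner_order :: "nat \<Rightarrow> nat" where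
  "corner_order k = (if k mod 3 = 0 then 0 else if k mod 3 = 1 then 1 else 2)"

lemma rho_plus_1: "(rho + 1) ^ 2 = rho" "rho * (rho + 1) = - 1"
proof -
  have "(rho + 1) ^ 2 = rho ^ 2 + 2 * rho + 1" by (simp add: power2_eq_square algebra_simps)
  then show "(rho + 1) ^ 2 = rho" unfolding rho_sq by simp
  have "rho * (rho + 1) = rho ^ 2 + rho" by (simp add: power2_eq_square algebra_simps)
  then show "rho * (rho + 1) = - 1" unfolding rho_sq by simp
qed

lemma corner_coefficients:
  shows "k mod 3 = 0 \<Longrightarrow> rho ^ k = 1" "k mod 3 = 0 \<Longrightarrow> rho ^ (2 * k) = 1"
    "k mod 3 = 1 \<Longrightarrow> rho ^ k = rho" "k mod 3 = 1 \<Longrightarrow> rho ^ (2 * k) = - 1 - rho"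
    "k mod 3 = 2 \<Longrightarrow> rho ^ k = - 1 - rho" "k mod 3 = 2 \<Longrightarrow> rho ^ (2 * k) = rho"
proof -
  have d: "rho ^ (2 * k) = (rho ^ k) ^ 2" by (simp add: power_mult mult.commute)
  have q: "(- 1 - rho) ^ 2 = rho"
  proof -
    have "(- 1 - rho) ^ 2 = (rho + 1) ^ 2" by (simp add: power2_eq_square algebra_simps)
    then show ?thesis unfolding rho_plus_1 .
  qed
  show "k mod 3 = 0 \<Longrightarrow> rho ^ k = 1" "k mod 3 = 1 \<Longrightarrow> rho ^ k = rho" "k mod 3 = 2 \<Longrightarrow> rho ^ k = - 1 - rho"
    using rho_power_mod[of k] rho_sq by simp_all
  then show "k mod 3 = 0 \<Longrightarrow> rho ^ (2 * k) = 1" "k mod 3 = 1 \<Longrightarrow> rho ^ (2 * k) = - 1 - rho" "k mod 3 = 2 \<Longrightarrow> rho ^ (2 * k) = rho"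
    unfolding d using rho_sq q by simp_all
qed

lemma exp_taylor_bound:
  fixes w u :: complex
  assumes "norm w = 1" "norm u \<le> 1"
  shows "norm (exp (w * u) - (\<Sum>k\<le>n. (w * u) ^ k / fact k)) \<le> 3 * norm u ^ Suc n / fact n"
proof -
  have n: "norm (w * u) = norm u" using assms by (simp add: norm_mult)
  have "exp \<bar>Re (w * u)\<bar> \<le> exp 1" using abs_Re_le_cmod[of "w * u"] n assms by simp
  then have "exp \<bar>Re (w * u)\<bar> \<le> 3" using exp_le by linarith
  then have "exp \<bar>Re (w * u)\<bar> * norm u ^ Suc n / fact n \<le> 3 * norm u ^ Suc n / fact n"
    by (intro divide_right_mono mult_right_mono) auto
  then show ?thesis using Taylor_exp[of "w * u" n] unfolding n by linarith
qed

lemma norm_one_plus_two_rho: "norm (1 + 2 * rho) \<ge> 1"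
proof -
  have "1 + 2 * rho = \<i> * of_real (sqrt 3)" by (simp add: rho_def complex_eq_iff)
  then show ?thesis by (simp add: norm_mult)
qed

text \<open>Taylor expansion at 0: the coefficients below \<open>corner_order k\<close> cancel by
  \<open>1 + rho + rho^2 = 0\<close>, and the radius \<open>1/24\<close> keeps the remainders below
  three quarters of the leading term for \<open>k mod 3 \<noteq> 2\<close> and below half of it
  otherwise.\<close>

lemma corner_limit_low:
  assumes u: "norm u \<le> 1 / 24"
  shows "norm u ^ corner_order k / 4 \<le> norm (corner_limit k u)"
proof -
  have u1: "norm u \<le> 1" using u by simp
  define n where "n = norm u"
  have n: "0 \<le> n" "n \<le> 1 / 24" using u by (auto simp: n_def)
  define s where "s = rho + 1"
  have rs: "s ^ 2 = rho" "rho * s = - 1" "rho ^ 2 = - s" unfolding s_def using rho_plus_1 rho_sq by simp_all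
  define A where "A = exp (s * u)"
  define B where "B = exp (rho * u)"
  note TA = exp_taylor_bound[OF norm_rho(2) u1, folded s_def, folded A_def n_def]
  note TB = exp_taylor_bound[OF norm_rho(1) u1, folded B_def n_def]
  have ns: "norm s = 1" "norm rho = 1" unfolding s_def by (rule norm_rho)+
  have low: "x \<le> norm c" if "c = a + e1 + e2" "norm e1 \<le> y1" "norm e2 \<le> y2" "x + y1 + y2 \<le> norm a" for a c e1 e2 :: complex and x y1 y2
    using that norm_triangle_ineq[of c "- e1 - e2"] norm_triangle_ineq4[of "- e1" e2] by simp
  have "k mod 3 < 3" by simp
  then consider "k mod 3 = 0" | "k mod 3 = 1" | "k mod 3 = 2" by linarith
  then show ?thesis
  proof cases
    case 1
    have c: "corner_limit k u = 3 + (A - 1) + (B - 1)"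
      unfolding corner_limit_def corner_coefficients(1,2)[OF 1] s_def[symmetric] A_def B_def by simp
    have "1 / 4 \<le> norm (corner_limit k u)"
      by (rule low[OF c, of "3 * n" "3 * n"]) (use TA[of 0] TB[of 0] n in auto)
    then show ?thesis using 1 by (simp add: corner_order_def)
  next
    case 2
    define e1 where "e1 = - s * (A - (1 + s * u))"
    define e2 where "e2 = rho * (B - (1 + rho * u))"
    have "corner_limit k u = 1 + (- 1 - rho) * A + rho * B"
      unfolding corner_limit_def corner_coefficients(3,4)[OF 2] s_def[symmetric] A_def B_def by simp
    also have "\<dots> = (1 - s + rho) + (rho ^ 2 - s ^ 2) * u + e1 + e2"
      unfolding e1_def e2_def s_def by (simp add: algebra_simps power2_eq_square)
    also have "1 - s + rho = 0" by (simp add: s_def)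
    also have "rho ^ 2 - s ^ 2 = - (1 + 2 * rho)" unfolding rs by (simp add: s_def)
    finally have c: "corner_limit k u = - (1 + 2 * rho) * u + e1 + e2" by simp
    have b: "norm e1 \<le> 3 * n^2" "norm e2 \<le> 3 * n^2"
      using TA[of 1] TB[of 1] unfolding e1_def e2_def norm_mult by (simp_all add: ns power2_eq_square)
    have "n^2 \<le> n * (1 / 24)" unfolding power2_eq_square using n by (intro mult_left_mono) auto
    moreover have "1 * n \<le> norm (- (1 + 2 * rho) * u)"
      unfolding norm_mult norm_minus_cancel n_def by (intro mult_right_mono norm_one_plus_two_rho) auto
    ultimately have "n / 4 + 3 * n^2 + 3 * n^2 \<le> norm (- (1 + 2 * rho) * u)" using n by linarith
    from low[OF c b this] show ?thesis using 2 by (simp add: corner_order_def n_def)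
  next
    case 3
    define e1 where "e1 = rho * (A - (1 + s * u + (s * u)^2 / 2))"
    define e2 where "e2 = - s * (B - (1 + rho * u + (rho * u)^2 / 2))"
    have "corner_limit k u = 1 + rho * A + (- 1 - rho) * B"
      unfolding corner_limit_def corner_coefficients(5,6)[OF 3] s_def[symmetric] A_def B_def by simp
    also have "\<dots> = (1 + rho - s) + (rho * s) * (s - rho) * u^2 / 2 + e1 + e2"
      unfolding e1_def e2_def s_def by (simp add: field_simps power2_eq_square)
    also have "1 + rho - s = 0" by (simp add: s_def)
    also have "(rho * s) * (s - rho) = - 1" unfolding rs by (simp add: s_def)
    finally have c: "corner_limit k u = - (u^2 / 2) + e1 + e2" by simp
    have b: "norm e1 \<le> 3 / 2 * n^3" "norm e2 \<le> 3 / 2 * n^3"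
      using TA[of 2] TB[of 2] unfolding e1_def e2_def norm_mult
      by (simp_all add: ns numeral_eq_Suc atMost_Suc add_ac)
    have "n^3 \<le> n^2 * (1 / 24)" using mult_left_mono[OF n(2), of "n^2"] by (simp add: power3_eq_cube power2_eq_square)
    then have "n^2 / 4 + 3 / 2 * n^3 + 3 / 2 * n^3 \<le> n^2 / 2" using zero_le_power2[of n] by linarith
    also have "n^2 / 2 = norm (- (u^2 / 2))" by (simp add: n_def norm_divide norm_power)
    finally have b': "n^2 / 4 + 3 / 2 * n^3 + 3 / 2 * n^3 \<le> norm (- (u^2 / 2))" .
    show ?thesis using low[OF c b b'] 3 by (simp add: corner_order_def n_def)
  qed
qed

lemma corner_limit_deriv:
  "(corner_limit k has_field_derivative rho ^ (2 * k) * ((rho + 1) * exp ((rho + 1) * u)) + rho ^ k * (rho * exp (rho * u))) (at u)"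
  unfolding corner_limit_def[abs_def] by (auto intro!: derivative_eq_intros simp: mult_ac)

lemma corner_limit_vanishes:
  assumes "i < corner_order k"
  shows "(deriv ^^ i) (corner_limit k) 0 = 0"
proof -
  have k: "k mod 3 = 1 \<or> k mod 3 = 2" using assms by (auto simp: corner_order_def split: if_splits)
  then have 0: "corner_limit k 0 = 0" by (auto simp: corner_limit_def corner_coefficients)
  show ?thesis
  proof (cases "i = 0")
    case False
    then have "k mod 3 = 2" "i = 1" using assms by (auto simp: corner_order_def split: if_splits)
    moreover have "deriv (corner_limit k) 0 = rho ^ (2 * k) * (rho + 1) + rho ^ k * rho"
      using DERIV_imp_deriv[OF corner_limit_deriv[of k 0]] by simp
    moreover have "rho ^ (2 * k) * (rho + 1) + rho ^ k * rho = 0"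
      unfolding corner_coefficients(5,6)[OF \<open>k mod 3 = 2\<close>] by (simp add: algebra_simps)
    ultimately show ?thesis by simp
  qed (use 0 in simp)
qed

lemma norm_three_terms_near_rho:
  assumes k: "even k" "8 * (pi * real m + 1) \<le> real k" and u: "norm u \<le> 1"
  defines "z \<equiv> rho + u / of_nat k"
  shows "norm (nome z ^ m + nome (- of_nat m / z) / z ^ k + nome (- of_nat m / (z + 1)) / (z + 1) ^ k - nome rho ^ m * corner_limit k u)
     \<le> norm (nome rho ^ m) * (108 * (pi * real m + 1) / real k)"
proof -
  define Q where "Q = nome rho ^ m"
  define X where "X = 36 * (pi * real m + 1) / real k"
  have "0 \<le> pi * real m" by simp
  moreover have "8 * (pi * real m) + 8 \<le> real k" using k(2) by (simp add: distrib_left)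
  ultimately have k0: "real k > 0" by linarith
  have e1: "- u / rho = (rho + 1) * u"
  proof -
    have "- u / rho = - u * (1 / rho)" by simp
    then show ?thesis unfolding rho_inverse by (simp add: algebra_simps)
  qed
  have e2: "- u / (rho + 1) = rho * u"
  proof -
    have "- u / (rho + 1) = - u * (1 / (rho + 1))" by simp
    then show ?thesis unfolding rho_inverse by simp
  qed
  have 2: "norm (nome (- of_nat m / z) / z ^ k - Q * rho ^ (2 * k) * exp ((rho + 1) * u)) \<le> norm Q * X"
    using inverted_term_near[OF norm_rho(1) u k(2)]
    unfolding z_def Q_def X_def nome_at_rho e1 rho_powers(1)[OF k(1), symmetric] by simp
  have z1: "z + 1 = (rho + 1) + u / of_nat k" by (simp add: z_def)
  have 3: "norm (nome (- of_nat m / (z + 1)) / (z + 1) ^ k - Q * rho ^ k * exp (rho * u)) \<le> norm Q * X"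
    using inverted_term_near[OF norm_rho(2) u k(2)]
    unfolding z1 Q_def X_def nome_at_rho e2 rho_powers(2)[OF k(1), symmetric] by simp
  have 1: "norm (nome z ^ m - Q) \<le> norm Q * X"
  proof -
    define d where "d = of_nat m * (2 * of_real pi * \<i> * (u / of_nat k))"
    have nd: "norm d \<le> 2 * pi * real m / real k"
    proof -
      have "norm d = 2 * pi * real m / real k * norm u" by (simp add: d_def norm_mult norm_divide)
      also have "\<dots> \<le> 2 * pi * real m / real k * 1" using u by (intro mult_left_mono) auto
      finally show ?thesis by simp
    qed
    have "2 * pi * real m / real k \<le> 1" using k(2) k0 \<open>0 \<le> pi * real m\<close> by (simp add: divide_le_eq)
    then have "norm (exp d - 1) \<le> 3 * norm d" using nd by (intro norm_exp_minus_1_le) linarith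
    also have "\<dots> \<le> 3 * (2 * pi * real m / real k)" using nd by simp
    also have "\<dots> \<le> X" unfolding X_def using k0 by (simp add: divide_right_mono)
    finally have "norm Q * norm (exp d - 1) \<le> norm Q * X" by (intro mult_left_mono) auto
    moreover have "nome z ^ m = Q * exp d"
      unfolding z_def nome_add power_mult_distrib Q_def d_def exp_of_nat_mult by (simp add: nome_def)
    ultimately show ?thesis by (simp add: right_diff_distrib flip: norm_mult)
  qed
  have "nome z ^ m + nome (- of_nat m / z) / z ^ k + nome (- of_nat m / (z + 1)) / (z + 1) ^ k - Q * corner_limit k u
    = (nome z ^ m - Q) + (nome (- of_nat m / z) / z ^ k - Q * rho ^ (2 * k) * exp ((rho + 1) * u))
      + (nome (- of_nat m / (z + 1)) / (z + 1) ^ k - Q * rho ^ k * exp (rho * u))"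
    unfolding corner_limit_def by (simp add: algebra_simps)
  also have "norm \<dots> \<le> norm Q * X + norm Q * X + norm Q * X" by (intro norm_triangle_mono 1 2 3)
  also have "\<dots> = norm Q * (108 * (pi * real m + 1) / real k)" by (simp add: X_def)
  finally show ?thesis by (simp add: Q_def)
qed

text \<open>The map \<open>z \<mapsto> - 1 / (z + 1)\<close> fixes \<open>rho\<close>. Comparing
  values, and then first derivatives, in the transformation law shows that each equals itself times
  a cube root of unity other than 1.\<close>

lemma modular_form_at_rho:
  fixes f :: "complex \<Rightarrow> complex" and i k :: nat
  assumes f: "modular_form k f" and k: "even k" "k \<ge> 2" "i < corner_order k"
  shows "(deriv ^^ i) f rho = 0"
proof -
  have I: "Im rho > 0" by (simp add: rho_def)
  have opH: "open upper_half_plane" unfolding upper_half_plane_def by (rule open_halfspace_Im_gt)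
  have rH: "rho \<in> upper_half_plane" using I by (simp add: upper_half_plane_def)
  have fixed_pt: "- 1 / (rho + 1) = rho" using rho_inverse(2) by simp
  have ST: "f (- 1 / (z + 1)) = (z + 1) ^ k * f z" if "z \<in> upper_half_plane" for z
    using modular_formD(2,3)[OF f] that by (simp add: upper_half_plane_def)
  have pk: "(rho + 1) ^ k * rho ^ k = 1" using rho_powers(2)[OF k(1)] rho_nonzero by (simp add: field_simps)
  have km: "k mod 3 = 1 \<or> k mod 3 = 2" using k(3) by (auto simp: corner_order_def split: if_splits)
  have r1: "rho \<noteq> 1" "- 1 - rho \<noteq> 1" "- 1 - rho \<noteq> rho" by (simp_all add: rho_def complex_eq_iff)
  have f0: "f rho = 0"
  proof (rule ccontr)
    assume "f rho \<noteq> 0"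
    then have "(rho + 1) ^ k = 1" using ST[OF rH] unfolding fixed_pt by simp
    then have "rho ^ k = 1" using pk by simp
    then show False using km r1 by (auto simp: corner_coefficients)
  qed
  show ?thesis
  proof (cases "i = 0")
    case False
    then have k2: "k mod 3 = 2" and i: "i = 1" using k(3) by (auto simp: corner_order_def split: if_splits)
    define d where "d = deriv f rho"
    have fd: "(f has_field_derivative d) (at rho)"
      unfolding d_def by (rule holomorphic_derivI[OF modular_formD(1)[OF f] opH rH])
    have inv: "((\<lambda>z. - 1 / (z + 1)) has_field_derivative (1 / (rho + 1)^2)) (at rho)"
      using rho_nonzero by (auto intro!: derivative_eq_intros simp: power2_eq_square field_simps)
    have "((\<lambda>z. f (- 1 / (z + 1))) has_field_derivative d * (1 / (rho + 1)^2)) (at rho)"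
      by (rule DERIV_chain2[where f = f and g = "\<lambda>z. - 1 / (z + 1)"], unfold fixed_pt, rule fd, rule inv)
    then have D1: "((\<lambda>z. (z + 1) ^ k * f z) has_field_derivative d * (1 / (rho + 1)^2)) (at rho)"
      by (rule has_field_derivative_transform_within_open[OF _ opH rH ST])
    have "((\<lambda>z. (z + 1) ^ k) has_field_derivative of_nat k * (1 + 0) * (rho + 1) ^ (k - 1)) (at rho)"
      by (auto intro!: derivative_eq_intros)
    from DERIV_mult[OF this fd]
    have D2: "((\<lambda>z. (z + 1) ^ k * f z) has_field_derivative (rho + 1) ^ k * d) (at rho)"
      using f0 by (simp add: mult.commute)
    have "d * (1 / (rho + 1)^2) = (rho + 1) ^ k * d" by (rule DERIV_unique[OF D1 D2])
    moreover have "1 / (rho + 1)^2 = - 1 - rho"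
    proof -
      have "1 / (rho + 1)^2 = 1 / rho" unfolding rho_plus_1 ..
      then show ?thesis unfolding rho_inverse by simp
    qed
    moreover have "(rho + 1) ^ k = rho"
    proof -
      have "(rho + 1) ^ k * (- 1 - rho) = 1" using pk unfolding corner_coefficients(5)[OF k2] .
      moreover have "rho * (- 1 - rho) = 1"
      proof -
        have "rho * (- 1 - rho) = - (rho * (rho + 1))" by (simp add: algebra_simps)
        then show ?thesis unfolding rho_plus_1(2) by simp
      qed
      ultimately have "(rho + 1) ^ k * (- 1 - rho) = rho * (- 1 - rho)" by simp
      moreover have "- 1 - rho \<noteq> 0" using rho_nonzero(2) by (metis add.commute diff_0_right eq_neg_iff_add_eq_0 minus_diff_eq right_minus_eq)
      ultimately show ?thesis by (metis mult_right_cancel)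
    qed
    ultimately have "d * (- 1 - rho) = rho * d" by simp
    then have "d * ((- 1 - rho) - rho) = 0" by (simp add: algebra_simps)
    then have "d = 0" using r1(3) unfolding mult_eq_0_iff right_minus_eq by blast
    then show ?thesis by (simp add: i d_def)
  qed (use f0 in simp)
qed

lemma near_rho_in_strip:
  assumes k: "real k \<ge> 400" and u: "norm u \<le> 1"
  shows "4/5 \<le> Im (rho + u / of_nat k)" "Im (rho + u / of_nat k) \<le> 2"
    "- 6/10 \<le> Re (rho + u / of_nat k)" "Re (rho + u / of_nat k) \<le> 1/10"
proof -
  define d where "d = u / of_nat k"
  have "norm d \<le> 1 / 400" unfolding d_def norm_divide norm_of_nat using k u by (intro frac_le) auto
  then have "\<bar>Re d\<bar> \<le> 1 / 400" "\<bar>Im d\<bar> \<le> 1 / 400" using abs_Re_le_cmod[of d] abs_Im_le_cmod[of d] by linarith+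
  moreover have "17/10 \<le> sqrt 3" "sqrt 3 \<le> 18/10"
    by (rule real_le_rsqrt, simp add: power2_eq_square) (rule real_le_lsqrt, simp_all add: power2_eq_square)
  ultimately show "4/5 \<le> Im (rho + u / of_nat k)" "Im (rho + u / of_nat k) \<le> 2"
    "- 6/10 \<le> Re (rho + u / of_nat k)" "Re (rho + u / of_nat k) \<le> 1/10"
    unfolding d_def[symmetric] rho_def by (simp_all add: abs_le_iff)
qed

lemma norm_nome_rho_power_ge: "exp (- (4 * pi * real m)) \<le> norm (nome rho ^ m)"
proof -
  have "pi * real m * (sqrt 3 / 2) \<le> pi * real m * 2"
    using real_sqrt_le_mono[of 3 16] by (intro mult_left_mono) auto
  then show ?thesis unfolding norm_power norm_nome exp_of_nat_mult[symmetric] by (simp add: rho_def mult_ac)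
qed

text \<open>A uniform error bound alone would fail near \<open>u = 0\<close>, where the limit may
  vanish. But the error \<open>h\<close> vanishes there to the same order \<open>j\<close>; dividing
  by \<open>u^j\<close> and using the maximum principle on \<open>|u| = 1/2\<close> turns
  \<open>|Q| / 32\<close> into \<open>|Q| |u|^j / 8\<close>, half of the lower bound for the
  limit.\<close>

lemma corner_lower_bound:
  assumes f: "miller m k f" and k: "6912 * (pi * real m + 1) \<le> real k"
    and d: "decay k * exp (4 * pi * real m) \<le> 1 / 64" and u: "norm u \<le> 1 / 24"
  shows "norm (nome rho ^ m) * (norm u)^2 / 8 \<le> norm (f (rho + u / of_nat k))"
proof -
  define Q where "Q = nome rho ^ m"
  define j where "j = corner_order k"
  have "0 \<le> pi * real m" by simp
  moreover have k': "6912 * (pi * real m) + 6912 \<le> real k" using k by (simp add: distrib_left)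
  moreover have "8 * (pi * real m + 1) = 8 * (pi * real m) + 8" by simp
  ultimately have kk: "real k \<ge> 400" "8 * (pi * real m + 1) \<le> real k" "real k > 0" by linarith+
  have ev: "even k" "k \<ge> 2" using miller_even[OF f] miller_ge_12[OF f] by auto
  define F where "F = (\<lambda>u. f (inverse (of_nat k) * u + rho))"
  have lin: "inverse (of_nat k) * u + rho = rho + u / of_nat k" for u :: complex
    by (simp only: divide_inverse ac_simps)
  have F: "F u = f (rho + u / of_nat k)" for u unfolding F_def lin ..
  define h where "h = (\<lambda>u. F u - Q * corner_limit k u)"
  have sub: "inverse (of_nat k) * u + rho \<in> upper_half_plane" if "u \<in> ball 0 1" for u
  proof -
    have "4/5 \<le> Im (rho + u / of_nat k)" using that by (intro near_rho_in_strip(1) kk(1)) simp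
    then have "0 < Im (rho + u / of_nat k)" by linarith
    then show ?thesis unfolding lin upper_half_plane_def by (rule CollectI)
  qed
  have fh: "f holomorphic_on upper_half_plane" by (rule modular_formD(1)[OF miller_modular[OF f]])
  have opH: "open upper_half_plane" unfolding upper_half_plane_def by (rule open_halfspace_Im_gt)
  have "f \<circ> (\<lambda>u. inverse (of_nat k) * u + rho) holomorphic_on ball 0 1"
    by (rule holomorphic_on_compose_gen[OF _ fh]) (auto intro!: holomorphic_intros sub)
  then have Fh: "F holomorphic_on ball 0 1" by (simp add: F_def o_def)
  have Lh: "corner_limit k holomorphic_on S" for S unfolding corner_limit_def[abs_def] by (intro holomorphic_intros)
  have hh: "h holomorphic_on ball 0 1" unfolding h_def by (intro holomorphic_intros Fh Lh)
  have Dh: "(deriv ^^ i) h 0 = 0" if "i < j" for i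
  proof -
    have 0: "(0 :: complex) \<in> ball 0 1" by simp
    have "(deriv ^^ i) h 0 = (deriv ^^ i) F 0 - (deriv ^^ i) (\<lambda>u. Q * corner_limit k u) 0"
      unfolding h_def by (rule higher_deriv_diff[OF Fh _ open_ball 0]) (intro holomorphic_intros Lh)
    also have "(deriv ^^ i) (\<lambda>u. Q * corner_limit k u) 0 = Q * (deriv ^^ i) (corner_limit k) 0"
      by (rule higher_deriv_cmult[OF Lh 0 open_ball])
    also have "(deriv ^^ i) F 0 = inverse (of_nat k) ^ i * (deriv ^^ i) f (inverse (of_nat k) * 0 + rho)"
      unfolding F_def by (rule higher_deriv_compose_linear'[OF fh open_ball opH 0 sub])
    also have "inverse (of_nat k) * 0 + rho = rho" by simp
    finally show ?thesis
      using corner_limit_vanishes[of i k] modular_form_at_rho[OF miller_modular[OF f] ev, of i] that by (simp add: j_def)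
  qed
  have hb: "norm (h v) \<le> norm Q / 32" if "norm v \<le> 1" for v
  proof -
    define z where "z = rho + v / of_nat k"
    have "norm (f z - (nome z ^ m + nome (- of_nat m / z) / z ^ k + nome (- of_nat m / (z + 1)) / (z + 1) ^ k)) \<le> decay k"
      unfolding z_def by (rule miller_three_terms[OF f near_rho_in_strip[OF kk(1) that]])
    moreover have "norm (nome z ^ m + nome (- of_nat m / z) / z ^ k + nome (- of_nat m / (z + 1)) / (z + 1) ^ k - Q * corner_limit k v)
       \<le> norm Q * (108 * (pi * real m + 1) / real k)"
      unfolding z_def Q_def by (rule norm_three_terms_near_rho[OF ev(1) kk(2) that])
    \<comment> \<open>\<open>6912 = 64 * 108\<close>: this error and \<open>decay k\<close> get
      \<open>|Q| / 64\<close> each.\<close>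
    moreover have "norm Q * (108 * (pi * real m + 1) / real k) \<le> norm Q * (1 / 64)"
      using k kk(3) by (intro mult_left_mono) (simp_all add: divide_le_eq)
    moreover have "decay k \<le> norm Q / 64"
    proof -
      have "decay k = decay k * exp (4 * pi * real m) * exp (- (4 * pi * real m))" by (simp add: mult.assoc mult_exp_exp)
      also have "\<dots> \<le> 1 / 64 * norm Q" using d norm_nome_rho_power_ge[of m] unfolding Q_def by (intro mult_mono) auto
      finally show ?thesis by simp
    qed
    moreover have "norm (h v) \<le> norm (f z - (nome z ^ m + nome (- of_nat m / z) / z ^ k + nome (- of_nat m / (z + 1)) / (z + 1) ^ k))
       + norm (nome z ^ m + nome (- of_nat m / z) / z ^ k + nome (- of_nat m / (z + 1)) / (z + 1) ^ k - Q * corner_limit k v)"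
    proof -
      have "norm (a - c) \<le> norm (a - b) + norm (b - c)" for a b c :: complex
        using norm_triangle_ineq[of "a - b" "b - c"] by simp
      then show ?thesis unfolding h_def F z_def .
    qed
    ultimately show ?thesis by linarith
  qed
  obtain g where g: "g holomorphic_on ball 0 1"
    and hg0: "\<And>q. q \<in> ball 0 1 \<Longrightarrow> h q = (\<Sum>n<j. (deriv ^^ n) h 0 / fact n * q ^ n) + q ^ j * g q"
    using holomorphic_disc_factor[OF hh] by blast
  have hg: "h q = q ^ j * g q" if "q \<in> ball 0 1" for q using hg0[OF that] by (simp add: Dh)
  have j2: "j \<le> 2" by (simp add: j_def corner_order_def)
  have gb: "norm (g v) \<le> norm Q / 8" if "v \<in> cball 0 (1/2)" for v
  proof (rule maximum_modulus_frontier[of g "cball 0 (1/2)"])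
    show "g holomorphic_on interior (cball 0 (1/2))" by (rule holomorphic_on_subset[OF g]) auto
    show "continuous_on (closure (cball 0 (1/2))) g"
      by (rule holomorphic_on_imp_continuous_on, rule holomorphic_on_subset[OF g]) auto
    show "bounded (cball (0 :: complex) (1/2))" by simp
    fix w :: complex assume "w \<in> frontier (cball 0 (1/2))"
    then have w: "norm w = 1 / 2" by simp
    have "norm (h w) = norm w ^ j * norm (g w)" using hg[of w] w by (simp add: norm_mult norm_power)
    then have "norm (h w) = (1/2) ^ j * norm (g w)" unfolding w .
    then have "(1/2) ^ j * norm (g w) \<le> norm Q / 32" using hb[of w] w by simp
    moreover have "(1/2 :: real) ^ 2 * norm (g w) \<le> (1/2) ^ j * norm (g w)"
      by (intro mult_right_mono power_decreasing j2) auto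
    ultimately show "norm (g w) \<le> norm Q / 8" by (simp add: power2_eq_square)
  qed (use that in simp)
  have "norm (h u) = norm u ^ j * norm (g u)" using hg[of u] u by (simp add: norm_mult norm_power)
  also have "\<dots> \<le> norm u ^ j * (norm Q / 8)" using u by (intro mult_left_mono gb) auto
  finally have "norm (h u) \<le> norm Q * norm u ^ j / 8" by (simp add: mult.commute)
  moreover have "norm Q * (norm u ^ j / 4) \<le> norm (Q * corner_limit k u)"
    unfolding norm_mult j_def by (intro mult_left_mono corner_limit_low u) auto
  moreover have "norm (Q * corner_limit k u) \<le> norm (F u) + norm (h u)"
    using norm_triangle_ineq4[of "F u" "h u"] by (simp add: h_def)
  ultimately have "norm Q * norm u ^ j / 8 \<le> norm (F u)" by simp
  moreover have "norm Q * norm u ^ 2 \<le> norm Q * norm u ^ j" using u j2 by (intro mult_left_mono power_decreasing) auto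
  ultimately show ?thesis unfolding F[symmetric] Q_def[symmetric] by linarith
qed

text \<open>The disc of radius \<open>1 / (24 k)\<close> overlaps the range of the cosine argument,
  which begins at parameter distance \<open>1 / (300 k)\<close> from the corner.\<close>

definition corner_good :: "nat \<Rightarrow> (complex \<Rightarrow> complex) \<Rightarrow> bool" where
  "corner_good k f \<longleftrightarrow> (\<forall>z. real k * norm (z - rho) \<le> 1 / 24 \<and> f z = 0 \<longrightarrow> z = rho) \<and>
     (f rho = 0 \<longrightarrow> zorder f rho = 1 \<or> zorder f rho = 2)"

lemma eventually_corner_good: "\<forall>\<^sub>F k in sequentially. \<forall>f. miller m k f \<longrightarrow> corner_good k f"
proof -
  have "\<forall>\<^sub>F k in sequentially. decay k * exp (real k / 100 + 4 * pi * real m) < 1 / 64"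
    by (intro order_tendstoD(2)[OF decay_exp_tendsto]) simp
  moreover have "\<forall>\<^sub>F k in sequentially. 6912 * (pi * real m + 1) \<le> real k"
    by (rule eventually_nat_real[OF filterlim_at_top[THEN iffD1, rule_format, OF filterlim_ident]])
  ultimately show ?thesis
  proof eventually_elim
    case (elim k)
    show ?case
    proof (intro allI impI)
      fix f assume f: "miller m k f"
      have "decay k * exp (4 * pi * real m) \<le> decay k * exp (real k / 100 + 4 * pi * real m)"
        using decay_nonneg[of k] by (intro mult_left_mono) auto
      then have d: "decay k * exp (4 * pi * real m) \<le> 1 / 64" using elim by linarith
      have k0: "k > 0" using miller_ge_12[OF f] by simp
      define c where "c = norm (nome rho ^ m) * (real k)^2 / 8"
      have c: "c > 0" using k0 by (simp add: c_def nome_def)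
      have low: "c * norm (z - rho)^2 \<le> norm (f z)" if "real k * norm (z - rho) \<le> 1 / 24" for z
      proof -
        define u where "u = of_nat k * (z - rho)"
        have nu: "norm u = real k * norm (z - rho)" by (simp add: u_def norm_mult)
        have "rho + u / of_nat k = z" using k0 by (simp add: u_def)
        then show ?thesis
          using corner_lower_bound[OF f elim(2) d, of u] that unfolding nu c_def by (simp add: power_mult_distrib mult_ac)
      qed
      show "corner_good k f" unfolding corner_good_def
      proof (intro conjI allI impI)
        fix z assume z: "real k * norm (z - rho) \<le> 1 / 24 \<and> f z = 0"
        then have "c * norm (z - rho)^2 \<le> 0" using low[of z] by simp
        then show "z = rho" using c by (simp add: mult_le_0_iff)
      next
        assume "f rho = 0"
        show "zorder f rho = 1 \<or> zorder f rho = 2"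
        proof (rule zorder_le_2[OF modular_formD(1)[OF miller_modular[OF f]] _ _ _ \<open>f rho = 0\<close> c])
          show "open upper_half_plane" unfolding upper_half_plane_def by (rule open_halfspace_Im_gt)
          show "connected upper_half_plane"
            unfolding upper_half_plane_def by (rule convex_connected) (rule convex_halfspace_Im_gt)
          have I: "Im rho \<ge> 4/5" using near_rho_in_strip(1)[of 400 0] by simp
          then show "rho \<in> upper_half_plane" by (simp add: upper_half_plane_def)
          show "1 / (24 * real k) > 0" using k0 by simp
          show "ball rho (1 / (24 * real k)) \<subseteq> upper_half_plane"
          proof
            fix z assume "z \<in> ball rho (1 / (24 * real k))"
            then have "norm (rho - z) < 1 / (24 * real k)" by (simp add: dist_norm)
            also have "\<dots> \<le> 1 / 24" using k0 by (intro divide_left_mono) auto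
            finally have "Im (rho - z) < 1 / 24" using abs_Im_le_cmod[of "rho - z"] by linarith
            then show "z \<in> upper_half_plane" using I by (simp add: upper_half_plane_def)
          qed
          fix w assume "0 < norm (w - rho)" "norm (w - rho) < 1 / (24 * real k)"
          then show "c * (norm (w - rho))^2 \<le> norm (f w)" using k0 by (intro low) (simp add: field_simps)
        qed
      qed
    qed
  qed
qed

section \<open>Counting zeros\<close>

text \<open>Let \<open>c = exp (- 1 / 1200)\<close>, the bound for \<open>decay_arc\<close> at
  distance at least \<open>1 / (300 k)\<close> from the corner. With
  \<open>slack = (1 - c) / 4\<close> and \<open>contraction = (1 + c) / 2\<close> one has
  \<open>c + slack \<le> (1 - slack) * contraction\<close>, which yields both inequalities required
  by the cosine argument.\<close>

definition slack :: real where
  "slack = (1 - exp (- 1 / 1200)) / 4"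

definition contraction :: real where
  "contraction = (1 + exp (- 1 / 1200)) / 2"

lemma slack_bounds: "0 < slack" "slack < 1"
proof -
  define e where "e = exp (- 1 / 1200 :: real)"
  have "0 < e" "e < 1" by (simp_all add: e_def)
  then show "0 < slack" "slack < 1" unfolding slack_def e_def[symmetric] by simp_all
qed

lemma contraction_less_1: "contraction < 1"
proof -
  have "exp (- 1 / 1200 :: real) < 1" by simp
  then show ?thesis unfolding contraction_def by simp
qed

lemma decay_arc_away_from_corner:
  assumes "1 / 300 \<le> real k * (2 * pi / 3 - x)"
  shows "decay_arc k x + slack \<le> contraction"
    "sqrt 3 * decay_arc k x + slack \<le> (1 - slack) * sqrt 3 * contraction"
proof -
  define c where "c = exp (- 1 / 1200 :: real)"
  have c: "0 < c" "c \<le> 1" by (simp_all add: c_def)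
  have s: "slack = (1 - c) / 4" "contraction = (1 + c) / 2" by (simp_all add: slack_def contraction_def c_def)
  have d: "decay_arc k x \<le> c" unfolding decay_arc_def c_def using assms by simp
  show "decay_arc k x + slack \<le> contraction" unfolding s using d c by (simp add: field_simps)
  have s0: "0 \<le> slack" using slack_bounds by simp
  have "slack * contraction \<le> slack * 1" using s0 contraction_less_1 by (intro mult_left_mono) auto
  then have "c + slack \<le> (1 - slack) * contraction" unfolding left_diff_distrib s by (simp add: field_simps)
  then have "decay_arc k x + slack \<le> (1 - slack) * contraction" using d by linarith
  then have "sqrt 3 * (decay_arc k x + slack) \<le> sqrt 3 * ((1 - slack) * contraction)" by (rule mult_left_mono) simp
  moreover have "1 * slack \<le> sqrt 3 * slack" using s0 by (intro mult_right_mono) auto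
  ultimately show "sqrt 3 * decay_arc k x + slack \<le> (1 - slack) * sqrt 3 * contraction"
    by (simp add: distrib_left mult.commute mult.left_commute)
qed

definition well_approximated :: "nat \<Rightarrow> nat \<Rightarrow> (complex \<Rightarrow> complex) \<Rightarrow> bool" where
  "well_approximated m k f \<longleftrightarrow> arc_good m slack k f \<and> corner_good k f \<and> (\<forall>z. Im z \<ge> 2 \<longrightarrow> f z \<noteq> 0) \<and>
     16 * pi * real m \<le> real k \<and> decay k * exp (4 * pi * real m) \<le> 1 / 2"

lemma eventually_well_approximated: "\<forall>\<^sub>F k in sequentially. \<forall>f. miller m k f \<longrightarrow> well_approximated m k f"
proof -
  have 1: "\<forall>\<^sub>F k in sequentially. decay k * exp (real k / 100 + 4 * pi * real m) < 1 / 2"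
    by (intro order_tendstoD(2)[OF decay_exp_tendsto]) simp
  have 2: "\<forall>\<^sub>F k in sequentially. 16 * pi * real m \<le> real k"
    using eventually_ge_at_top[of "nat \<lceil>16 * pi * real m\<rceil>"] unfolding nat_ceiling_le_eq .
  have 3: "\<forall>\<^sub>F k in sequentially. \<forall>f. miller m k f \<longrightarrow> arc_good m slack k f"
    by (rule eventually_arc_good) (use slack_bounds in auto)
  show ?thesis using 1 2 3 eventually_corner_good[of m] eventually_no_zeros_above[of m]
  proof eventually_elim
    case (elim k)
    have "decay k * exp (4 * pi * real m) \<le> decay k * exp (real k / 100 + 4 * pi * real m)"
      using decay_nonneg[of k] by (intro mult_left_mono) auto
    then show ?case using elim unfolding well_approximated_def by auto
  qed
qed

lemma well_approximatedD:
  assumes "well_approximated m k f"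
  shows "arc_good m slack k f" "miller m k f" "k \<ge> 400" "corner_good k f" "\<And>z. Im z \<ge> 2 \<Longrightarrow> f z \<noteq> 0"
    "16 * pi * real m \<le> real k" "decay k * exp (4 * pi * real m) \<le> 1 / 2"
  using assms by (auto simp: well_approximated_def arc_good_def)

lemma exp_ln_parameter:
  assumes "z \<noteq> 0"
  shows "exp (\<i> * (- \<i> * Ln z)) = z" "Re (- \<i> * Ln z) = Im (Ln z)" "Im (- \<i> * Ln z) = - ln (norm z)"
  using assms by (simp_all flip: mult.assoc)

lemma arc_parameter:
  assumes z: "norm z \<ge> 1" "- 1 / 2 \<le> Re z" "Re z \<le> 0" "0 < Im z"
  shows "pi / 2 \<le> Im (Ln z)" "Im (Ln z) \<le> 2 * pi / 3"
proof -
  have z0: "z \<noteq> 0" using z by auto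
  define x where "x = Im (Ln z)"
  have x: "0 < x" "x < pi" using Im_Ln_pos_lt_imp[OF z(4)] by (simp_all add: x_def)
  have R: "Re z = norm z * cos x"
    using Re_exp[of "Ln z"] z0 by (simp add: x_def)
  have "cos x \<le> cos (pi / 2)" using R z(1,3) z0 by (simp add: mult_le_0_iff)
  then show "pi / 2 \<le> Im (Ln z)" using cos_mono_le_eq[of x "pi / 2"] x unfolding x_def[symmetric] by simp
  have "cos x \<le> 0" using R z(1,3) z0 by (simp add: mult_le_0_iff)
  then have "norm z * cos x \<le> 1 * cos x" using z(1) by (intro mult_right_mono_neg) auto
  then have "cos (2 * pi / 3) \<le> cos x" using z(2) R by (simp add: cos_two_pi_thirds)
  then show "Im (Ln z) \<le> 2 * pi / 3" using cos_mono_le_eq[of "2 * pi / 3" x] x unfolding x_def[symmetric] by simp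
qed

lemma rho_eq_exp: "rho = exp (\<i> * of_real (2 * pi / 3))"
proof -
  have "exp (\<i> * complex_of_real x) = Complex (cos x) (sin x)" for x
    by (simp add: complex_eq_iff Re_exp_ii Im_exp_ii)
  then show ?thesis unfolding rho_def by (simp only: cos_two_pi_thirds sin_two_pi_thirds)
qed

lemma norm_exp_minus_rho_le:
  assumes "norm (\<theta> - of_real (2 * pi / 3)) \<le> 1"
  shows "norm (exp (\<i> * \<theta>) - rho) \<le> 3 * norm (\<theta> - of_real (2 * pi / 3))"
proof -
  define d where "d = \<theta> - of_real (2 * pi / 3)"
  have "exp (\<i> * \<theta>) = rho * exp (\<i> * d)" unfolding rho_eq_exp d_def right_diff_distrib exp_diff by simp
  then have "norm (exp (\<i> * \<theta>) - rho) = norm (rho * (exp (\<i> * d) - 1))" by (simp add: right_diff_distrib)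
  also have "\<dots> = norm (exp (\<i> * d) - 1)" by (simp add: norm_mult norm_rho)
  also have "\<dots> \<le> 3 * norm (\<i> * d)" by (rule norm_exp_minus_1_le) (use assms in \<open>simp add: d_def norm_mult\<close>)
  finally show ?thesis by (simp add: d_def norm_mult)
qed

text \<open>At angular distance \<open>s\<close> from the corner the boundary
  \<open>Re z = - 1/2\<close> leaves only a height of about \<open>sqrt 3 * s\<close> above the arc.
  So closeness to the corner in angle implies closeness in the plane.\<close>

lemma height_near_corner:
  fixes s y :: real
  assumes s: "0 \<le> s" "s \<le> 1 / 10" and y: "0 \<le> y" and R: "- 1 / 2 \<le> exp y * cos (2 * pi / 3 - s)"
  shows "y \<le> 3 * s"
proof -
  have c: "2 * cos (2 * pi / 3 - s) = - (cos s - sqrt 3 * sin s)"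
    unfolding cos_diff by (simp add: cos_two_pi_thirds sin_two_pi_thirds)
  have "cos s - sqrt 3 * sin s \<ge> 1 - 2 * s"
  proof -
    have "1 - s^2 / 2 \<le> cos s" by (rule cos_ge_quadratic) (use s in auto)
    moreover have "s^2 \<le> s * (1 / 10)" unfolding power2_eq_square using s by (intro mult_left_mono) auto
    moreover have "sqrt 3 * sin s \<le> 18 / 10 * s"
    proof (intro mult_mono)
      show "sqrt 3 \<le> 18 / 10" by (rule real_le_lsqrt) (simp_all add: power2_eq_square)
      show "sin s \<le> s" by (rule sin_x_le_x) (use s in simp)
      show "0 \<le> sin s" by (rule sin_ge_zero) (use s pi_gt3 in linarith)+
    qed simp
    ultimately show ?thesis using s by linarith
  qed
  then have "(1 + y) * (1 - 2 * s) \<le> exp y * (cos s - sqrt 3 * sin s)"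
    using y s exp_ge_add_one_self[of y] by (intro mult_mono) auto
  also have "\<dots> \<le> 1"
  proof -
    have "2 * (exp y * cos (2 * pi / 3 - s)) = exp y * (2 * cos (2 * pi / 3 - s))" by simp
    also have "\<dots> = - (exp y * (cos s - sqrt 3 * sin s))" unfolding c by (rule mult_minus_right)
    finally show ?thesis using R by linarith
  qed
  finally have "y - 2 * (y * s) \<le> 2 * s" by (simp add: algebra_simps)
  moreover have "y * s \<le> y * (1 / 10)" using s y by (intro mult_left_mono) auto
  ultimately show ?thesis using s y by linarith
qed

text \<open>If the angle stays \<open>1 / (300 k)\<close> away from the corner,
  \<open>arc_fun_nonzero_off_axis\<close> excludes the zero. Otherwise \<open>z\<close> lies within
  \<open>12 s\<close> of \<open>rho\<close>, and \<open>12 / 300 < 1 / 24\<close> puts it into the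
  disc where \<open>rho\<close> is the only possible zero.\<close>

lemma zero_has_norm_1:
  assumes W: "well_approximated m k f"
    and z: "norm z \<ge> 1" "- 1 / 2 \<le> Re z" "Re z \<le> 0" "0 < Im z" and fz: "f z = 0"
  shows "norm z = 1"
proof (rule ccontr)
  assume n: "norm z \<noteq> 1"
  note W = well_approximatedD[OF W]
  have z0: "z \<noteq> 0" using z by auto
  have k0: "real k \<ge> 400" using W(3) by simp
  define \<theta> where "\<theta> = - \<i> * Ln z"
  define y where "y = ln (norm z)"
  define s where "s = 2 * pi / 3 - Re \<theta>"
  note E = exp_ln_parameter[OF z0, folded \<theta>_def y_def]
  have x: "pi / 2 \<le> Re \<theta>" "Re \<theta> \<le> 2 * pi / 3" unfolding E by (rule arc_parameter[OF z])+
  have "1 < norm z" using n z(1) by (simp add: less_le)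
  then have y: "y > 0" unfolding y_def by (rule ln_gt_zero)
  have "Im z < 2" using W(5) fz by force
  then have ky: "real k * y < 4" unfolding y_def by (intro zero_near_arc[OF W(2,6,7) z _ fz]) simp
  have "arc_fun f k m \<theta> = 0" unfolding arc_fun_def E fz by simp
  then have "\<not> 1 / 300 \<le> real k * s"
    using arc_fun_nonzero_off_axis[OF W(1) slack_bounds contraction_less_1 x _ _ decay_arc_away_from_corner[of k "Re \<theta>"]]
      ky y unfolding s_def by (auto simp: E)
  then have ks: "real k * s < 1 / 300" by simp
  have s0: "s \<ge> 0" using x by (simp add: s_def)
  have "400 * s \<le> real k * s" using k0 s0 by (intro mult_right_mono) auto
  then have s1: "s \<le> 1 / 100" using ks by linarith
  have "Re z = exp y * cos (2 * pi / 3 - s)"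
    using Re_exp[of "Ln z"] z0 by (simp add: E y_def s_def)
  then have ys: "y \<le> 3 * s" using z(2) s0 s1 y by (intro height_near_corner) auto
  have nd: "norm (\<theta> - of_real (2 * pi / 3)) \<le> 4 * s"
  proof -
    have "norm (\<theta> - of_real (2 * pi / 3)) \<le> \<bar>Re (\<theta> - of_real (2 * pi / 3))\<bar> + \<bar>Im (\<theta> - of_real (2 * pi / 3))\<bar>"
      by (rule cmod_le)
    also have "\<dots> = s + y" using s0 y E(3) unfolding s_def by simp
    finally show ?thesis using ys by linarith
  qed
  have "norm (exp (\<i> * \<theta>) - rho) \<le> 3 * norm (\<theta> - of_real (2 * pi / 3))"
    by (rule norm_exp_minus_rho_le) (use nd s1 in linarith)
  then have "norm (z - rho) \<le> 12 * s" unfolding E(1) using nd by linarith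
  then have "real k * norm (z - rho) \<le> real k * (12 * s)" by (rule mult_left_mono) simp
  then have "real k * norm (z - rho) \<le> 1 / 24" using ks by linarith
  then have "z = rho" using W(4) fz unfolding corner_good_def by blast
  then show False using n norm_rho by simp
qed

text \<open>A zero in the right half is reflected to \<open>- cnj z\<close> in the left half, where
  it must have norm 1; but points of the right half have norm greater than 1.\<close>

lemma zero_in_fundamental_domain:
  assumes W: "well_approximated m k f" and z: "z \<in> fundamental_domain" and fz: "f z = 0"
  obtains x where "pi / 2 \<le> x" "x \<le> 2 * pi / 3" "z = exp (\<i> * of_real x)"
proof -
  note solution = that
  have left: thesis if l: "norm z \<ge> 1" "- 1 / 2 \<le> Re z" "Re z \<le> 0" "0 < Im z"
  proof -
    have "norm z = 1" by (rule zero_has_norm_1[OF W l fz])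
    then have "Ln z = \<i> * of_real (Im (Ln z))" using l by (auto simp: complex_eq_iff)
    moreover have "exp (Ln z) = z" using l by (intro exp_Ln) auto
    ultimately have "z = exp (\<i> * of_real (Im (Ln z)))" by metis
    then show thesis using arc_parameter[OF l] solution by blast
  qed
  show thesis
  proof (cases "Re z \<le> 0")
    case True
    then show thesis using z left by (auto simp: fundamental_domain_def)
  next
    case False
    then have z: "norm z > 1" "0 < Re z" "Re z < 1/2" "0 < Im z" using z by (auto simp: fundamental_domain_def)
    have "(Re z)^2 \<le> (1/2)^2" using z by (intro power_mono) auto
    moreover have "1 \<le> (Re z)^2 + (Im z)^2" using z(1) by (metis cmod_power2 less_imp_le one_le_power)
    ultimately have "(4/5)^2 \<le> (Im z)^2" by (simp add: power2_eq_square)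
    then have I: "4/5 \<le> Im z" by (rule power2_le_imp_le) (use z in simp)
    have "f (- cnj z) = 0" using miller_reflection[OF well_approximatedD(2)[OF W] I] fz by simp
    then have "norm (- cnj z) = 1" using z by (intro zero_has_norm_1[OF W]) auto
    then show thesis using z by simp
  qed
qed

lemma arc_in_fundamental_domain:
  assumes "pi / 2 \<le> x" "x \<le> 2 * pi / 3"
  shows "exp (\<i> * of_real x) \<in> fundamental_domain"
proof -
  have "cos x \<le> cos (pi / 2)" using assms pi_gt_zero by (intro cos_monotone_0_pi_le) auto
  moreover have "cos (2 * pi / 3) \<le> cos x" using assms pi_gt_zero by (intro cos_monotone_0_pi_le) auto
  moreover have "sin x > 0" using assms pi_gt_zero by (intro sin_gt_zero) linarith+
  ultimately show ?thesis
    by (simp add: fundamental_domain_def Re_exp_ii Im_exp_ii cos_two_pi_thirds)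
qed

lemma inj_on_arc: "inj_on (\<lambda>x. exp (\<i> * complex_of_real x)) {pi / 2..2 * pi / 3}"
proof (rule inj_onI)
  fix x y assume xy: "x \<in> {pi / 2..2 * pi / 3}" "y \<in> {pi / 2..2 * pi / 3}"
    and e: "exp (\<i> * complex_of_real x) = exp (\<i> * of_real y)"
  have "cos x = cos y" using arg_cong[OF e, of Re] by (simp add: Re_exp_ii)
  moreover have "0 \<le> x" "x \<le> pi" "0 \<le> y" "y \<le> pi" using xy pi_gt_zero unfolding atLeastAtMost_iff by linarith+
  ultimately show "x = y" by (rule cos_inj_pi[rotated -1])
qed

section \<open>Zeros on the arc against half periods of the phase\<close>

definition arc_zeros :: "(complex \<Rightarrow> complex) \<Rightarrow> nat \<Rightarrow> nat \<Rightarrow> real \<Rightarrow> real \<Rightarrow> real set" where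
  "arc_zeros f k m a b = {x \<in> {a..b}. real_arc_fun f k m x = 0}"

lemma arc_zero_away_from_corner:
  assumes W: "well_approximated m k f" and x: "pi / 2 \<le> x" "x < 2 * pi / 3" "real_arc_fun f k m x = 0"
  shows "1 / 300 \<le> real k * (2 * pi / 3 - x)"
proof (rule ccontr)
  assume n: "\<not> 1 / 300 \<le> real k * (2 * pi / 3 - x)"
  note W = well_approximatedD[OF W]
  define s where "s = 2 * pi / 3 - x"
  have s: "s > 0" "real k * s < 1 / 300" using x n by (auto simp: s_def)
  have "400 * s \<le> real k * s" using W(3) s by (intro mult_right_mono) auto
  then have s1: "s \<le> 1 / 100" using s by linarith
  have d: "norm (complex_of_real x - of_real (2 * pi / 3)) = s"
    unfolding of_real_diff[symmetric] norm_of_real s_def using x by simp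
  have "norm (exp (\<i> * of_real x) - rho) \<le> 3 * s"
    using norm_exp_minus_rho_le[of "of_real x"] s1 unfolding d by simp
  then have "real k * norm (exp (\<i> * of_real x) - rho) \<le> real k * (3 * s)" by (rule mult_left_mono) simp
  then have "real k * norm (exp (\<i> * of_real x) - rho) \<le> 1 / 24" using s(2) by linarith
  moreover have "f (exp (\<i> * of_real x)) = 0" using arc_zero_iff[OF W(2), of x] x by simp
  ultimately have "exp (\<i> * of_real x) = rho" using W(4) unfolding corner_good_def by blast
  then have "x = 2 * pi / 3"
    using x pi_gt_zero unfolding rho_eq_exp by (intro inj_onD[OF inj_on_arc]) auto
  then show False using x by simp
qed

text \<open>The corner is left out because \<open>decay_arc\<close> equals 1 there and the Wronskian
  estimate breaks down. Any other zero on the arc is far enough from the corner for it.\<close>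

lemma floor_phase_inj_on:
  assumes W: "well_approximated m k f" and ab: "pi / 2 \<le> a" "b \<le> 2 * pi / 3"
  shows "inj_on (\<lambda>x. \<lfloor>real_phase k m x / pi\<rfloor>) (arc_zeros f k m a b - {2 * pi / 3})"
proof -
  have *: "\<lfloor>real_phase k m x / pi\<rfloor> \<noteq> \<lfloor>real_phase k m y / pi\<rfloor>"
    if "x \<in> arc_zeros f k m a b - {2 * pi / 3}" "y \<in> arc_zeros f k m a b - {2 * pi / 3}" "x < y" for x y
  proof -
    have "1 / 300 \<le> real k * (2 * pi / 3 - y)"
      by (rule arc_zero_away_from_corner[OF W]) (use that ab in \<open>auto simp: arc_zeros_def\<close>)
    then show ?thesis
      using that ab
      by (intro zeros_in_same_cell[OF well_approximatedD(1)[OF W] slack_bounds contraction_less_1] decay_arc_away_from_corner)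
         (auto simp: arc_zeros_def)
  qed
  show ?thesis
  proof (rule inj_onI, rule ccontr)
    fix x y assume "x \<in> arc_zeros f k m a b - {2 * pi / 3}" "y \<in> arc_zeros f k m a b - {2 * pi / 3}"
      "\<lfloor>real_phase k m x / pi\<rfloor> = \<lfloor>real_phase k m y / pi\<rfloor>" "x \<noteq> y"
    then show False using *[of x y] *[of y x] by linarith
  qed
qed

lemma arc_zeros_upper:
  assumes W: "well_approximated m k f" and ab: "pi / 2 \<le> a" "a < b" "b \<le> 2 * pi / 3"
  shows "finite (arc_zeros f k m a b)"
    "real (card (arc_zeros f k m a b - {2 * pi / 3})) \<le> (real_phase k m b - real_phase k m a) / pi + 2"
proof -
  define c where "c = (\<lambda>x. \<lfloor>real_phase k m x / pi\<rfloor>)"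
  have mono: "real_phase k m x / pi \<le> real_phase k m y / pi" if "x \<le> y" for x y
    using real_phase_strict_mono[OF well_approximatedD(1)[OF W] slack_bounds(2), of x y] that
    by (intro divide_right_mono) (auto simp: le_less)
  have sub: "c ` (arc_zeros f k m a b - {2 * pi / 3}) \<subseteq> {c a..c b}"
    unfolding c_def by (auto simp: arc_zeros_def intro!: floor_mono mono)
  have inj: "inj_on c (arc_zeros f k m a b - {2 * pi / 3})"
    unfolding c_def by (rule floor_phase_inj_on[OF W ab(1,3)])
  have "finite (arc_zeros f k m a b - {2 * pi / 3})"
    by (rule inj_on_finite[OF inj sub]) simp
  then show "finite (arc_zeros f k m a b)" by simp
  have "card (arc_zeros f k m a b - {2 * pi / 3}) \<le> card {c a..c b}"
    by (rule card_inj_on_le[OF inj sub]) simp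
  then have "real (card (arc_zeros f k m a b - {2 * pi / 3})) \<le> real_of_int (c b + 1 - c a)"
    using floor_mono[OF mono[of a b]] ab(2) by (simp add: c_def)
  also have "\<dots> \<le> real_phase k m b / pi - real_phase k m a / pi + 2"
    unfolding c_def by linarith
  finally show "real (card (arc_zeros f k m a b - {2 * pi / 3})) \<le> (real_phase k m b - real_phase k m a) / pi + 2"
    by (simp add: diff_divide_distrib)
qed

text \<open>At multiples of \<open>\<pi>\<close> the cosine term has modulus 2, while the remainder
  is at most \<open>1 + slack < 2\<close>. This bound persists up to the corner, so sign changes are
  available on the whole arc.\<close>

lemma real_arc_fun_sign:
  assumes W: "well_approximated m k f" and x: "pi / 2 \<le> x" "x \<le> 2 * pi / 3" and p: "real_phase k m x = of_int j * pi"
  shows "(if even j then 1 else - 1) * real_arc_fun f k m x > 0"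
proof -
  have g: "arc_good m slack k f" by (rule well_approximatedD(1)[OF W])
  have "norm (arc_rest f k m (of_real x)) \<le> decay_arc k x + slack"
    using g x unfolding arc_good_def by (auto dest!: spec[of _ "of_real x"])
  then have "norm (arc_rest f k m (of_real x)) < 2"
    using decay_arc_le_1[OF x(2), of k] slack_bounds by linarith
  then have "\<bar>Re (arc_rest f k m (of_real x))\<bar> < 2" using abs_Re_le_cmod by (rule le_less_trans[rotated])
  then have r: "- 2 < Re (arc_rest f k m (of_real x))" "Re (arc_rest f k m (of_real x)) < 2" by linarith+
  have c: "cos (of_int j * pi) = (if even j then 1 else - 1 :: real)"
    using cos_npi_int[of j] by (simp add: mult.commute)
  show ?thesis unfolding real_arc_fun_eq p c using r by auto
qed

lemma arc_zero_in_cell: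
  assumes W: "well_approximated m k f" and ab: "pi / 2 \<le> a" "b \<le> 2 * pi / 3"
    and j: "real_phase k m a \<le> of_int j * pi" "(of_int j + 1) * pi \<le> real_phase k m b"
  shows "j \<in> (\<lambda>x. \<lfloor>real_phase k m x / pi\<rfloor>) ` arc_zeros f k m a b"
proof -
  note W' = well_approximatedD[OF W]
  have P: "isCont (real_phase k m) x" for x by (rule DERIV_isCont[OF real_phase_deriv])
  have sm: "real_phase k m x < real_phase k m y" if "x < y" for x y
    by (rule real_phase_strict_mono[OF W'(1) slack_bounds(2) that])
  have less: "x < y" if "real_phase k m x < real_phase k m y" for x y
    using that sm[of y x] by (metis less_asym linorder_neqE)
  have jj: "of_int j * pi < (of_int j + 1) * pi" by simp
  have ab': "a < b" by (rule less) (use j jj in linarith)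
  have ex: "\<exists>x. a \<le> x \<and> x \<le> b \<and> real_phase k m x = t" if "real_phase k m a \<le> t" "t \<le> real_phase k m b" for t
    by (rule IVT[where f = "real_phase k m" and a = a and b = b and y = t, OF that]) (use ab' P in auto)
  have ju: "of_int j * pi \<le> real_phase k m b" using j jj by linarith
  have jv: "real_phase k m a \<le> of_int (j + 1) * pi" "of_int (j + 1) * pi \<le> real_phase k m b"
    using j jj unfolding of_int_add of_int_1 by linarith+
  obtain u where u: "a \<le> u" "u \<le> b" "real_phase k m u = of_int j * pi" using ex[OF j(1) ju] by blast
  obtain v where v: "a \<le> v" "v \<le> b" "real_phase k m v = of_int (j + 1) * pi" using ex[OF jv] by blast
  have uv: "u < v" by (rule less) (simp add: u v)
  have R: "isCont (real_arc_fun f k m) x" if "u \<le> x" "x \<le> v" for x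
    by (rule DERIV_isCont[OF real_arc_fun_deriv[OF W'(2)]]) (use that u v ab in linarith)+
  have su: "(if even j then 1 else - 1) * real_arc_fun f k m u > 0"
    by (rule real_arc_fun_sign[OF W _ _ u(3)]) (use u ab in linarith)+
  have sv: "(if even (j + 1) then 1 else - 1) * real_arc_fun f k m v > 0"
    by (rule real_arc_fun_sign[OF W _ _ v(3)]) (use v ab in linarith)+
  have "\<exists>x. u \<le> x \<and> x \<le> v \<and> real_arc_fun f k m x = 0"
  proof (cases "even j")
    case True
    then show ?thesis using su sv uv R by (intro IVT2) auto
  next
    case False
    then show ?thesis using su sv uv R by (intro IVT) auto
  qed
  then obtain x where x: "u \<le> x" "x \<le> v" "real_arc_fun f k m x = 0" by blast
  have "x \<noteq> u" "x \<noteq> v" using su sv x(3) by auto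
  then have "u < x" "x < v" using x by auto
  from sm[OF this(1)] sm[OF this(2)] have "of_int j * pi < real_phase k m x" "real_phase k m x < of_int (j + 1) * pi"
    using u v by simp_all
  then have "\<lfloor>real_phase k m x / pi\<rfloor> = j"
    by (intro floor_unique) (auto simp: le_divide_eq divide_less_eq)
  moreover have "x \<in> arc_zeros f k m a b" using x u v by (simp add: arc_zeros_def)
  ultimately show ?thesis by blast
qed

lemma arc_zeros_lower:
  assumes W: "well_approximated m k f" and ab: "pi / 2 \<le> a" "a < b" "b \<le> 2 * pi / 3"
  shows "(real_phase k m b - real_phase k m a) / pi - 2 \<le> real (card (arc_zeros f k m a b))"
proof -
  define c where "c = (\<lambda>x. \<lfloor>real_phase k m x / pi\<rfloor>)"
  define i where "i = \<lceil>real_phase k m a / pi\<rceil>"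
  have fin: "finite (arc_zeros f k m a b)" by (rule arc_zeros_upper[OF W ab])
  have "{i..<c b} \<subseteq> c ` arc_zeros f k m a b"
  proof
    fix j assume j: "j \<in> {i..<c b}"
    have "real_phase k m a / pi \<le> of_int j" using j by (simp add: i_def ceiling_le_iff)
    moreover have "of_int (j + 1) \<le> real_phase k m b / pi" using j unfolding le_floor_iff[symmetric] c_def by simp
    ultimately show "j \<in> c ` arc_zeros f k m a b"
      unfolding c_def by (intro arc_zero_in_cell[OF W ab(1,3)]) (simp_all add: divide_le_eq le_divide_eq)
  qed
  then have "card {i..<c b} \<le> card (c ` arc_zeros f k m a b)" by (rule card_mono[rotated]) (use fin in simp)
  also have "\<dots> \<le> card (arc_zeros f k m a b)" by (rule card_image_le[OF fin])
  finally have "real_of_int (c b - i) \<le> real (card (arc_zeros f k m a b))" by simp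
  moreover have "real_phase k m b / pi - real_phase k m a / pi - 2 \<le> real_of_int (c b - i)"
    unfolding c_def i_def by linarith
  ultimately show ?thesis by (simp add: diff_divide_distrib)
qed

text \<open>The error consists of \<open>4 m\<close> from the cosine summand of the phase, 2 from
  incomplete cells at the two ends, and 2 from a possible zero at the corner of multiplicity at most
  2.\<close>

lemma zero_count_arc:
  assumes W: "well_approximated m k f" and ab: "pi / 2 \<le> a" "a < b" "b \<le> 2 * pi / 3"
    and S: "{z \<in> S. f z = 0} = (\<lambda>x. exp (\<i> * complex_of_real x)) ` arc_zeros f k m a b"
  shows "\<bar>real_of_int (zero_count f S) - real k * (b - a) / (2 * pi)\<bar> \<le> 4 * real m + 4"
proof -
  note W' = well_approximatedD[OF W]
  define Z where "Z = arc_zeros f k m a b"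
  define ord where "ord = (\<lambda>x. zorder f (exp (\<i> * complex_of_real x)))"
  note fin = arc_zeros_upper(1)[OF W ab, folded Z_def]
  have "Z \<subseteq> {pi / 2..2 * pi / 3}" using ab unfolding Z_def arc_zeros_def by auto
  then have "inj_on (\<lambda>x. exp (\<i> * complex_of_real x)) Z" by (rule inj_on_subset[OF inj_on_arc])
  then have "zero_count f S = (\<Sum>x\<in>Z. ord x)"
    unfolding zero_count_def S ord_def Z_def by (simp add: sum.reindex)
  moreover have one: "ord x = 1" if "x \<in> Z - {2 * pi / 3}" for x
  proof -
    have x: "pi / 2 \<le> x" "x < 2 * pi / 3" "real_arc_fun f k m x = 0" using that ab by (auto simp: Z_def arc_zeros_def)
    have "1 / 300 \<le> real k * (2 * pi / 3 - x)" by (rule arc_zero_away_from_corner[OF W x])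
    then show ?thesis unfolding ord_def using x arc_zero_iff[OF W'(2), of x]
      by (intro simple_zero_on_arc[OF W'(1) slack_bounds contraction_less_1] decay_arc_away_from_corner) auto
  qed
  then have s1: "(\<Sum>x\<in>Z - {2 * pi / 3}. ord x) = int (card (Z - {2 * pi / 3}))" by simp
  moreover have two: "1 \<le> ord (2 * pi / 3) \<and> ord (2 * pi / 3) \<le> 2" if "2 * pi / 3 \<in> Z"
  proof -
    have "real_arc_fun f k m (2 * pi / 3) = 0" using that unfolding Z_def arc_zeros_def by blast
    then have "f rho = 0" using arc_zero_iff[OF W'(2), of "2 * pi / 3"] unfolding rho_eq_exp by simp
    then have "zorder f rho = 1 \<or> zorder f rho = 2" using W'(4) by (simp add: corner_good_def)
    then show ?thesis unfolding ord_def rho_eq_exp[symmetric] by auto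
  qed
  ultimately have "int (card Z) \<le> zero_count f S \<and> zero_count f S \<le> int (card (Z - {2 * pi / 3})) + 2"
  proof (cases "2 * pi / 3 \<in> Z")
    case True
    have "(\<Sum>x\<in>Z. ord x) = ord (2 * pi / 3) + (\<Sum>x\<in>Z - {2 * pi / 3}. ord x)" by (rule sum.remove[OF fin True])
    moreover have "card Z = Suc (card (Z - {2 * pi / 3}))" by (rule card.remove[OF fin True])
    ultimately show ?thesis using two[OF True] s1 \<open>zero_count f S = (\<Sum>x\<in>Z. ord x)\<close> by linarith
  next
    case False
    then have "Z - {2 * pi / 3} = Z" by blast
    then show ?thesis using s1 \<open>zero_count f S = (\<Sum>x\<in>Z. ord x)\<close> by simp
  qed
  then have "real (card Z) \<le> real_of_int (zero_count f S)"
    "real_of_int (zero_count f S) \<le> real (card (Z - {2 * pi / 3})) + 2"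
    by linarith+
  moreover have "(real_phase k m b - real_phase k m a) / pi = real k * (b - a) / (2 * pi) + 2 * real m * (cos b - cos a)"
    unfolding real_phase_def by (simp add: field_simps)
  moreover have "\<bar>2 * real m * (cos b - cos a)\<bar> \<le> 2 * real m * 2"
  proof -
    have "\<bar>cos b - cos a\<bar> \<le> 2"
      using cos_ge_minus_one[of a] cos_le_one[of a] cos_ge_minus_one[of b] cos_le_one[of b] by linarith
    then show ?thesis unfolding abs_mult by (intro mult_mono) auto
  qed
  moreover note arc_zeros_upper(2)[OF W ab, folded Z_def] arc_zeros_lower[OF W ab, folded Z_def]
  ultimately show ?thesis by linarith
qed

lemma zeros_in_arc_segment:
  assumes W: "well_approximated m k f" and ab: "pi / 2 \<le> a" "b \<le> 2 * pi / 3"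
  shows "{z \<in> {z \<in> fundamental_domain. \<exists>\<theta>\<in>{a..b}. z = exp (\<i> * of_real \<theta>)}. f z = 0}
     = (\<lambda>x. exp (\<i> * complex_of_real x)) ` arc_zeros f k m a b"
  using arc_zero_iff[OF well_approximatedD(2)[OF W]] arc_in_fundamental_domain ab
  by (fastforce simp: arc_zeros_def)

lemma zeros_in_fundamental_domain:
  assumes W: "well_approximated m k f"
  shows "{z \<in> fundamental_domain. f z = 0} = (\<lambda>x. exp (\<i> * complex_of_real x)) ` arc_zeros f k m (pi / 2) (2 * pi / 3)"
proof -
  have "\<exists>\<theta>\<in>{pi / 2..2 * pi / 3}. z = exp (\<i> * of_real \<theta>)" if "z \<in> fundamental_domain" "f z = 0" for z
    using zero_in_fundamental_domain[OF W that] by (metis atLeastAtMost_iff)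
  then have "{z \<in> fundamental_domain. f z = 0}
    = {z \<in> {z \<in> fundamental_domain. \<exists>\<theta>\<in>{pi / 2..2 * pi / 3}. z = exp (\<i> * of_real \<theta>)}. f z = 0}"
    by blast
  then show ?thesis using zeros_in_arc_segment[OF W] by simp
qed

text \<open>\<open>N - p * D\<close> is at most \<open>2 C\<close> because both counts share the
  error bound \<open>C\<close>, and the condition on \<open>K\<close> makes \<open>D\<close> larger
  than \<open>2 C / \<epsilon>\<close>.\<close>

lemma ratio_estimate:
  fixes N D K p C \<epsilon> :: real
  assumes N: "\<bar>N - p * K\<bar> \<le> C" and D: "\<bar>D - K\<bar> \<le> C" and p: "0 \<le> p" "p \<le> 1" and C: "0 \<le> C" and \<epsilon>: "0 < \<epsilon>"
    and K: "C + 2 * C / \<epsilon> < K"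
  shows "\<bar>N / D - p\<bar> < \<epsilon>"
proof -
  have "2 * C / \<epsilon> < D" using D K by linarith
  moreover have "0 \<le> 2 * C / \<epsilon>" using C \<epsilon> by simp
  ultimately have "D > 0" by linarith
  moreover have "2 * C < \<epsilon> * D" using \<open>2 * C / \<epsilon> < D\<close> \<epsilon> by (simp add: divide_less_eq mult.commute)
  ultimately have D0: "D > 0" "2 * C < \<epsilon> * D" .
  have "\<bar>p * (D - K)\<bar> \<le> 1 * C" unfolding abs_mult using p D C by (intro mult_mono) auto
  moreover have "N - p * D = (N - p * K) - p * (D - K)" by (simp add: algebra_simps)
  ultimately have "\<bar>N - p * D\<bar> \<le> 2 * C" using N by linarith
  then have "\<bar>N - p * D\<bar> < \<epsilon> * D" using D0 by linarith
  moreover have "N / D - p = (N - p * D) / D" using D0 by (simp add: field_simps)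
  ultimately show ?thesis using D0 by (simp add: divide_less_eq)
qed

lemma miller_form_well_approximated:
  assumes "m \<ge> 1"
  obtains k0 where "\<And>l k' f. k' \<in> {0, 4, 6, 8, 10, 14} \<Longrightarrow> m \<le> l \<Longrightarrow> k0 \<le> l \<Longrightarrow> miller_form (12 * l + k') l m f
    \<Longrightarrow> well_approximated m (12 * l + k') f"
proof -
  obtain k0 where k0: "\<And>k f. k0 \<le> k \<Longrightarrow> miller m k f \<Longrightarrow> well_approximated m k f"
    using eventually_well_approximated[of m] unfolding eventually_sequentially by blast
  show thesis
  proof (rule that)
    fix l k' f assume "k' \<in> {0, 4, 6, 8, 10, 14 :: nat}" "m \<le> l" "k0 \<le> l" "miller_form (12 * l + k') l m f"
    then have "miller m (12 * l + k') f" "k0 \<le> 12 * l + k'" using assms unfolding miller_def by (blast, simp)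
    then show "well_approximated m (12 * l + k') f" by (rule k0[rotated])
  qed
qed

theorem theorem1p1:
  fixes m :: nat
  assumes "m \<ge> 1"
  shows "(\<exists>\<alpha> \<beta> :: real. \<alpha> > 0 \<and> \<beta> > 0 \<and>
            (\<forall>l k' f. k' \<in> {0, 4, 6, 8, 10, 14} \<and> m \<le> l \<and> real l > \<alpha> * real m + \<beta> \<and>
                 miller_form (12 * l + k') l m f \<longrightarrow>
                 (\<forall>z\<in>fundamental_domain. f z = 0 \<longrightarrow> z \<in> arcA))) \<and>
         (\<forall>a b :: real. pi / 2 \<le> a \<and> a < b \<and> b \<le> 2 * pi / 3 \<longrightarrow>
            (\<forall>\<epsilon> > 0. \<exists>L. \<forall>l k' f. L \<le> l \<and> k' \<in> {0, 4, 6, 8, 10, 14} \<and> m \<le> l \<and>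
                 miller_form (12 * l + k') l m f \<longrightarrow>
                 \<bar>real_of_int (zero_count f
                      {z \<in> fundamental_domain. \<exists>\<theta>\<in>{a..b}. z = exp (\<i> * of_real \<theta>)})
                   / real_of_int (zero_count f fundamental_domain)
                   - (b - a) / (2 * pi / 3 - pi / 2)\<bar> < \<epsilon>))"
proof -
  obtain k0 where k0: "\<And>l k' f. k' \<in> {0, 4, 6, 8, 10, 14} \<Longrightarrow> m \<le> l \<Longrightarrow> k0 \<le> l \<Longrightarrow> miller_form (12 * l + k') l m f
    \<Longrightarrow> well_approximated m (12 * l + k') f"
    using miller_form_well_approximated[OF assms] by blast
  show ?thesis
  proof (intro conjI allI impI)
    show "\<exists>\<alpha> \<beta> :: real. \<alpha> > 0 \<and> \<beta> > 0 \<and>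
            (\<forall>l k' f. k' \<in> {0, 4, 6, 8, 10, 14} \<and> m \<le> l \<and> real l > \<alpha> * real m + \<beta> \<and>
                 miller_form (12 * l + k') l m f \<longrightarrow> (\<forall>z\<in>fundamental_domain. f z = 0 \<longrightarrow> z \<in> arcA))"
    \<comment> \<open>As \<open>m\<close> is fixed, the whole threshold is placed in
      \<open>\<beta>\<close>, through \<open>k0\<close>; the value 1 for \<open>\<alpha>\<close> is
      an arbitrary positive choice.\<close>
    proof (rule exI[of _ 1], rule exI[of _ "real k0 + 1"], intro conjI allI impI ballI)
      fix l k' f z
      assume "k' \<in> {0, 4, 6, 8, 10, 14} \<and> m \<le> l \<and> real l > 1 * real m + (real k0 + 1) \<and> miller_form (12 * l + k') l m f"
      then have "well_approximated m (12 * l + k') f" by (intro k0) auto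
      moreover assume "z \<in> fundamental_domain" "f z = 0"
      ultimately show "z \<in> arcA" by (rule zero_in_fundamental_domain) (auto simp: arcA_def)
    qed simp_all
  next
    fix a b \<epsilon> :: real assume ab: "pi / 2 \<le> a \<and> a < b \<and> b \<le> 2 * pi / 3" and \<epsilon>: "\<epsilon> > 0"
    define C where "C = 4 * real m + 4"
    \<comment> \<open>The second entry is the threshold of \<open>ratio_estimate\<close> for
      \<open>K = k / 12\<close>, which is at least \<open>l\<close>.\<close>
    define L where "L = max k0 (nat \<lceil>C + 2 * C / \<epsilon>\<rceil> + 1)"
    show "\<exists>L. \<forall>l k' f. L \<le> l \<and> k' \<in> {0, 4, 6, 8, 10, 14} \<and> m \<le> l \<and> miller_form (12 * l + k') l m f \<longrightarrow>
                 \<bar>real_of_int (zero_count f {z \<in> fundamental_domain. \<exists>\<theta>\<in>{a..b}. z = exp (\<i> * of_real \<theta>)})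
                   / real_of_int (zero_count f fundamental_domain) - (b - a) / (2 * pi / 3 - pi / 2)\<bar> < \<epsilon>"
    proof (rule exI[of _ L], intro allI impI)
      fix l k' f
      assume h: "L \<le> l \<and> k' \<in> {0, 4, 6, 8, 10, 14} \<and> m \<le> l \<and> miller_form (12 * l + k') l m f"
      define k where "k = 12 * l + k'"
      have W: "well_approximated m k f" unfolding k_def using h by (intro k0) (auto simp: L_def)
      show "\<bar>real_of_int (zero_count f {z \<in> fundamental_domain. \<exists>\<theta>\<in>{a..b}. z = exp (\<i> * of_real \<theta>)})
                   / real_of_int (zero_count f fundamental_domain) - (b - a) / (2 * pi / 3 - pi / 2)\<bar> < \<epsilon>"
      \<comment> \<open>\<open>k / 12\<close> is the expected total: the zeros have density
        \<open>k / (2 \<pi>)\<close> in the angle, and the arc has length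
        \<open>\<pi> / 6\<close>.\<close>
      proof (rule ratio_estimate[of _ _ "real k / 12" C])
        have "(b - a) / (2 * pi / 3 - pi / 2) * (real k / 12) = real k * (b - a) / (2 * pi)" by (simp add: field_simps)
        then show "\<bar>real_of_int (zero_count f {z \<in> fundamental_domain. \<exists>\<theta>\<in>{a..b}. z = exp (\<i> * of_real \<theta>)})
            - (b - a) / (2 * pi / 3 - pi / 2) * (real k / 12)\<bar> \<le> C"
          unfolding C_def using zero_count_arc[OF W _ _ _ zeros_in_arc_segment[OF W]] ab by simp
        have "real k * (2 * pi / 3 - pi / 2) / (2 * pi) = real k / 12" by (simp add: field_simps)
        then show "\<bar>real_of_int (zero_count f fundamental_domain) - real k / 12\<bar> \<le> C"
          unfolding C_def using zero_count_arc[OF W _ _ _ zeros_in_fundamental_domain[OF W]] pi_gt_zero by simp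
        show "0 \<le> (b - a) / (2 * pi / 3 - pi / 2)" "(b - a) / (2 * pi / 3 - pi / 2) \<le> 1"
          using ab pi_gt_zero by (simp_all add: divide_le_eq)
        show "0 \<le> C" by (simp add: C_def)
        have "C + 2 * C / \<epsilon> < real L" unfolding L_def by linarith
        also have "\<dots> \<le> real k / 12" using h by (simp add: k_def)
        finally show "C + 2 * C / \<epsilon> < real k / 12" .
      qed (rule \<epsilon>)
    qed
  qed
qed

end
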